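(* Let $X$ be a compact geodesic space and $\varepsilon>0$. Then $\pi_\varepsilon(X)$ is either trivial or is generated by a finite collection $[\lambda_1]_\varepsilon,\dots,[\lambda_n]_\varepsilon$, where each $\lambda_i$ is an $\varepsilon$-refinement of a $\delta$-lollichain with $\delta\ge\varepsilon$ (where $\delta$ may depend on $i$). In particular, if $X$ is semilocally simply connected and not simply connected then $\pi_1(X)$ is generated by a finite collection of (homotopy) equivalence classes of geodesic lollipops.
   Context: A geodesic is an arclength-parameterized path whose length equals the distance between its endpoints; a geodesic space is a metric space in which any two points are joined by a geodesic. Fix a base point $*\in X$. For $\varepsilon>0$, an $\varepsilon$-chain is a finite sequence $\{x_0,\dots,x_n\}$ in $X$ with $d(x_i,x_{i+1})<\varepsilon$ for all $i$; it is an $\varepsilon$-loop if $x_0=x_n$. An $\varepsilon$-homotopy is a finite sequence of $\varepsilon$-chains, each obtained from its predecessor by adding or removing a single point, endpoints always fixed; $[\alpha]_\varepsilon$ is the $\varepsilon$-homotopy class of $\alpha$, and an $\varepsilon$-loop is $\varepsilon$-null if it is $\varepsilon$-homotopic to a trivial (one-point) chain. $\pi_\varepsilon(X)$ is the group of classes of $\varepsilon$-loops based at $*$ under concatenation. A refinement of a chain is obtained by inserting, between each pair of consecutive points, some subdivision chain of a geodesic joining them; it is an $\varepsilon$-refinement if it is an $\varepsilon$-chain, and a midpoint refinement if exactly a midpoint is inserted between each consecutive pair. A $\delta$-triad is a triple $T=\{x_0,x_1,x_2\}$ with $d(x_i,x_j)=\delta$ for $i\neq j$; put $\alpha_T=\{x_0,x_1,x_2,x_0\}$.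 $T$ is essential if some (equivalently any) $\delta$-refinement of $\alpha_T$ is not $\delta$-null. An essential $\delta$-circle is the image of a loop (of length $3\delta$) obtained by joining the three points of an essential $\delta$-triad by geodesics; an essential circle is an essential $\delta$-circle for some $\delta>0$. A $\delta$-lollichain is a $\delta$-loop of the form $k*c*\overline k$, where $k$ is a $\delta$-chain starting at $*$, $\overline k$ its reversal, and $c$ is a midpoint refinement of (the loop $\alpha_T$ of) an essential $\delta$-triad $T$. A lollipop is a path of the form $k*c*\overline k$, where $k$ is a path starting at $*$ and $c$ is an arclength parameterization of an essential circle; it is a geodesic lollipop if $k$ is locally length minimizing (possibly not minimal). *)

theory Defs
  imports "HOL-Analysis.Analysis" "HOL-Algebra.Elementary_Groups"
begin

section \<open>Geodesics\<close>

text \<open>Length of \<open>g\<close> on \<open>[a, b]\<close>: the supremum over all finite sequences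
  \<open>a \<le> t\<^sub>0 \<le> \<dots> \<le> t\<^sub>m \<le> b\<close>.\<close>

definition path_length :: "(real \<Rightarrow> 'a::metric_space) \<Rightarrow> real \<Rightarrow> real \<Rightarrow> ennreal" where
  "path_length g a b =
     (SUP ts \<in> {ts. sorted ts \<and> set ts \<subseteq> {a..b}}.
        ennreal (\<Sum>i<length ts - 1. dist (g (ts ! i)) (g (ts ! Suc i))))"

definition arclength_parameterized :: "(real \<Rightarrow> 'a::metric_space) \<Rightarrow> real \<Rightarrow> real \<Rightarrow> bool" where
  "arclength_parameterized g a b \<longleftrightarrow> continuous_on {a..b} g \<and>
     (\<forall>s t. a \<le> s \<and> s \<le> t \<and> t \<le> b \<longrightarrow> path_length g s t = ennreal (t - s))"

text \<open>An arclength-parameterized path has length equal to the length of its domain, so a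
  geodesic from \<open>x\<close> to \<open>y\<close> is defined on \<open>[0, dist x y]\<close>.\<close>

definition geodesic :: "'a::metric_space set \<Rightarrow> (real \<Rightarrow> 'a) \<Rightarrow> 'a \<Rightarrow> 'a \<Rightarrow> bool" where
  "geodesic X g x y \<longleftrightarrow> g ` {0..dist x y} \<subseteq> X \<and> g 0 = x \<and> g (dist x y) = y \<and>
     arclength_parameterized g 0 (dist x y)"

definition geodesic_space :: "'a::metric_space set \<Rightarrow> bool" where
  "geodesic_space X \<longleftrightarrow> (\<forall>x\<in>X. \<forall>y\<in>X. \<exists>g. geodesic X g x y)"


section \<open>Discrete homotopy\<close>

definition eps_chain :: "'a::metric_space set \<Rightarrow> real \<Rightarrow> 'a list \<Rightarrow> bool" where
  "eps_chain X \<epsilon> \<alpha> \<longleftrightarrow> \<alpha> \<noteq> [] \<and> set \<alpha> \<subseteq> X \<and> successively (\<lambda>x y. dist x y < \<epsilon>) \<alpha>"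

definition eps_loop :: "'a::metric_space set \<Rightarrow> real \<Rightarrow> 'a \<Rightarrow> 'a list \<Rightarrow> bool" where
  "eps_loop X \<epsilon> p \<alpha> \<longleftrightarrow> eps_chain X \<epsilon> \<alpha> \<and> hd \<alpha> = p \<and> last \<alpha> = p"

definition adds_point :: "'a list \<Rightarrow> 'a list \<Rightarrow> bool" where
  "adds_point \<alpha> \<beta> \<longleftrightarrow> (\<exists>us x vs. \<alpha> = us @ vs \<and> \<beta> = us @ x # vs)"

definition eps_step :: "'a::metric_space set \<Rightarrow> real \<Rightarrow> 'a list \<Rightarrow> 'a list \<Rightarrow> bool" where
  "eps_step X \<epsilon> \<alpha> \<beta> \<longleftrightarrow> eps_chain X \<epsilon> \<alpha> \<and> eps_chain X \<epsilon> \<beta> \<and>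
     hd \<alpha> = hd \<beta> \<and> last \<alpha> = last \<beta> \<and> (adds_point \<alpha> \<beta> \<or> adds_point \<beta> \<alpha>)"

definition eps_homotopic :: "'a::metric_space set \<Rightarrow> real \<Rightarrow> 'a list \<Rightarrow> 'a list \<Rightarrow> bool" where
  "eps_homotopic X \<epsilon> \<alpha> \<beta> \<longleftrightarrow> eps_chain X \<epsilon> \<alpha> \<and> (eps_step X \<epsilon>)\<^sup>*\<^sup>* \<alpha> \<beta>"

definition eps_null :: "'a::metric_space set \<Rightarrow> real \<Rightarrow> 'a list \<Rightarrow> bool" where
  "eps_null X \<epsilon> \<alpha> \<longleftrightarrow> (\<exists>x. eps_homotopic X \<epsilon> \<alpha> [x])"

definition eps_class :: "'a::metric_space set \<Rightarrow> real \<Rightarrow> 'a list \<Rightarrow> 'a list set" where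
  "eps_class X \<epsilon> \<alpha> = {\<beta>. eps_homotopic X \<epsilon> \<alpha> \<beta>}"

text \<open>Concatenation; meaningful when \<open>last \<alpha> = hd \<beta>\<close>, that point being kept only once.\<close>

definition chain_concat :: "'a list \<Rightarrow> 'a list \<Rightarrow> 'a list" where
  "chain_concat \<alpha> \<beta> = \<alpha> @ tl \<beta>"

definition pi_eps :: "'a::metric_space set \<Rightarrow> real \<Rightarrow> 'a \<Rightarrow> 'a list set monoid" where
  "pi_eps X \<epsilon> p =
     \<lparr>carrier = {eps_class X \<epsilon> \<alpha> | \<alpha>. eps_loop X \<epsilon> p \<alpha>},
      monoid.mult = (\<lambda>A B. \<Union>\<alpha>\<in>A. \<Union>\<beta>\<in>B. eps_class X \<epsilon> (chain_concat \<alpha> \<beta>)),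
      one = eps_class X \<epsilon> [p]\<rparr>"


section \<open>Refinements, essential triads and circles\<close>

text \<open>Between consecutive points \<open>x\<close>, \<open>y\<close> one inserts the interior points of a subdivision
  chain \<open>g 0, g t\<^sub>1, \<dots>, g t\<^sub>m, g (dist x y)\<close> of a geodesic; possibly none.\<close>

inductive refinement :: "'a::metric_space set \<Rightarrow> 'a list \<Rightarrow> 'a list \<Rightarrow> bool" for X where
  single: "refinement X [x] [x]"
| step: "geodesic X g x y \<Longrightarrow> sorted_wrt (<) ts \<Longrightarrow> set ts \<subseteq> {0<..<dist x y} \<Longrightarrow>
         refinement X (y # \<alpha>) \<beta> \<Longrightarrow> refinement X (x # y # \<alpha>) (x # map g ts @ \<beta>)"

definition eps_refinement :: "'a::metric_space set \<Rightarrow> real \<Rightarrow> 'a list \<Rightarrow> 'a list \<Rightarrow> bool" where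
  "eps_refinement X \<epsilon> \<alpha> \<beta> \<longleftrightarrow> refinement X \<alpha> \<beta> \<and> eps_chain X \<epsilon> \<beta>"

inductive midpoint_refinement :: "'a::metric_space set \<Rightarrow> 'a list \<Rightarrow> 'a list \<Rightarrow> bool" for X where
  single: "midpoint_refinement X [x] [x]"
| step: "geodesic X g x y \<Longrightarrow> midpoint_refinement X (y # \<alpha>) \<beta> \<Longrightarrow>
         midpoint_refinement X (x # y # \<alpha>) (x # g (dist x y / 2) # \<beta>)"

definition triad :: "'a::metric_space set \<Rightarrow> real \<Rightarrow> 'a \<Rightarrow> 'a \<Rightarrow> 'a \<Rightarrow> bool" where
  "triad X \<delta> x0 x1 x2 \<longleftrightarrow> {x0, x1, x2} \<subseteq> X \<and>
     dist x0 x1 = \<delta> \<and> dist x1 x2 = \<delta> \<and> dist x2 x0 = \<delta>"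

definition triad_loop :: "'a \<Rightarrow> 'a \<Rightarrow> 'a \<Rightarrow> 'a list" where
  "triad_loop x0 x1 x2 = [x0, x1, x2, x0]"

definition essential_triad :: "'a::metric_space set \<Rightarrow> real \<Rightarrow> 'a \<Rightarrow> 'a \<Rightarrow> 'a \<Rightarrow> bool" where
  "essential_triad X \<delta> x0 x1 x2 \<longleftrightarrow> triad X \<delta> x0 x1 x2 \<and>
     (\<exists>\<beta>. eps_refinement X \<delta> (triad_loop x0 x1 x2) \<beta> \<and> \<not> eps_null X \<delta> \<beta>)"

definition essential_circle :: "'a::metric_space set \<Rightarrow> real \<Rightarrow> 'a set \<Rightarrow> bool" where
  "essential_circle X \<delta> C \<longleftrightarrow> (\<exists>x0 x1 x2 g0 g1 g2. essential_triad X \<delta> x0 x1 x2 \<and>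
     geodesic X g0 x0 x1 \<and> geodesic X g1 x1 x2 \<and> geodesic X g2 x2 x0 \<and>
     C = g0 ` {0..\<delta>} \<union> g1 ` {0..\<delta>} \<union> g2 ` {0..\<delta>})"


section \<open>Lollichains and lollipops\<close>

definition lollichain :: "'a::metric_space set \<Rightarrow> 'a \<Rightarrow> real \<Rightarrow> 'a list \<Rightarrow> bool" where
  "lollichain X p \<delta> \<mu> \<longleftrightarrow> eps_loop X \<delta> p \<mu> \<and>
     (\<exists>k c x0 x1 x2. eps_chain X \<delta> k \<and> hd k = p \<and> last k = x0 \<and>
        essential_triad X \<delta> x0 x1 x2 \<and> midpoint_refinement X (triad_loop x0 x1 x2) c \<and>
        \<mu> = chain_concat k (chain_concat c (rev k)))"

text \<open>An essential \<open>\<delta>\<close>-circle \<open>C\<close> has length \<open>3\<delta>\<close>; the curve \<open>c\<close> runs once around it, in either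
  direction and from any starting point.\<close>

definition circle_parameterization ::
    "(real \<Rightarrow> 'a::metric_space) \<Rightarrow> real \<Rightarrow> 'a set \<Rightarrow> bool" where
  "circle_parameterization c \<delta> C \<longleftrightarrow> arclength_parameterized c 0 (3 * \<delta>) \<and>
     c 0 = c (3 * \<delta>) \<and> inj_on c {0..<3 * \<delta>} \<and> c ` {0..3 * \<delta>} = C"

definition length_minimizing ::
    "'a::metric_space set \<Rightarrow> (real \<Rightarrow> 'a) \<Rightarrow> real \<Rightarrow> real \<Rightarrow> bool" where
  "length_minimizing X k a b \<longleftrightarrow>
     (\<forall>h. path h \<and> path_image h \<subseteq> X \<and> pathstart h = k a \<and> pathfinish h = k b \<longrightarrow>
        path_length k a b \<le> path_length h 0 1)"

definition locally_length_minimizing :: "'a::metric_space set \<Rightarrow> (real \<Rightarrow> 'a) \<Rightarrow> bool" where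
  "locally_length_minimizing X k \<longleftrightarrow>
     (\<forall>t\<in>{0..1}. \<exists>e>0. \<forall>a b. a \<le> b \<and> {a..b} \<subseteq> {0..1} \<inter> ball t e \<longrightarrow>
        length_minimizing X k a b)"

text \<open>As a path on \<open>[0, 1]\<close>; the circle is rescaled from \<open>[0, 3\<delta>]\<close>.\<close>

definition lollipop :: "'a::metric_space set \<Rightarrow> 'a \<Rightarrow> (real \<Rightarrow> 'a) \<Rightarrow> (real \<Rightarrow> 'a) \<Rightarrow> bool" where
  "lollipop X p k \<gamma> \<longleftrightarrow> path k \<and> path_image k \<subseteq> X \<and> pathstart k = p \<and>
     (\<exists>\<delta> C c. 0 < \<delta> \<and> essential_circle X \<delta> C \<and> circle_parameterization c \<delta> C \<and>
        pathfinish k = c 0 \<and> \<gamma> = k +++ (\<lambda>t. c (3 * \<delta> * t)) +++ reversepath k)"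

definition geodesic_lollipop :: "'a::metric_space set \<Rightarrow> 'a \<Rightarrow> (real \<Rightarrow> 'a) \<Rightarrow> bool" where
  "geodesic_lollipop X p \<gamma> \<longleftrightarrow> (\<exists>k. lollipop X p k \<gamma> \<and> locally_length_minimizing X k)"


section \<open>The fundamental group\<close>

definition path_class :: "'a::topological_space set \<Rightarrow> (real \<Rightarrow> 'a) \<Rightarrow> (real \<Rightarrow> 'a) set" where
  "path_class X f = {g. homotopic_paths X f g}"

definition pi_1 :: "'a::topological_space set \<Rightarrow> 'a \<Rightarrow> (real \<Rightarrow> 'a) set monoid" where
  "pi_1 X p =
     \<lparr>carrier = {path_class X f | f.
        path f \<and> path_image f \<subseteq> X \<and> pathstart f = p \<and> pathfinish f = p},
      monoid.mult = (\<lambda>A B. \<Union>f\<in>A. \<Union>g\<in>B. path_class X (f +++ g)),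
      one = path_class X (\<lambda>_. p)\<rparr>"

definition semilocally_simply_connected :: "'a::topological_space set \<Rightarrow> bool" where
  "semilocally_simply_connected X \<longleftrightarrow>
     (\<forall>x\<in>X. \<exists>U. openin (top_of_set X) U \<and> x \<in> U \<and>
        (\<forall>f. path f \<and> path_image f \<subseteq> U \<and> pathstart f = x \<and> pathfinish f = x \<longrightarrow>
           homotopic_paths X f (\<lambda>_. x)))"


section \<open>Both structures are groups\<close>

lemma eps_step_sym: "eps_step X \<epsilon> \<alpha> \<beta> \<Longrightarrow> eps_step X \<epsilon> \<beta> \<alpha>"
  by (auto simp: eps_step_def)

lemma eps_homotopic_refl: "eps_chain X \<epsilon> \<alpha> \<Longrightarrow> eps_homotopic X \<epsilon> \<alpha> \<alpha>"
  by (simp add: eps_homotopic_def)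

lemma eps_homotopic_ends:
  assumes "eps_homotopic X \<epsilon> \<alpha> \<beta>"
  shows "eps_chain X \<epsilon> \<alpha> \<and> eps_chain X \<epsilon> \<beta> \<and> hd \<beta> = hd \<alpha> \<and> last \<beta> = last \<alpha>"
proof -
  have "(eps_step X \<epsilon>)\<^sup>*\<^sup>* \<alpha> \<beta>" "eps_chain X \<epsilon> \<alpha>"
    using assms by (auto simp: eps_homotopic_def)
  then show ?thesis
    by (induction rule: rtranclp_induct) (auto simp: eps_step_def)
qed

lemma eps_homotopic_sym: "eps_homotopic X \<epsilon> \<alpha> \<beta> \<Longrightarrow> eps_homotopic X \<epsilon> \<beta> \<alpha>"
proof -
  assume h: "eps_homotopic X \<epsilon> \<alpha> \<beta>"
  have "symp (eps_step X \<epsilon>)"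
    by (rule sympI) (rule eps_step_sym)
  then have "symp ((eps_step X \<epsilon>)\<^sup>*\<^sup>*)"
    by (rule symp_rtranclp)
  then show ?thesis
    using h eps_homotopic_ends[OF h] by (auto simp: eps_homotopic_def dest: sympD)
qed

lemma eps_homotopic_trans:
  "eps_homotopic X \<epsilon> \<alpha> \<beta> \<Longrightarrow> eps_homotopic X \<epsilon> \<beta> \<gamma> \<Longrightarrow> eps_homotopic X \<epsilon> \<alpha> \<gamma>"
  by (auto simp: eps_homotopic_def)

lemma eps_class_eq_iff:
  "eps_chain X \<epsilon> \<alpha> \<Longrightarrow> eps_class X \<epsilon> \<alpha> = eps_class X \<epsilon> \<beta> \<longleftrightarrow> eps_homotopic X \<epsilon> \<alpha> \<beta>"
  unfolding eps_class_def
  by (blast intro: eps_homotopic_refl eps_homotopic_sym eps_homotopic_trans)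

lemma chain_concat_alt: "\<alpha> \<noteq> [] \<Longrightarrow> \<beta> \<noteq> [] \<Longrightarrow> last \<alpha> = hd \<beta> \<Longrightarrow>
    chain_concat \<alpha> \<beta> = butlast \<alpha> @ \<beta>"
  unfolding chain_concat_def
  by (metis append.assoc append_Cons append_Nil append_butlast_last_id list.collapse)

lemma chain_concat_ends:
  assumes "\<alpha> \<noteq> []" "\<beta> \<noteq> []" "last \<alpha> = hd \<beta>"
  shows "hd (chain_concat \<alpha> \<beta>) = hd \<alpha>" "last (chain_concat \<alpha> \<beta>) = last \<beta>"
proof -
  show "hd (chain_concat \<alpha> \<beta>) = hd \<alpha>"
    using assms by (simp add: chain_concat_def)
  show "last (chain_concat \<alpha> \<beta>) = last \<beta>"
    using assms by (simp add: chain_concat_alt)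
qed

lemma eps_chain_concat:
  assumes "eps_chain X \<epsilon> \<alpha>" "eps_chain X \<epsilon> \<beta>" "last \<alpha> = hd \<beta>"
  shows "eps_chain X \<epsilon> (chain_concat \<alpha> \<beta>)"
proof (cases \<beta>)
  case (Cons b bs)
  then show ?thesis
    using assms by (auto simp: eps_chain_def chain_concat_def successively_append_iff
        successively_Cons)
qed (use assms in \<open>auto simp: eps_chain_def\<close>)

lemma eps_homotopic_concat_left:
  assumes "eps_homotopic X \<epsilon> \<alpha> \<alpha>'" "eps_chain X \<epsilon> \<beta>" "last \<alpha> = hd \<beta>"
  shows "eps_homotopic X \<epsilon> (chain_concat \<alpha> \<beta>) (chain_concat \<alpha>' \<beta>)"
proof -
  have "eps_step X \<epsilon> (chain_concat \<gamma> \<beta>) (chain_concat \<gamma>' \<beta>)"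
    if "eps_step X \<epsilon> \<gamma> \<gamma>'" "last \<gamma> = hd \<beta>" for \<gamma> \<gamma>'
  proof -
    have ne: "\<gamma> \<noteq> []" "\<gamma>' \<noteq> []" "\<beta> \<noteq> []"
      using that assms by (auto simp: eps_step_def eps_chain_def)
    have "adds_point (chain_concat u \<beta>) (chain_concat v \<beta>)" if "adds_point u v" for u v
      using that unfolding adds_point_def chain_concat_def by (metis append.assoc append_Cons)
    then show ?thesis
      using that assms ne by (auto simp: eps_step_def eps_chain_concat chain_concat_ends)
  qed
  moreover have "(eps_step X \<epsilon>)\<^sup>*\<^sup>* \<alpha> \<alpha>'"
    using assms by (simp add: eps_homotopic_def)
  then have "(eps_step X \<epsilon>)\<^sup>*\<^sup>* (chain_concat \<alpha> \<beta>) (chain_concat \<alpha>' \<beta>) \<and> last \<alpha>' = hd \<beta>"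
    by (induction rule: rtranclp_induct)
      (use assms calculation in \<open>auto simp: eps_step_def intro: rtranclp.rtrancl_into_rtrancl\<close>)
  ultimately show ?thesis
    using assms eps_homotopic_ends[OF assms(1)]
    by (auto simp: eps_homotopic_def intro: eps_chain_concat)
qed

lemma eps_homotopic_concat_right:
  assumes "eps_homotopic X \<epsilon> \<beta> \<beta>'" "eps_chain X \<epsilon> \<alpha>" "last \<alpha> = hd \<beta>"
  shows "eps_homotopic X \<epsilon> (chain_concat \<alpha> \<beta>) (chain_concat \<alpha> \<beta>')"
proof -
  have "eps_step X \<epsilon> (chain_concat \<alpha> \<gamma>) (chain_concat \<alpha> \<gamma>')"
    if "eps_step X \<epsilon> \<gamma> \<gamma>'" "last \<alpha> = hd \<gamma>" for \<gamma> \<gamma>'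
  proof -
    have ne: "\<gamma> \<noteq> []" "\<gamma>' \<noteq> []" "\<alpha> \<noteq> []" "last \<alpha> = hd \<gamma>'"
      using that assms by (auto simp: eps_step_def eps_chain_def)
    have "adds_point (butlast \<alpha> @ u) (butlast \<alpha> @ v)" if "adds_point u v" for u v
      using that unfolding adds_point_def by (metis append.assoc)
    then show ?thesis
      using that assms ne
      by (auto simp: eps_step_def eps_chain_concat chain_concat_ends)
        (auto simp: chain_concat_alt)
  qed
  moreover have "(eps_step X \<epsilon>)\<^sup>*\<^sup>* \<beta> \<beta>'"
    using assms by (simp add: eps_homotopic_def)
  then have "(eps_step X \<epsilon>)\<^sup>*\<^sup>* (chain_concat \<alpha> \<beta>) (chain_concat \<alpha> \<beta>') \<and> last \<alpha> = hd \<beta>'"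
    by (induction rule: rtranclp_induct)
      (use assms calculation in \<open>auto simp: eps_step_def intro: rtranclp.rtrancl_into_rtrancl\<close>)
  ultimately show ?thesis
    using assms eps_homotopic_ends[OF assms(1)]
    by (auto simp: eps_homotopic_def intro: eps_chain_concat)
qed

lemma eps_homotopic_concat:
  assumes "eps_homotopic X \<epsilon> \<alpha> \<alpha>'" "eps_homotopic X \<epsilon> \<beta> \<beta>'" "last \<alpha> = hd \<beta>"
  shows "eps_homotopic X \<epsilon> (chain_concat \<alpha> \<beta>) (chain_concat \<alpha>' \<beta>')"
  using eps_homotopic_concat_left[OF assms(1), of \<beta>] eps_homotopic_concat_right[OF assms(2), of \<alpha>']
    eps_homotopic_ends[OF assms(1)] eps_homotopic_ends[OF assms(2)] assms(3)
  by (metis eps_homotopic_trans)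

lemma eps_chain_rev: "eps_chain X \<epsilon> \<alpha> \<Longrightarrow> eps_chain X \<epsilon> (rev \<alpha>)"
  by (simp add: eps_chain_def successively_rev dist_commute)

lemma eps_homotopic_rev:
  assumes "eps_chain X \<epsilon> \<alpha>" "\<epsilon> > 0"
  shows "eps_homotopic X \<epsilon> (chain_concat \<alpha> (rev \<alpha>)) [hd \<alpha>]"
  using assms(1)
proof (induction \<alpha> rule: rev_induct)
  case Nil
  then show ?case by (simp add: eps_chain_def)
next
  case (snoc y \<alpha>)
  show ?case
  proof (cases "\<alpha> = []")
    case True
    then show ?thesis
      using snoc.prems by (simp add: chain_concat_def eps_homotopic_refl)
  next
    case False
    then obtain us z where us: "\<alpha> = us @ [z]"
      by (metis append_butlast_last_id)
    have a: "eps_chain X \<epsilon> (us @ [z])"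
      using snoc.prems by (auto simp: us eps_chain_def successively_append_iff)
    let ?a = "us @ [z, y, z] @ rev us" and ?b = "us @ [z, z] @ rev us" and ?c = "us @ [z] @ rev us"
    have c: "eps_chain X \<epsilon> ?a" "eps_chain X \<epsilon> ?b" "eps_chain X \<epsilon> ?c"
      using snoc.prems \<open>\<epsilon> > 0\<close>
      by (auto simp: us eps_chain_def successively_append_iff successively_Cons successively_rev
          dist_commute hd_rev)
    have ends: "hd ?a = hd ?b" "hd ?b = hd ?c" "last ?a = last ?b" "last ?b = last ?c"
      by (cases us; simp)+
    have "adds_point ?b ?a" "adds_point ?c ?b"
      unfolding adds_point_def
      by (rule exI[of _ "us @ [z]"], simp) (rule exI[of _ us], simp)
    then have "eps_step X \<epsilon> ?a ?b" "eps_step X \<epsilon> ?b ?c"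
      using c ends by (auto simp: eps_step_def)
    then have "eps_homotopic X \<epsilon> ?a ?c"
      using c by (auto simp: eps_homotopic_def intro: rtranclp_trans)
    moreover have "eps_homotopic X \<epsilon> ?c [hd \<alpha>]"
      using snoc.IH a by (simp add: us chain_concat_def)
    ultimately show ?thesis
      by (auto simp: us chain_concat_def hd_append intro: eps_homotopic_trans)
  qed
qed

lemma pi_eps_mult:
  assumes "eps_chain X \<epsilon> \<alpha>" "eps_chain X \<epsilon> \<beta>" "last \<alpha> = hd \<beta>"
  shows "eps_class X \<epsilon> \<alpha> \<otimes>\<^bsub>pi_eps X \<epsilon> p\<^esub> eps_class X \<epsilon> \<beta> = eps_class X \<epsilon> (chain_concat \<alpha> \<beta>)"
proof -
  have "eps_class X \<epsilon> (chain_concat \<alpha>' \<beta>') = eps_class X \<epsilon> (chain_concat \<alpha> \<beta>)"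
    if "\<alpha>' \<in> eps_class X \<epsilon> \<alpha>" "\<beta>' \<in> eps_class X \<epsilon> \<beta>" for \<alpha>' \<beta>'
  proof -
    have "eps_homotopic X \<epsilon> (chain_concat \<alpha> \<beta>) (chain_concat \<alpha>' \<beta>')"
      using that assms by (intro eps_homotopic_concat) (auto simp: eps_class_def)
    then show ?thesis
      using eps_class_eq_iff eps_chain_concat[OF assms] by metis
  qed
  moreover have "\<alpha> \<in> eps_class X \<epsilon> \<alpha>" "\<beta> \<in> eps_class X \<epsilon> \<beta>"
    using assms by (auto simp: eps_class_def eps_homotopic_refl)
  ultimately have "(\<Union>\<alpha>'\<in>eps_class X \<epsilon> \<alpha>. \<Union>\<beta>'\<in>eps_class X \<epsilon> \<beta>.
      eps_class X \<epsilon> (chain_concat \<alpha>' \<beta>')) = eps_class X \<epsilon> (chain_concat \<alpha> \<beta>)"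
    by blast
  then show ?thesis
    by (simp add: pi_eps_def)
qed

proposition group_pi_eps:
  assumes "p \<in> X" "\<epsilon> > 0"
  shows "group (pi_eps X \<epsilon> p)"
proof (rule groupI)
  let ?G = "pi_eps X \<epsilon> p"
  have carr: "A \<in> carrier ?G \<longleftrightarrow> (\<exists>\<alpha>. A = eps_class X \<epsilon> \<alpha> \<and> eps_loop X \<epsilon> p \<alpha>)" for A
    by (auto simp: pi_eps_def)
  have mult: "eps_class X \<epsilon> \<alpha> \<otimes>\<^bsub>?G\<^esub> eps_class X \<epsilon> \<beta> = eps_class X \<epsilon> (chain_concat \<alpha> \<beta>)"
    if "eps_loop X \<epsilon> p \<alpha>" "eps_loop X \<epsilon> p \<beta>" for \<alpha> \<beta>
    using that by (simp add: eps_loop_def pi_eps_mult)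
  have loop: "eps_loop X \<epsilon> p (chain_concat \<alpha> \<beta>)"
    if "eps_loop X \<epsilon> p \<alpha>" "eps_loop X \<epsilon> p \<beta>" for \<alpha> \<beta>
    using that chain_concat_ends[of \<alpha> \<beta>] eps_chain_concat[of X \<epsilon> \<alpha> \<beta>]
    by (auto simp: eps_loop_def eps_chain_def)
  have one: "\<one>\<^bsub>?G\<^esub> = eps_class X \<epsilon> [p]" "eps_loop X \<epsilon> p [p]"
    using assms by (auto simp: pi_eps_def eps_loop_def eps_chain_def)
  show "\<one>\<^bsub>?G\<^esub> \<in> carrier ?G"
    using one carr by blast
  fix A assume "A \<in> carrier ?G"
  then obtain \<alpha> where \<alpha>: "A = eps_class X \<epsilon> \<alpha>" "eps_loop X \<epsilon> p \<alpha>"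
    using carr by blast
  have "chain_concat [p] \<alpha> = \<alpha>"
    using \<alpha> by (auto simp: eps_loop_def eps_chain_def chain_concat_def)
  then show "\<one>\<^bsub>?G\<^esub> \<otimes>\<^bsub>?G\<^esub> A = A"
    using mult one \<alpha> by simp
  have r: "eps_loop X \<epsilon> p (rev \<alpha>)"
    using \<alpha>(2) eps_chain_rev
    by (auto simp: eps_loop_def hd_rev last_rev)
  have "eps_homotopic X \<epsilon> (chain_concat (rev \<alpha>) \<alpha>) [p]"
    using eps_homotopic_rev[of X \<epsilon> "rev \<alpha>"] r assms by (simp add: eps_loop_def)
  then have "eps_class X \<epsilon> (rev \<alpha>) \<otimes>\<^bsub>?G\<^esub> A = \<one>\<^bsub>?G\<^esub>"
    using mult[OF r \<alpha>(2)] loop[OF r \<alpha>(2)] one \<alpha> eps_class_eq_iff by (metis eps_loop_def)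
  then show "\<exists>B\<in>carrier ?G. B \<otimes>\<^bsub>?G\<^esub> A = \<one>\<^bsub>?G\<^esub>"
    using r carr by blast
  fix B assume "B \<in> carrier ?G"
  then obtain \<beta> where \<beta>: "B = eps_class X \<epsilon> \<beta>" "eps_loop X \<epsilon> p \<beta>"
    using carr by blast
  show "A \<otimes>\<^bsub>?G\<^esub> B \<in> carrier ?G"
    using mult[OF \<alpha>(2) \<beta>(2)] loop[OF \<alpha>(2) \<beta>(2)] \<alpha>(1) \<beta>(1) carr by blast
  fix C assume "C \<in> carrier ?G"
  then obtain \<gamma> where \<gamma>: "C = eps_class X \<epsilon> \<gamma>" "eps_loop X \<epsilon> p \<gamma>"
    using carr by blast
  have "chain_concat (chain_concat \<alpha> \<beta>) \<gamma> = chain_concat \<alpha> (chain_concat \<beta> \<gamma>)"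
    using \<beta>(2) by (auto simp: eps_loop_def eps_chain_def chain_concat_def)
  then show "A \<otimes>\<^bsub>?G\<^esub> B \<otimes>\<^bsub>?G\<^esub> C = A \<otimes>\<^bsub>?G\<^esub> (B \<otimes>\<^bsub>?G\<^esub> C)"
    by (simp add: \<alpha> \<beta> \<gamma> mult loop)
qed

lemma homotopic_paths_const_left:
  assumes "path f" "path_image f \<subseteq> X" "pathstart f = p"
  shows "homotopic_paths X ((\<lambda>_. p) +++ f) f"
proof (rule homotopic_paths_sym, rule homotopic_paths_reparametrize[OF assms(1,2)])
  show "continuous_on {0..1} (\<lambda>t::real. max 0 (2 * t - 1))"
    by (intro continuous_intros)
  show "((\<lambda>_. p) +++ f) t = f (max 0 (2 * t - 1))" for t
    using assms(3) by (cases "t \<le> 1 / 2") (auto simp: joinpaths_def pathstart_def max_absorb1)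
qed auto

lemma homotopic_paths_reverse_left:
  assumes "path f" "path_image f \<subseteq> X"
  shows "homotopic_paths X (reversepath f +++ f) (\<lambda>_. pathfinish f)"
proof -
  define h where "h = (\<lambda>y::real \<times> real. f (max (fst y) \<bar>1 - 2 * snd y\<bar>))"
  have f: "continuous_on {0..1} f"
    using assms by (simp add: path_def)
  have 1: "continuous_on ({0..1} \<times> {0..1}) h"
    unfolding h_def by (rule continuous_on_compose2[OF f]) (auto intro!: continuous_intros)
  have 2: "h \<in> {0..1} \<times> {0..1} \<rightarrow> X"
    using assms(2) by (force simp: h_def path_image_def)
  have 3: "h (0, t) = (reversepath f +++ f) t" for t
    by (cases "t \<le> 1 / 2") (simp_all add: h_def joinpaths_def reversepath_def max_def)
  have 4: "h (1, t) = pathfinish f" if "t \<in> {0..1}" for t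
  proof -
    have "max 1 \<bar>1 - 2 * t\<bar> = 1"
      using that by (auto simp: abs_if)
    then show ?thesis
      by (simp add: h_def pathfinish_def)
  qed
  have 5: "pathstart (h \<circ> Pair s) = pathstart (reversepath f +++ f) \<and>
      pathfinish (h \<circ> Pair s) = pathfinish (reversepath f +++ f)" if "s \<in> {0..1}" for s
  proof -
    have "max s 1 = 1"
      using that by simp
    then have "pathstart (h \<circ> Pair s) = f 1" "pathfinish (h \<circ> Pair s) = f 1"
      by (simp_all add: h_def pathstart_def pathfinish_def)
    then show ?thesis
      unfolding pathstart_join pathfinish_join pathstart_reversepath
      by (simp add: pathfinish_def[of f])
  qed
  show ?thesis
    unfolding homotopic_paths
  proof (intro exI[of _ h] conjI ballI)
    fix s :: real assume "s \<in> {0..1}"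
    then show "pathstart (h \<circ> Pair s) = pathstart (reversepath f +++ f)"
      "pathfinish (h \<circ> Pair s) = pathfinish (reversepath f +++ f)"
      using 5 by metis+
  qed (rule 1 2 3 4 | assumption)+
qed

lemma path_class_eq_iff:
  "path f \<Longrightarrow> path_image f \<subseteq> X \<Longrightarrow> path_class X f = path_class X g \<longleftrightarrow> homotopic_paths X f g"
  unfolding path_class_def set_eq_iff mem_Collect_eq
  by (metis homotopic_paths_refl homotopic_paths_sym homotopic_paths_trans)

lemma pi_1_mult:
  assumes "path f" "path_image f \<subseteq> X" "path g" "path_image g \<subseteq> X" "pathfinish f = pathstart g"
  shows "path_class X f \<otimes>\<^bsub>pi_1 X p\<^esub> path_class X g = path_class X (f +++ g)"
proof -
  have "path_class X (f' +++ g') = path_class X (f +++ g)"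
    if "f' \<in> path_class X f" "g' \<in> path_class X g" for f' g'
  proof -
    have "homotopic_paths X (f +++ g) (f' +++ g')"
      using that assms by (intro homotopic_paths_join) (auto simp: path_class_def)
    then show ?thesis
      using path_class_eq_iff homotopic_paths_imp_path homotopic_paths_imp_subset by metis
  qed
  moreover have "f \<in> path_class X f" "g \<in> path_class X g"
    using assms by (auto simp: path_class_def)
  ultimately have "(\<Union>f'\<in>path_class X f. \<Union>g'\<in>path_class X g. path_class X (f' +++ g')) =
      path_class X (f +++ g)"
    by blast
  then show ?thesis
    by (simp add: pi_1_def)
qed

proposition group_pi_1:
  assumes "p \<in> X"
  shows "group (pi_1 X p)"
proof (rule groupI)
  let ?G = "pi_1 X p"
  define L where
    "L f \<longleftrightarrow> path f \<and> path_image f \<subseteq> X \<and> pathstart f = p \<and> pathfinish f = p" for f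
  have carr: "A \<in> carrier ?G \<longleftrightarrow> (\<exists>f. A = path_class X f \<and> L f)" for A
    by (auto simp: pi_1_def L_def)
  have mult: "path_class X f \<otimes>\<^bsub>?G\<^esub> path_class X g = path_class X (f +++ g)"
    if "L f" "L g" for f g
    using that by (simp add: L_def pi_1_mult)
  have loop: "L (f +++ g)" if "L f" "L g" for f g
    using that by (auto simp: L_def path_image_join)
  have one: "\<one>\<^bsub>?G\<^esub> = path_class X (\<lambda>_. p)" "L (\<lambda>_. p)"
    using assms by (auto simp: pi_1_def L_def path_def path_image_def pathstart_def pathfinish_def)
  show "\<one>\<^bsub>?G\<^esub> \<in> carrier ?G"
    using one carr by blast
  fix A assume "A \<in> carrier ?G"
  then obtain f where f: "A = path_class X f" "L f"
    using carr by blast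
  show "\<one>\<^bsub>?G\<^esub> \<otimes>\<^bsub>?G\<^esub> A = A"
    using mult[OF one(2) f(2)] loop[OF one(2) f(2)] homotopic_paths_const_left[of f X p] f one
    by (metis L_def path_class_eq_iff)
  have r: "L (reversepath f)"
    using f(2) by (auto simp: L_def)
  have "path_class X (reversepath f) \<otimes>\<^bsub>?G\<^esub> A = \<one>\<^bsub>?G\<^esub>"
    using mult[OF r f(2)] loop[OF r f(2)] homotopic_paths_reverse_left[of f X] f one
    by (metis L_def path_class_eq_iff)
  then show "\<exists>B\<in>carrier ?G. B \<otimes>\<^bsub>?G\<^esub> A = \<one>\<^bsub>?G\<^esub>"
    using r carr by blast
  fix B assume "B \<in> carrier ?G"
  then obtain g where g: "B = path_class X g" "L g"
    using carr by blast
  show "A \<otimes>\<^bsub>?G\<^esub> B \<in> carrier ?G"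
    using mult[OF f(2) g(2)] loop[OF f(2) g(2)] f(1) g(1) carr by blast
  fix C assume "C \<in> carrier ?G"
  then obtain h where h: "C = path_class X h" "L h"
    using carr by blast
  have "homotopic_paths X (f +++ (g +++ h)) ((f +++ g) +++ h)"
    using f(2) g(2) h(2) by (intro homotopic_paths_assoc) (auto simp: L_def)
  then have "path_class X ((f +++ g) +++ h) = path_class X (f +++ (g +++ h))"
    using path_class_eq_iff homotopic_paths_imp_path homotopic_paths_imp_subset by metis
  then show "A \<otimes>\<^bsub>?G\<^esub> B \<otimes>\<^bsub>?G\<^esub> C = A \<otimes>\<^bsub>?G\<^esub> (B \<otimes>\<^bsub>?G\<^esub> C)"
    using f g h by (simp add: mult loop)
qed

end

theory Submission
  imports Defs
begin

text \<open>
  A loop that is an \<open>\<epsilon>\<close>-chain of length less than \<open>3\<epsilon>\<close> is \<open>\<epsilon>\<close>-null: parameterize it by arclength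
  and replace it by three points at pairwise distance less than \<open>\<epsilon>\<close>. Let \<open>\<sigma> < \<delta> \<le> 3\<sigma>/2\<close>. A
  \<open>\<delta>\<close>-chain then has a well-defined \<open>\<sigma>\<close>-class, obtained by filling in its steps, and inserting a
  point changes this class by a conjugate of a filled \<open>\<delta>\<close>-triangle. Such a triangle is \<open>\<sigma>\<close>-null if
  its perimeter is less than \<open>3\<sigma>\<close>. By compactness, for \<open>\<delta>\<close> fixed and \<open>\<sigma>\<close> slightly smaller all
  \<open>\<delta>\<close>-triangles are \<open>\<sigma>\<close>-null, and for \<open>\<sigma>\<close> fixed and \<open>\<delta>\<close> slightly larger every \<open>\<delta>\<close>-triangle of
  perimeter at least \<open>3\<sigma>\<close> is close to a \<open>\<sigma>\<close>-triad. So the set of scales at which the loops coming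
  from lollichains generate the whole group can be continued downwards from the diameter of \<open>X\<close> past
  every positive scale. Finitely many of them suffice because the group is finitely generated.

  If \<open>X\<close> is semilocally simply connected, then for small \<open>\<epsilon>\<close> joining the points of a chain by
  geodesics induces an epimorphism from the discrete group onto the fundamental group. The stick of a
  lollipop is made locally minimizing by choosing a shortest chain in its \<open>\<epsilon>\<close>-class.
\<close>

section \<open>The groupoid of chains\<close>

text \<open>No discreteness of the scales at which new loops appear is available, so there is no
  induction over critical values. It is replaced by two one-sided statements: from
  \<open>\<delta>\<close> to all slightly smaller scales, where nothing new arises, and from scales
  just above \<open>\<sigma>\<close> to \<open>\<sigma>\<close> itself, where the circles of scale
  \<open>\<sigma>\<close> enter. Together they exclude a supremum of bad scales. This gives no bound
  on the number of generators; finite generation is proved separately, with other generators, and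
  then transferred. A circle is carried by a curve and not by a chain. The same curve can be
  subdivided anew at every smaller scale, so a generator found at scale \<open>\<delta>\<close>
  remains one below \<open>\<delta>\<close>; hence the condition
  \<open>\<delta> \<ge> \<epsilon>\<close>. The constant \<open>3 / 2\<close> arises because two
  fillings of a step shorter than \<open>\<delta>\<close> form a loop shorter than
  \<open>2 * \<delta>\<close>, which has to be at most \<open>3 * \<sigma>\<close>. Filling respects
  homotopies only up to triangles, so its invariance is stated as membership in a subgroup and not
  as equality of classes.\<close>

notation chain_concat (infixr "@@" 75)

definition joins :: "'a::metric_space set \<Rightarrow> real \<Rightarrow> 'a \<Rightarrow> 'a \<Rightarrow> 'a list \<Rightarrow> bool" where
  "joins X \<epsilon> a b \<alpha> \<longleftrightarrow> eps_chain X \<epsilon> \<alpha> \<and> hd \<alpha> = a \<and> last \<alpha> = b"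

lemma joinsD:
  assumes "joins X \<epsilon> a b \<alpha>"
  shows "eps_chain X \<epsilon> \<alpha>" "\<alpha> \<noteq> []" "hd \<alpha> = a" "last \<alpha> = b" "set \<alpha> \<subseteq> X" "a \<in> X" "b \<in> X"
  using assms by (auto simp: joins_def eps_chain_def)

lemma eps_loop_iff: "eps_loop X \<epsilon> p \<alpha> \<longleftrightarrow> joins X \<epsilon> p p \<alpha>"
  by (simp add: eps_loop_def joins_def)

lemma joins_single: "a \<in> X \<Longrightarrow> joins X \<epsilon> a a [a]"
  by (simp add: joins_def eps_chain_def)

lemma joins_concat:
  assumes "joins X \<epsilon> a b \<alpha>" "joins X \<epsilon> b c \<beta>"
  shows "joins X \<epsilon> a c (\<alpha> @@ \<beta>)"
  using assms joinsD[OF assms(1)] joinsD[OF assms(2)]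
  by (auto simp: joins_def eps_chain_concat chain_concat_ends)

lemma joins_rev: "joins X \<epsilon> a b \<alpha> \<Longrightarrow> joins X \<epsilon> b a (rev \<alpha>)"
  by (auto simp: joins_def eps_chain_rev hd_rev last_rev)

lemma joins_mono: "joins X \<sigma> a b \<alpha> \<Longrightarrow> \<sigma> \<le> \<epsilon> \<Longrightarrow> joins X \<epsilon> a b \<alpha>"
  unfolding joins_def eps_chain_def
  by (auto elim!: successively_mono)

lemma joins_homotopic:
  "joins X \<epsilon> a b \<alpha> \<Longrightarrow> eps_homotopic X \<epsilon> \<alpha> \<beta> \<Longrightarrow> joins X \<epsilon> a b \<beta>"
  using eps_homotopic_ends by (auto simp: joins_def)

lemma chain_concat_assoc: "\<beta> \<noteq> [] \<Longrightarrow> (\<alpha> @@ \<beta>) @@ \<gamma> = \<alpha> @@ \<beta> @@ \<gamma>"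
  by (auto simp: chain_concat_def)

lemma chain_concat_single [simp]:
  "\<alpha> @@ [b] = \<alpha>" "\<alpha> \<noteq> [] \<Longrightarrow> hd \<alpha> = a \<Longrightarrow> [a] @@ \<alpha> = \<alpha>"
  by (auto simp: chain_concat_def)

lemma chain_concat_eq_Nil [simp]: "\<alpha> @@ \<beta> = [] \<longleftrightarrow> \<alpha> = [] \<and> tl \<beta> = []"
  by (simp add: chain_concat_def)

lemma rev_chain_concat:
  assumes "\<alpha> \<noteq> []" "\<beta> \<noteq> []" "last \<alpha> = hd \<beta>"
  shows "rev (\<alpha> @@ \<beta>) = rev \<beta> @@ rev \<alpha>"
proof -
  obtain us z where "\<alpha> = us @ [z]" using assms(1) by (metis append_butlast_last_id)
  moreover obtain w vs where "\<beta> = w # vs" using assms(2) by (cases \<beta>) auto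
  ultimately show ?thesis using assms(3) by (simp add: chain_concat_def)
qed

lemmas eps_homotopic_equiv = eps_homotopic_sym eps_homotopic_trans

lemma eps_homotopic_add_point:
  assumes "eps_chain X \<epsilon> (us @ vs)" "eps_chain X \<epsilon> (us @ x # vs)"
    "hd (us @ vs) = hd (us @ x # vs)" "last (us @ vs) = last (us @ x # vs)"
  shows "eps_homotopic X \<epsilon> (us @ vs) (us @ x # vs)"
  using assms unfolding eps_homotopic_def eps_step_def adds_point_def by blast

lemma concat_rev_null:
  assumes "joins X \<epsilon> a b \<alpha>" "\<epsilon> > 0"
  shows "eps_homotopic X \<epsilon> (\<alpha> @@ rev \<alpha>) [a]" "eps_homotopic X \<epsilon> (rev \<alpha> @@ \<alpha>) [b]"
  using eps_homotopic_rev[of X \<epsilon> \<alpha>] eps_homotopic_rev[of X \<epsilon> "rev \<alpha>"] assms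
  by (auto simp: joins_def eps_chain_rev hd_rev)

lemma homotopic_concat_null_left:
  assumes "eps_homotopic X \<epsilon> \<alpha> [a]" "joins X \<epsilon> a b \<beta>"
  shows "eps_homotopic X \<epsilon> (\<alpha> @@ \<beta>) \<beta>"
  using eps_homotopic_concat_left[OF assms(1), of \<beta>] eps_homotopic_ends[OF assms(1)]
    joinsD[OF assms(2)] by auto

lemma homotopic_concat_null_right:
  assumes "eps_homotopic X \<epsilon> \<beta> [b]" "joins X \<epsilon> a b \<alpha>"
  shows "eps_homotopic X \<epsilon> (\<alpha> @@ \<beta>) \<alpha>"
  using eps_homotopic_concat_right[OF assms(1), of \<alpha>] eps_homotopic_ends[OF assms(1)]
    joinsD[OF assms(2)] by auto

text \<open>Insert \<open>rev \<beta> @@ \<beta>\<close> after \<open>\<alpha>\<close> and regroup.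
  Equality of classes is thereby reduced to nullity of a loop, which is what length estimates can
  decide.\<close>

lemma eps_homotopic_if_quotient_null:
  assumes \<alpha>: "joins X \<epsilon> a b \<alpha>" and \<beta>: "joins X \<epsilon> a b \<beta>" and "\<epsilon> > 0"
    and null: "eps_homotopic X \<epsilon> (\<alpha> @@ rev \<beta>) [a]"
  shows "eps_homotopic X \<epsilon> \<alpha> \<beta>"
proof -
  note D = joinsD[OF \<alpha>] joinsD[OF \<beta>]
  have "eps_homotopic X \<epsilon> (\<alpha> @@ (rev \<beta> @@ \<beta>)) \<alpha>"
    using homotopic_concat_null_right[OF concat_rev_null(2)[OF \<beta> \<open>\<epsilon> > 0\<close>] \<alpha>] .
  moreover have "eps_homotopic X \<epsilon> ((\<alpha> @@ rev \<beta>) @@ \<beta>) \<beta>"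
    by (rule homotopic_concat_null_left[OF null \<beta>])
  moreover have "(\<alpha> @@ rev \<beta>) @@ \<beta> = \<alpha> @@ (rev \<beta> @@ \<beta>)"
    using D by (simp add: chain_concat_assoc)
  ultimately show ?thesis
    by (metis eps_homotopic_sym eps_homotopic_trans)
qed

lemma eps_homotopic_rev_cong:
  assumes "eps_homotopic X \<epsilon> \<alpha> \<beta>" "\<epsilon> > 0"
  shows "eps_homotopic X \<epsilon> (rev \<alpha>) (rev \<beta>)"
proof -
  have \<alpha>: "joins X \<epsilon> (hd \<alpha>) (last \<alpha>) \<alpha>"
    using eps_homotopic_ends[OF assms(1)] by (simp add: joins_def)
  have \<beta>: "joins X \<epsilon> (hd \<alpha>) (last \<alpha>) \<beta>"
    using \<alpha> assms(1) by (rule joins_homotopic)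
  have "eps_homotopic X \<epsilon> (rev \<alpha> @@ \<beta>) (rev \<alpha> @@ \<alpha>)"
    using assms(1) joins_rev[OF \<alpha>] joinsD[OF \<beta>]
    by (intro eps_homotopic_concat_right) (auto simp: eps_homotopic_sym joins_def)
  then have "eps_homotopic X \<epsilon> (rev \<alpha> @@ rev (rev \<beta>)) [last \<alpha>]"
    using concat_rev_null(2)[OF \<alpha> \<open>\<epsilon> > 0\<close>] eps_homotopic_trans by fastforce
  with joins_rev[OF \<alpha>] joins_rev[OF \<beta>] \<open>\<epsilon> > 0\<close> show ?thesis
    by (rule eps_homotopic_if_quotient_null)
qed

section \<open>Subdivisions of curves\<close>

text \<open>Repetitions are allowed, so that two subdivisions can be merged by mere
  \<open>insort\<close>. Strict order matters only for \<open>refinement\<close> and is restored in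
  \<open>subdivision_containing\<close>.\<close>

definition subdivision :: "real \<Rightarrow> real \<Rightarrow> real \<Rightarrow> real list \<Rightarrow> bool" where
  "subdivision \<eta> a b ts \<longleftrightarrow> 0 < \<eta> \<and> ts \<noteq> [] \<and> sorted ts \<and> hd ts = a \<and> last ts = b \<and>
     successively (\<lambda>s t. t - s < \<eta>) ts"

text \<open>The mesh \<open>\<eta>\<close> in time is kept apart from the scale
  \<open>\<epsilon>\<close> in space. For 1-Lipschitz curves they coincide; for an arbitrary path,
  as needed for surjectivity onto the fundamental group, \<open>\<eta>\<close> comes from uniform
  continuity.\<close>

definition modulus :: "'a::metric_space set \<Rightarrow> real \<Rightarrow> real \<Rightarrow> (real \<Rightarrow> 'a) \<Rightarrow> real \<Rightarrow> real \<Rightarrow> bool" where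
  "modulus X \<eta> \<epsilon> c a b \<longleftrightarrow> c ` {a..b} \<subseteq> X \<and>
     (\<forall>s t. a \<le> s \<and> s \<le> t \<and> t \<le> b \<and> t - s < \<eta> \<longrightarrow> dist (c s) (c t) < \<epsilon>)"

lemma sorted_bounds:
  fixes ts :: "real list"
  assumes "ts \<noteq> []" "sorted ts" "x \<in> set ts"
  shows "hd ts \<le> x" "x \<le> last ts"
proof -
  show "hd ts \<le> x" using assms by (cases ts) auto
  obtain us z where "ts = us @ [z]" using assms(1) by (metis append_butlast_last_id)
  then show "x \<le> last ts" using assms by (auto simp: sorted_append)
qed

lemma subdivision_bounds: "subdivision \<eta> a b ts \<Longrightarrow> set ts \<subseteq> {a..b}"
  using sorted_bounds by (fastforce simp: subdivision_def)

lemma subdivision_ends: "subdivision \<eta> a b ts \<Longrightarrow> a \<in> set ts \<and> b \<in> set ts \<and> a \<le> b"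
  using sorted_bounds[of ts "hd ts"] by (auto simp: subdivision_def)

lemma joins_map:
  assumes "modulus X \<eta> \<epsilon> c a b" "subdivision \<eta> a b ts"
  shows "joins X \<epsilon> (c a) (c b) (map c ts)"
proof -
  have "successively (\<lambda>s t. dist (c s) (c t) < \<epsilon>) ts"
    unfolding successively_conv_nth
  proof (intro allI impI)
    fix i assume i: "Suc i < length ts"
    have "ts ! i \<in> {a..b}" "ts ! Suc i \<in> {a..b}"
      using subdivision_bounds[OF assms(2)] i nth_mem Suc_lessD by blast+
    moreover have "ts ! i \<le> ts ! Suc i"
      using assms(2) i by (auto simp: subdivision_def sorted_iff_nth_Suc)
    moreover have "ts ! Suc i - ts ! i < \<eta>"
      using assms(2) i by (auto simp: subdivision_def successively_conv_nth)
    ultimately show "dist (c (ts ! i)) (c (ts ! Suc i)) < \<epsilon>"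
      using assms(1) by (auto simp: modulus_def)
  qed
  then show ?thesis
    using assms subdivision_bounds[OF assms(2)]
    by (force simp: joins_def eps_chain_def successively_map subdivision_def modulus_def
        hd_map last_map)
qed

lemma subdivision_mono: "subdivision \<eta> a b ts \<Longrightarrow> \<eta> \<le> \<eta>' \<Longrightarrow> subdivision \<eta>' a b ts"
  by (auto simp: subdivision_def elim!: successively_mono)

lemma insort_split:
  fixes ts :: "real list"
  assumes "sorted ts"
  shows "\<exists>us vs. ts = us @ vs \<and> insort u ts = us @ u # vs \<and> (\<forall>x\<in>set us. x < u) \<and> (\<forall>x\<in>set vs. u \<le> x)"
  using assms
proof (induction ts)
  case (Cons t ts)
  show ?case
  proof (cases "u \<le> t")
    case True
    then show ?thesis using Cons.prems by (intro exI[of _ "[]"] exI[of _ "t # ts"]) auto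
  next
    case False
    obtain us vs where "ts = us @ vs" "insort u ts = us @ u # vs" "\<forall>x\<in>set us. x < u" "\<forall>x\<in>set vs. u \<le> x"
      using Cons by auto
    with False show ?thesis by (intro exI[of _ "t # us"] exI[of _ vs]) auto
  qed
qed auto

text \<open>\<open>insort\<close> places \<open>u\<close> in front of the first entry that is at
  least \<open>u\<close>. So the last entry \<open>b\<close> stays behind \<open>u\<close>, and
  \<open>u\<close> comes first only if \<open>u = a\<close>: both ends survive.\<close>

lemma subdivision_insort:
  assumes "subdivision \<eta> a b ts" "a \<le> u" "u \<le> b"
  obtains us vs where "ts = us @ vs" "insort u ts = us @ u # vs" "subdivision \<eta> a b (insort u ts)"
    "vs \<noteq> []" "us \<noteq> [] \<or> u = a"
proof -
  have s: "sorted ts" "ts \<noteq> []" "hd ts = a" "last ts = b" "successively (\<lambda>s t. t - s < \<eta>) ts"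
    using assms by (auto simp: subdivision_def)
  obtain us vs where uv: "ts = us @ vs" "insort u ts = us @ u # vs"
      "\<forall>x\<in>set us. x < u" "\<forall>x\<in>set vs. u \<le> x"
    using insort_split[OF s(1)] by blast
  have vs: "vs \<noteq> []"
    using s uv assms(3) by (metis append_Nil2 last_in_set not_less)
  have us: "us \<noteq> [] \<or> u = a"
    using s uv assms(2) vs by (metis append_Nil hd_in_set order_antisym)
  have "successively (\<lambda>s t. t - s < \<eta>) (us @ u # vs)"
  proof -
    have 1: "successively (\<lambda>s t. t - s < \<eta>) us" "successively (\<lambda>s t. t - s < \<eta>) vs"
      using s(5) by (auto simp: uv successively_append_iff)
    have 2: "us \<noteq> [] \<Longrightarrow> hd vs - last us < \<eta>"
      using s(5) vs by (auto simp: uv successively_append_iff)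
    have 3: "us \<noteq> [] \<Longrightarrow> last us < u" "u \<le> hd vs"
      using uv vs by auto
    have 4: "hd vs - u < \<eta>"
    proof (cases "us = []")
      case True
      then show ?thesis using us s uv assms(1) by (auto simp: subdivision_def)
    qed (use 2 3 in linarith)
    have 5: "u - last us < \<eta>" if "us \<noteq> []"
      using 2[OF that] 3(1)[OF that] 3(2) by linarith
    show ?thesis using 1 4 5 vs by (auto simp: successively_append_iff successively_Cons)
  qed
  then have "subdivision \<eta> a b (insort u ts)"
    using s uv(1,2) us vs assms(1) sorted_insort[of u ts]
    by (auto simp: subdivision_def hd_append)
  with that uv us vs show thesis by blast
qed

lemma map_homotopic_insort:
  assumes m: "modulus X \<eta> \<epsilon> c a b" and ts: "subdivision \<eta> a b ts" and u: "u \<in> {a..b}"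
  shows "eps_homotopic X \<epsilon> (map c ts) (map c (insort u ts))"
    and "subdivision \<eta> a b (insort u ts)"
proof -
  have u': "a \<le> u" "u \<le> b" using u by auto
  obtain us vs where i: "ts = us @ vs" "insort u ts = us @ u # vs"
    "subdivision \<eta> a b (insort u ts)" "vs \<noteq> []" "us \<noteq> [] \<or> u = a"
    using subdivision_insort[OF ts u'] by blast
  show "subdivision \<eta> a b (insort u ts)" by fact
  have c: "joins X \<epsilon> (c a) (c b) (map c us @ map c vs)"
    "joins X \<epsilon> (c a) (c b) (map c us @ c u # map c vs)"
    using joins_map[OF m ts] joins_map[OF m i(3)] by (simp_all add: i(2)) (simp add: i(1))
  have "eps_homotopic X \<epsilon> (map c us @ map c vs) (map c us @ c u # map c vs)"
    using joinsD(1,3,4)[OF c(1)] joinsD(1,3,4)[OF c(2)]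
    by (intro eps_homotopic_add_point) auto
  then show "eps_homotopic X \<epsilon> (map c ts) (map c (insort u ts))"
    by (simp add: i(2)) (simp add: i(1))
qed

lemma map_homotopic_foldr_insort:
  assumes m: "modulus X \<eta> \<epsilon> c a b" and ts: "subdivision \<eta> a b ts" and "set us \<subseteq> {a..b}"
  shows "eps_homotopic X \<epsilon> (map c ts) (map c (foldr insort us ts)) \<and>
    subdivision \<eta> a b (foldr insort us ts)"
  using assms(3)
proof (induction us)
  case Nil
  then show ?case
    using ts joins_map[OF m ts] by (simp add: eps_homotopic_refl joinsD(1))
next
  case (Cons u us)
  then show ?case
    using map_homotopic_insort[OF m, of "foldr insort us ts" u] eps_homotopic_trans by fastforce
qed

text \<open>Both chains are homotopic to the one read off the merged subdivision, and merging in
  either order sorts the same multiset. The class thus belongs to the curve; most homotopies of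
  chains below are changes of subdivision.\<close>

lemma map_homotopic_subdivisions:
  assumes m: "modulus X \<eta> \<epsilon> c a b" and ts: "subdivision \<eta> a b ts" and us: "subdivision \<eta> a b us"
  shows "eps_homotopic X \<epsilon> (map c ts) (map c us)"
proof -
  have "foldr insort us ts = foldr insort ts us"
  proof -
    have f: "foldr insort us ts = sort (us @ ts)" if "sorted ts" for us ts :: "real list"
      using that by (metis foldr_append sort_key_def comp_apply sorted_sort_id)
    have "sort (us @ ts) = sort (ts @ us)"
      by (rule properties_for_sort) auto
    then show ?thesis
      using f[of ts us] f[of us ts] ts us by (simp add: subdivision_def)
  qed
  then show ?thesis
    using map_homotopic_foldr_insort[OF m ts subdivision_bounds[OF us]]
      map_homotopic_foldr_insort[OF m us subdivision_bounds[OF ts]]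
    by (metis eps_homotopic_sym eps_homotopic_trans)
qed

lemma subdivision_concat:
  assumes "subdivision \<eta> a b ts" "subdivision \<eta> b c us"
  shows "subdivision \<eta> a c (ts @@ us)" "map f (ts @@ us) = map f ts @@ map f us"
proof -
  obtain us' where us: "us = b # us'" using assms(2) by (cases us) (auto simp: subdivision_def)
  have "\<forall>x\<in>set ts. \<forall>y\<in>set us'. x \<le> y"
    using subdivision_bounds[OF assms(1)] assms(2) us by (force simp: subdivision_def)
  then show "subdivision \<eta> a c (ts @@ us)"
    using assms by (auto simp: subdivision_def chain_concat_def us sorted_append
        successively_append_iff successively_Cons)
  show "map f (ts @@ us) = map f ts @@ map f us"
    by (simp add: chain_concat_def us)
qed

lemma subdivision_single: "\<eta> > 0 \<Longrightarrow> subdivision \<eta> a a [a]"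
  by (simp add: subdivision_def)

lemma subdivision_exists:
  assumes "\<eta> > 0" "a \<le> b"
  shows "\<exists>ts. subdivision \<eta> a b ts"
proof -
  define h where "h = \<eta> / 2"
  have h: "0 < h" "h < \<eta>" using assms by (auto simp: h_def)
  have "\<exists>ts. subdivision \<eta> a b ts" if "a \<le> b" "b - a \<le> h * real n" for n b
    using that
  proof (induction n arbitrary: b)
    case 0
    then have "b = a" by simp
    then show ?case using assms subdivision_single by blast
  next
    case (Suc n)
    define d where "d = max a (b - h)"
    have d: "a \<le> d" "d \<le> b" "b - d < \<eta>" "d - a \<le> h * real n"
      using Suc.prems h by (auto simp: d_def algebra_simps max_def)
    have "subdivision \<eta> d b [d, b]"
      using d assms by (auto simp: subdivision_def)
    then show ?case
      using Suc.IH[OF d(1,4)] subdivision_concat(1) by blast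
  qed
  moreover obtain n where "(b - a) / h \<le> real n" using real_arch_simple by blast
  then have "b - a \<le> h * real n" using h by (simp add: field_simps)
  ultimately show ?thesis using assms(2) by blast
qed

section \<open>Length of chains and curves\<close>

fun len :: "'a::metric_space list \<Rightarrow> real" where
  "len (x # y # xs) = dist x y + len (y # xs)"
| "len _ = 0"

lemma len_nonneg: "0 \<le> len \<alpha>"
  by (induction \<alpha> rule: len.induct) auto

lemma len_append:
  "len (us @ x # vs) = len (us @ [x]) + len (x # vs)"
  by (induction us rule: len.induct) auto

lemma len_concat:
  assumes "\<alpha> \<noteq> []" "\<beta> \<noteq> []" "last \<alpha> = hd \<beta>"
  shows "len (\<alpha> @@ \<beta>) = len \<alpha> + len \<beta>"
proof -
  obtain us z where "\<alpha> = us @ [z]" using assms(1) by (metis append_butlast_last_id)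
  moreover obtain w vs where "\<beta> = w # vs" using assms(2) by (cases \<beta>) auto
  ultimately show ?thesis
    using assms(3) len_append[of us w vs] by (simp add: chain_concat_def)
qed

lemma len_rev: "len (rev \<alpha>) = len \<alpha>"
proof (induction \<alpha> rule: len.induct)
  case (1 x y xs)
  then show ?case
    using len_append[of "rev xs" y "[x]"] by (simp add: dist_commute)
qed auto

lemma len_eq_sum:
  "len \<alpha> = (\<Sum>i<length \<alpha> - 1. dist (\<alpha> ! i) (\<alpha> ! Suc i))"
proof (induction \<alpha> rule: len.induct)
  case (1 x y xs)
  then show ?case
    by (simp add: sum.lessThan_Suc_shift del: sum.lessThan_Suc)
qed auto

lemma path_length_eq:
  "path_length g a b = (SUP ts \<in> {ts. sorted ts \<and> set ts \<subseteq> {a..b}}. ennreal (len (map g ts)))"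
proof -
  have "(\<Sum>i<length ts - 1. dist (g (ts ! i)) (g (ts ! Suc i))) = len (map g ts)" for ts
    unfolding len_eq_sum by (intro sum.cong) auto
  then show ?thesis
    by (simp add: path_length_def)
qed

lemma len_le_path_length:
  "sorted ts \<Longrightarrow> set ts \<subseteq> {a..b} \<Longrightarrow> ennreal (len (map g ts)) \<le> path_length g a b"
  unfolding path_length_eq by (intro SUP_upper) auto

text \<open>The working notion of a curve is 1-Lipschitz instead of parameterized by arclength: it
  passes to joins and subintervals and bounds the length of each inscribed chain by the elapsed
  time. Exact arclength is recovered only for essential curves.\<close>

definition lip_curve :: "'a::metric_space set \<Rightarrow> (real \<Rightarrow> 'a) \<Rightarrow> real \<Rightarrow> real \<Rightarrow> bool" where
  "lip_curve X c a b \<longleftrightarrow> c ` {a..b} \<subseteq> X \<and>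
     (\<forall>s t. a \<le> s \<and> s \<le> t \<and> t \<le> b \<longrightarrow> dist (c s) (c t) \<le> t - s)"

lemma lip_curveD:
  assumes "lip_curve X c a b"
  shows "t \<in> {a..b} \<Longrightarrow> c t \<in> X"
    and "a \<le> s \<Longrightarrow> s \<le> t \<Longrightarrow> t \<le> b \<Longrightarrow> dist (c s) (c t) \<le> t - s"
  using assms by (auto simp: lip_curve_def)

lemma lip_curve_subset:
  "lip_curve X c a b \<Longrightarrow> a \<le> a' \<Longrightarrow> b' \<le> b \<Longrightarrow> lip_curve X c a' b'"
  unfolding lip_curve_def by (smt (verit) atLeastAtMost_iff image_subset_iff)

lemma lip_curve_modulus: "lip_curve X c a b \<Longrightarrow> modulus X \<epsilon> \<epsilon> c a b"
  unfolding lip_curve_def modulus_def by (metis le_less_trans)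

lemma lip_curve_continuous:
  assumes "lip_curve X c a b"
  shows "continuous_on {a..b} c"
proof -
  have "dist (c s) (c t) \<le> dist s t" if "s \<in> {a..b}" "t \<in> {a..b}" for s t
    using lip_curveD(2)[OF assms, of s t] lip_curveD(2)[OF assms, of t s] that
    by (cases "s \<le> t") (auto simp: dist_real_def dist_commute)
  then show ?thesis
    unfolding continuous_on_iff by (meson le_less_trans)
qed

lemma len_lipschitz_le:
  assumes "lip_curve X c a b" "ts \<noteq> []" "sorted ts" "set ts \<subseteq> {a..b}"
  shows "len (map c ts) \<le> last ts - hd ts"
  using assms(2-)
proof (induction ts rule: induct_list012)
  case (3 x y zs)
  then have "dist (c x) (c y) \<le> y - x"
    by (intro lip_curveD(2)[OF assms(1)]) auto
  with 3 show ?case by auto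
qed auto

lemma path_length_lipschitz_le:
  assumes "lip_curve X c a b" "a \<le> b"
  shows "path_length c a b \<le> ennreal (b - a)"
  unfolding path_length_eq
proof (rule SUP_least)
  fix ts assume ts: "ts \<in> {ts. sorted ts \<and> set ts \<subseteq> {a..b}}"
  show "ennreal (len (map c ts)) \<le> ennreal (b - a)"
  proof (cases "ts = []")
    case False
    then have "hd ts \<in> {a..b}" "last ts \<in> {a..b}"
      using ts hd_in_set last_in_set by blast+
    then show ?thesis
      using len_lipschitz_le[OF assms(1) False] ts by (intro ennreal_leI) auto
  qed (use assms in auto)
qed

text \<open>Arclength gives at most \<open>t - s\<close> on each of the three pieces cut out by
  \<open>s\<close> and \<open>t\<close>. If the middle piece fell short, the triangle inequality
  would bring the endpoints closer than \<open>dist x y\<close>.\<close>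

lemma geodesic_isometric:
  assumes "geodesic X g x y" "0 \<le> s" "s \<le> t" "t \<le> dist x y"
  shows "dist (g s) (g t) = t - s"
proof -
  have le: "dist (g s) (g t) \<le> t - s" if "0 \<le> s" "s \<le> t" "t \<le> dist x y" for s t
  proof -
    have "ennreal (dist (g s) (g t)) \<le> path_length g s t"
      using len_le_path_length[of "[s, t]" s t g] that by simp
    also have "\<dots> = ennreal (t - s)"
      using assms(1) that by (auto simp: geodesic_def arclength_parameterized_def)
    finally show ?thesis using that by (simp add: ennreal_le_iff)
  qed
  have "dist x y = dist (g 0) (g (dist x y))"
    using assms(1) by (simp add: geodesic_def)
  also have "\<dots> \<le> dist (g 0) (g s) + dist (g s) (g t) + dist (g t) (g (dist x y))"
    using dist_triangle[of "g 0" "g (dist x y)" "g s"] dist_triangle[of "g s" "g (dist x y)" "g t"]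
    by linarith
  finally show ?thesis
    using le[of 0 s] le[of s t] le[of t "dist x y"] assms by force
qed

lemma isometric_arclength_parameterized:
  assumes "lip_curve X c a b"
    and "\<And>s t. a \<le> s \<Longrightarrow> s \<le> t \<Longrightarrow> t \<le> b \<Longrightarrow> \<exists>ts. sorted ts \<and> set ts \<subseteq> {s..t} \<and> t - s \<le> len (map c ts)"
  shows "arclength_parameterized c a b"
  unfolding arclength_parameterized_def
proof (intro conjI allI impI)
  show "continuous_on {a..b} c" by (rule lip_curve_continuous[OF assms(1)])
  fix s t assume st: "a \<le> s \<and> s \<le> t \<and> t \<le> b"
  obtain ts where "sorted ts" "set ts \<subseteq> {s..t}" "t - s \<le> len (map c ts)"
    using assms(2) st by blast
  then have "ennreal (t - s) \<le> path_length c s t"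
    using len_le_path_length[of ts s t c] by (meson ennreal_leI order_trans)
  moreover have "path_length c s t \<le> ennreal (t - s)"
    using path_length_lipschitz_le[of X c s t] lip_curve_subset[OF assms(1)] st by blast
  ultimately show "path_length c s t = ennreal (t - s)" by simp
qed

lemma isometric_geodesic:
  assumes "g ` {0..d} \<subseteq> X" "\<And>s t. 0 \<le> s \<Longrightarrow> s \<le> t \<Longrightarrow> t \<le> d \<Longrightarrow> dist (g s) (g t) = t - s" "0 \<le> d"
  shows "geodesic X g (g 0) (g d)"
proof -
  have d: "dist (g 0) (g d) = d" using assms(2)[of 0 d] assms(3) by simp
  have "arclength_parameterized g 0 d"
  proof (rule isometric_arclength_parameterized)
    show "lip_curve X g 0 d"
      using assms by (auto simp: lip_curve_def)
    fix s t assume "0 \<le> s" "s \<le> t" "t \<le> d"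
    then show "\<exists>ts. sorted ts \<and> set ts \<subseteq> {s..t} \<and> t - s \<le> len (map g ts)"
      using assms(2) by (intro exI[of _ "[s, t]"]) auto
  qed
  then show ?thesis using assms(1) by (simp add: geodesic_def d)
qed

lemma geodesic_lipschitz: "geodesic X g x y \<Longrightarrow> lip_curve X g 0 (dist x y)"
  using geodesic_isometric[of X g x y] by (simp add: lip_curve_def geodesic_def)

lemma lip_curve_join:
  assumes g: "lip_curve X g 0 d" and c: "lip_curve X c 0 l" and "g d = c 0" "0 \<le> d" "0 \<le> l"
  shows "lip_curve X (\<lambda>t. if t \<le> d then g t else c (t - d)) 0 (d + l)"
  unfolding lip_curve_def
proof (intro conjI allI impI image_subsetI)
  fix t assume "t \<in> {0..d + l}"
  then show "(if t \<le> d then g t else c (t - d)) \<in> X"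
    using lip_curveD(1)[OF g] lip_curveD(1)[OF c] by auto
next
  fix s t assume st: "0 \<le> s \<and> s \<le> t \<and> t \<le> d + l"
  consider "t \<le> d" | "s \<le> d" "d < t" | "d < s" by linarith
  then show "dist (if s \<le> d then g s else c (s - d)) (if t \<le> d then g t else c (t - d)) \<le> t - s"
  proof cases
    case 1
    then show ?thesis using lip_curveD(2)[OF g, of s t] st by simp
  next
    case 2
    then show ?thesis
      using lip_curveD(2)[OF g, of s d] lip_curveD(2)[OF c, of 0 "t - d"] st assms(3)
        dist_triangle[of "g s" "c (t - d)" "g d"] by auto
  next
    case 3
    then show ?thesis using lip_curveD(2)[OF c, of "s - d" "t - d"] st by auto
  qed
qed

abbreviation unit_speed :: "(real \<Rightarrow> 'a::metric_space) \<Rightarrow> real list \<Rightarrow> bool" where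
  "unit_speed c \<equiv> successively (\<lambda>s t. dist (c s) (c t) = t - s)"

definition arc_parameter :: "'a::metric_space set \<Rightarrow> 'a list \<Rightarrow> (real \<Rightarrow> 'a) \<Rightarrow> real list \<Rightarrow> bool" where
  "arc_parameter X \<alpha> c ts \<longleftrightarrow> lip_curve X c 0 (len \<alpha>) \<and> ts \<noteq> [] \<and> sorted ts \<and>
     hd ts = 0 \<and> last ts = len \<alpha> \<and> map c ts = \<alpha> \<and>
     unit_speed c ts"

lemma arc_parameter_exists:
  assumes "geodesic_space X" "\<alpha> \<noteq> []" "set \<alpha> \<subseteq> X"
  shows "\<exists>c ts. arc_parameter X \<alpha> c ts"
  using assms(2,3)
proof (induction \<alpha> rule: len.induct)
  case (1 x y xs)
  define l where "l = len (y # xs)"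
  define d where "d = dist x y"
  have "\<exists>c ts. arc_parameter X (y # xs) c ts" using 1 by simp
  then obtain c ts where "arc_parameter X (y # xs) c ts" by blast
  then have c: "lip_curve X c 0 l" "ts \<noteq> []" "sorted ts" "hd ts = 0"
    "last ts = l" "map c ts = y # xs" "unit_speed c ts"
    unfolding l_def arc_parameter_def by simp_all
  have "x \<in> X" "y \<in> X" using "1.prems" by auto
  then obtain g where g: "geodesic X g x y" using assms(1) unfolding geodesic_space_def by blast
  have g0: "g 0 = x" "g d = y" using g by (auto simp: geodesic_def d_def)
  have c0: "c 0 = y" using c by (cases ts) auto
  define h where "h = (\<lambda>t. if t \<le> d then g t else c (t - d))"
  have d: "0 \<le> d" and l: "0 \<le> l" by (auto simp: d_def l_def len_nonneg)
  have hc: "h (t + d) = c t" if "0 \<le> t" for t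
    using that g0 c0 by (cases "t = 0") (auto simp: h_def)
  have ts0: "\<forall>t\<in>set ts. 0 \<le> t" using sorted_bounds(1)[of ts] c by auto
  have h: "lip_curve X h 0 (d + l)"
    unfolding h_def using geodesic_lipschitz[OF g] c g0 c0 d l
    by (intro lip_curve_join) (auto simp: d_def)
  define us where "us = 0 # map (\<lambda>t. t + d) ts"
  have "map (\<lambda>t. h (t + d)) ts = map c ts"
    using hc ts0 by auto
  moreover have "h 0 = x"
    using g0 d by (simp add: h_def)
  ultimately have "map h us = x # y # xs"
    using c(6) by (simp add: us_def comp_def)
  moreover have "successively (\<lambda>s t. dist (h s) (h t) = t - s) us"
  proof -
    have "successively (\<lambda>s t. dist (h s) (h t) = t - s) (map (\<lambda>t. t + d) ts)"
      unfolding successively_map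
      by (rule successively_mono[OF c(7)]) (use ts0 hc in auto)
    moreover have "dist (h 0) (h d) = d" using g0 d by (simp add: h_def d_def)
    ultimately show ?thesis using c(2,4) by (simp add: us_def successively_Cons hd_map)
  qed
  moreover have "sorted us" "hd us = 0" "last us = d + l" "us \<noteq> []"
    using c ts0 d by (auto simp: us_def sorted_map last_map)
  ultimately have "arc_parameter X (x # y # xs) h us"
    using h unfolding arc_parameter_def l_def d_def by simp
  then show ?case by blast
next
  case ("2_2" x)
  have "lip_curve X (\<lambda>_. x) 0 (len [x])"
    using "2_2.prems" by (auto simp: lip_curve_def)
  moreover have "map (\<lambda>_. x) [0::real] = [x]" by simp
  ultimately have "arc_parameter X [x] (\<lambda>_. x) [0]"
    by (simp add: arc_parameter_def)
  then show ?case by blast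
qed simp

text \<open>Along joined geodesics the time between consecutive points equals their distance, so the
  times at which the curve meets the chain have mesh below \<open>\<epsilon>\<close>. Chains can
  therefore be handled as curves.\<close>

lemma chain_curve_subdivision:
  assumes "geodesic_space X" "eps_chain X \<epsilon> \<alpha>" "\<epsilon> > 0"
  obtains c ts where "lip_curve X c 0 (len \<alpha>)"
    "subdivision \<epsilon> 0 (len \<alpha>) ts" "map c ts = \<alpha>"
proof -
  have \<alpha>: "\<alpha> \<noteq> []" "set \<alpha> \<subseteq> X" "successively (\<lambda>x y. dist x y < \<epsilon>) \<alpha>"
    using assms by (auto simp: eps_chain_def)
  obtain c ts where "arc_parameter X \<alpha> c ts"
    using arc_parameter_exists[OF assms(1) \<alpha>(1,2)] by blast
  then have c: "lip_curve X c 0 (len \<alpha>)" "ts \<noteq> []" "sorted ts" "hd ts = 0"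
    "last ts = len \<alpha>" "map c ts = \<alpha>" "unit_speed c ts"
    unfolding arc_parameter_def by simp_all
  have "successively (\<lambda>s t. dist (c s) (c t) < \<epsilon>) ts"
    using \<alpha>(3) unfolding c(6)[symmetric] successively_map .
  with c(7) have "successively (\<lambda>s t. t - s < \<epsilon>) ts"
    by (auto simp: successively_conv_nth)
  with c \<open>\<epsilon> > 0\<close> that show thesis by (auto simp: subdivision_def)
qed

section \<open>Short loops are null\<close>

locale geodesic_set =
  fixes X :: "'a::metric_space set"
  assumes geodesic_space: "geodesic_space X"
begin

text \<open>Subdividing at the thirds leaves a closed chain of three points. Three is the decisive
  number: any two of them are neighbours, whereas of four points opposite ones could be too far
  apart to drop what lies between.\<close>

lemma closed_curve_null:
  assumes c: "lip_curve X c a b" and "a \<le> b" "b - a < 3 * \<epsilon>" "c a = c b" "\<epsilon> > 0"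
    and ts: "subdivision \<epsilon> a b ts"
  shows "eps_homotopic X \<epsilon> (map c ts) [c a]"
proof -
  define h where "h = (b - a) / 3"
  have h: "0 \<le> h" "h < \<epsilon>" "b = a + 3 * h" using assms by (simp_all add: h_def field_simps)
  define x y where "x = c (a + h)" and "y = c (a + 2 * h)"
  have "subdivision \<epsilon> a b [a, a + h, a + 2 * h, b]"
    using h \<open>\<epsilon> > 0\<close> by (simp add: subdivision_def)
  then have 1: "eps_homotopic X \<epsilon> (map c ts) [c a, x, y, c a]"
    using map_homotopic_subdivisions[OF lip_curve_modulus[OF c] ts] assms(4)
    by (fastforce simp: x_def y_def)
  have X: "c a \<in> X" "x \<in> X" "y \<in> X"
    using lip_curveD(1)[OF c] h by (auto simp: x_def y_def)
  have d: "dist (c a) x < \<epsilon>" "dist x y < \<epsilon>" "dist y (c a) < \<epsilon>"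
    using lip_curveD(2)[OF c, of a "a + h"] lip_curveD(2)[OF c, of "a + h" "a + 2 * h"]
      lip_curveD(2)[OF c, of "a + 2 * h" b] h assms(4) by (auto simp: x_def y_def)
  have 2: "eps_homotopic X \<epsilon> [c a, x, c a] [c a, x, y, c a]"
    using eps_homotopic_add_point[of X \<epsilon> "[c a, x]" "[c a]" y] X d
    by (simp add: eps_chain_def dist_commute)
  have 3: "eps_homotopic X \<epsilon> [c a, c a] [c a, x, c a]"
    using eps_homotopic_add_point[of X \<epsilon> "[c a]" "[c a]" x] X d \<open>\<epsilon> > 0\<close>
    by (simp add: eps_chain_def dist_commute)
  have 4: "eps_homotopic X \<epsilon> [c a] [c a, c a]"
    using eps_homotopic_add_point[of X \<epsilon> "[]" "[c a]" "c a"] X \<open>\<epsilon> > 0\<close>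
    by (simp add: eps_chain_def)
  show ?thesis
    using 1 2 3 4 eps_homotopic_equiv by metis
qed

lemma short_loop_null:
  assumes \<alpha>: "joins X \<epsilon> a a \<alpha>" and "len \<alpha> < 3 * \<epsilon>" "\<epsilon> > 0"
  shows "eps_homotopic X \<epsilon> \<alpha> [a]"
proof -
  obtain c ts where c: "lip_curve X c 0 (len \<alpha>)"
    "subdivision \<epsilon> 0 (len \<alpha>) ts" "map c ts = \<alpha>"
    using chain_curve_subdivision[OF geodesic_space joinsD(1)[OF \<alpha>] \<open>\<epsilon> > 0\<close>] by blast
  have "ts \<noteq> []" "hd ts = 0" "last ts = len \<alpha>"
    using c(2) by (auto simp: subdivision_def)
  then have "c 0 = a" "c (len \<alpha>) = a"
    using c(3) joinsD(3,4)[OF \<alpha>] by (auto simp: hd_map last_map)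
  then show ?thesis
    using closed_curve_null[OF c(1) _ _ _ assms(3) c(2)] assms(2) c(3) len_nonneg[of \<alpha>] by auto
qed

lemma homotopic_if_short:
  assumes \<alpha>: "joins X \<epsilon> a b \<alpha>" and \<beta>: "joins X \<epsilon> a b \<beta>"
    and "len \<alpha> + len \<beta> < 3 * \<epsilon>" "\<epsilon> > 0"
  shows "eps_homotopic X \<epsilon> \<alpha> \<beta>"
proof (rule eps_homotopic_if_quotient_null[OF \<alpha> \<beta> \<open>\<epsilon> > 0\<close>])
  have "len (\<alpha> @@ rev \<beta>) = len \<alpha> + len \<beta>"
    using joinsD[OF \<alpha>] joinsD[OF \<beta>]
    by (subst len_concat) (auto simp: len_rev hd_rev)
  then show "eps_homotopic X \<epsilon> (\<alpha> @@ rev \<beta>) [a]"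
    using short_loop_null[OF joins_concat[OF \<alpha> joins_rev[OF \<beta>]]] assms by simp
qed

text \<open>The curve through \<open>\<alpha>\<close> is subdivided more finely. An inscribed chain
  is no longer than the curve, hence the bound on \<open>len \<beta>\<close>, on which
  \<open>fill\<close> relies.\<close>

lemma chain_refine:
  assumes \<alpha>: "joins X \<epsilon> a b \<alpha>" and "0 < \<sigma>" "\<sigma> \<le> \<epsilon>"
  obtains \<beta> where "joins X \<sigma> a b \<beta>" "eps_homotopic X \<epsilon> \<alpha> \<beta>" "len \<beta> \<le> len \<alpha>"
proof -
  have "\<epsilon> > 0" using assms by simp
  obtain c ts where c: "lip_curve X c 0 (len \<alpha>)"
    "subdivision \<epsilon> 0 (len \<alpha>) ts" "map c ts = \<alpha>"
    using chain_curve_subdivision[OF geodesic_space joinsD(1)[OF \<alpha>] \<open>\<epsilon> > 0\<close>] by blast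
  obtain us where us: "subdivision \<sigma> 0 (len \<alpha>) us"
    using subdivision_exists[OF \<open>0 < \<sigma>\<close> len_nonneg] by blast
  have "ts \<noteq> []" "hd ts = 0" "last ts = len \<alpha>"
    using c(2) by (auto simp: subdivision_def)
  then have "c 0 = a" "c (len \<alpha>) = b"
    using c(3) joinsD(3,4)[OF \<alpha>] by (auto simp: hd_map last_map)
  then have "joins X \<sigma> a b (map c us)"
    using joins_map[OF lip_curve_modulus[OF c(1)] us] by simp
  moreover have "eps_homotopic X \<epsilon> \<alpha> (map c us)"
    using map_homotopic_subdivisions[OF lip_curve_modulus[OF c(1)] c(2) subdivision_mono[OF us assms(3)]] c(3)
    by simp
  moreover have "len (map c us) \<le> len \<alpha>"
    using len_lipschitz_le[OF c(1), of us] us subdivision_bounds[OF us]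
    by (auto simp: subdivision_def)
  ultimately show thesis by (rule that)
qed

lemma short_chain_exists:
  assumes "a \<in> X" "b \<in> X" "0 < \<sigma>"
  obtains \<beta> where "joins X \<sigma> a b \<beta>" "len \<beta> \<le> dist a b"
proof -
  \<comment> \<open>This scale is large enough for the two points to form a chain and is at least
    \<open>\<sigma>\<close>, so that \<open>chain_refine\<close> applies.\<close>
  have "joins X (max \<sigma> (dist a b + 1)) a b [a, b]"
    using assms by (auto simp: joins_def eps_chain_def)
  from chain_refine[OF this \<open>0 < \<sigma>\<close>] that show thesis by auto
qed

end

lemma subdivision_containing:
  assumes "\<eta> > 0" "a \<le> b" "set us \<subseteq> {a..b}"
  obtains ts where "subdivision \<eta> a b ts" "set us \<subseteq> set ts" "sorted_wrt (<) ts"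
proof -
  obtain ts0 where "subdivision \<eta> a b ts0" using subdivision_exists[OF assms(1,2)] by blast
  then have "\<exists>ts. subdivision \<eta> a b ts \<and> set us \<subseteq> set ts"
    using assms(3)
  proof (induction us)
    case (Cons u us)
    then obtain ts where ts: "subdivision \<eta> a b ts" "set us \<subseteq> set ts" by auto
    have "a \<le> u" "u \<le> b" using Cons.prems by auto
    then have "subdivision \<eta> a b (insort u ts)" using subdivision_insort[OF ts(1)] by blast
    with ts(2) show ?case by (intro exI[of _ "insort u ts"]) (auto simp: set_insort_key)
  qed auto
  then obtain ts where ts: "subdivision \<eta> a b ts" "set us \<subseteq> set ts" by blast
  \<comment> \<open>Removing adjacent repetitions makes a sorted list strictly sorted without losing
    any of its points.\<close>
  define ts' where "ts' = remdups_adj ts"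
  have "successively (\<lambda>s t. t - s < \<eta>) ts'"
    using ts(1) by (simp add: ts'_def subdivision_def successively_remdups_adjI)
  then have "subdivision \<eta> a b ts'"
    using ts(1) by (simp add: subdivision_def ts'_def)
  moreover have "sorted_wrt (<) ts'"
  proof -
    have "successively (\<noteq>) ts'"
      using distinct_adj_remdups_adj[of ts] by (simp add: ts'_def distinct_adj_def)
    moreover have "sorted ts'" using ts(1) by (simp add: subdivision_def ts'_def)
    ultimately have "successively (<) ts'"
      by (auto simp: successively_conv_nth sorted_iff_nth_Suc less_le)
    then show ?thesis by (simp add: successively_conv_sorted_wrt transp_on_less)
  qed
  ultimately show thesis using that[of ts'] ts(2) by (simp add: ts'_def)
qed

section \<open>Filling in chains\<close>

context geodesic_set
begin

text \<open>A choice of chain that is no longer than a geodesic. By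
  \<open>homotopic_if_short\<close> all such choices are \<open>\<sigma>\<close>-homotopic as soon
  as \<open>2 * dist a b < 3 * \<sigma>\<close>.\<close>

definition fill :: "real \<Rightarrow> 'a \<Rightarrow> 'a \<Rightarrow> 'a list" where
  "fill \<sigma> a b = (SOME \<beta>. joins X \<sigma> a b \<beta> \<and> len \<beta> \<le> dist a b)"

lemma fill:
  assumes "a \<in> X" "b \<in> X" "0 < \<sigma>"
  shows "joins X \<sigma> a b (fill \<sigma> a b)" "len (fill \<sigma> a b) \<le> dist a b"
proof -
  have "\<exists>\<beta>. joins X \<sigma> a b \<beta> \<and> len \<beta> \<le> dist a b"
    using short_chain_exists[OF assms] by blast
  then have "joins X \<sigma> a b (fill \<sigma> a b) \<and> len (fill \<sigma> a b) \<le> dist a b"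
    unfolding fill_def by (rule someI_ex)
  then show "joins X \<sigma> a b (fill \<sigma> a b)" "len (fill \<sigma> a b) \<le> dist a b" by auto
qed

fun fills :: "real \<Rightarrow> 'a list \<Rightarrow> 'a list" where
  "fills \<sigma> (x # y # xs) = fill \<sigma> x y @@ fills \<sigma> (y # xs)"
| "fills \<sigma> \<alpha> = \<alpha>"

lemma fills_between:
  assumes "\<alpha> \<noteq> []" "set \<alpha> \<subseteq> X" "0 < \<sigma>"
  shows "joins X \<sigma> (hd \<alpha>) (last \<alpha>) (fills \<sigma> \<alpha>)"
  using assms
proof (induction \<sigma> \<alpha> rule: fills.induct)
  case (1 \<sigma> x y xs)
  then have "joins X \<sigma> y (last (y # xs)) (fills \<sigma> (y # xs))" by simp
  moreover have "joins X \<sigma> x y (fill \<sigma> x y)" using 1 by (intro fill) auto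
  ultimately show ?case using joins_concat by fastforce
next
  case ("2_2" \<sigma> v)
  then show ?case by (simp add: joins_single)
qed auto

lemma fills_append:
  assumes "set (us @ a # vs) \<subseteq> X" "0 < \<sigma>"
  shows "fills \<sigma> (us @ a # vs) = fills \<sigma> (us @ [a]) @@ fills \<sigma> (a # vs)"
  using assms
proof (induction us)
  case Nil
  have "joins X \<sigma> a (last (a # vs)) (fills \<sigma> (a # vs))"
    using fills_between[of "a # vs" \<sigma>] Nil by simp
  then show ?case by (simp add: joinsD)
next
  case (Cons u us)
  obtain w ws where w: "us @ [a] = w # ws" by (cases us) auto
  then have w': "us @ a # vs = w # ws @ vs" by (metis append_Cons append_assoc append_self_conv2)
  have "fills \<sigma> (w # ws) \<noteq> []"
    using fills_between[of "w # ws" \<sigma>] Cons.prems w' by (auto simp: joinsD)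
  with Cons show ?case
    by (simp add: w w' chain_concat_assoc)
qed

lemma fills_homotopic:
  assumes "eps_chain X \<sigma> \<alpha>" "0 < \<sigma>"
  shows "eps_homotopic X \<sigma> (fills \<sigma> \<alpha>) \<alpha>"
  using assms
proof (induction \<sigma> \<alpha> rule: fills.induct)
  case (1 \<sigma> x y xs)
  have X: "x \<in> X" "y \<in> X" "dist x y < \<sigma>" "eps_chain X \<sigma> (y # xs)"
    using "1.prems" by (auto simp: eps_chain_def)
  have xy: "joins X \<sigma> x y [x, y]" using X by (simp add: joins_def eps_chain_def)
  have "eps_homotopic X \<sigma> (fill \<sigma> x y) [x, y]"
    using fill[OF X(1,2) \<open>0 < \<sigma>\<close>] X \<open>0 < \<sigma>\<close> by (intro homotopic_if_short[OF _ xy]) auto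
  moreover have "last (fill \<sigma> x y) = hd (fills \<sigma> (y # xs))"
    using joinsD(4)[OF fill(1)[OF X(1,2) \<open>0 < \<sigma>\<close>]] fills_between[of "y # xs" \<sigma>] X(4) \<open>0 < \<sigma>\<close>
    by (auto simp: joinsD eps_chain_def)
  ultimately have "eps_homotopic X \<sigma> (fill \<sigma> x y @@ fills \<sigma> (y # xs)) ([x, y] @@ (y # xs))"
    using "1.IH"[OF X(4) \<open>0 < \<sigma>\<close>] by (intro eps_homotopic_concat)
  then show ?case by (simp add: chain_concat_def)
qed (auto simp: eps_homotopic_refl)

lemma fill_same_null:
  assumes "a \<in> X" "0 < \<sigma>"
  shows "eps_homotopic X \<sigma> (fill \<sigma> a a) [a]"
  using fill[OF assms(1,1,2)] assms by (intro short_loop_null) auto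

end

section \<open>Filled loops modulo a subgroup\<close>

locale pointed_geodesic_set = geodesic_set +
  fixes p
  assumes base_point: "p \<in> X"
begin

abbreviation \<pi> where "\<pi> \<sigma> \<equiv> pi_eps X \<sigma> p"
abbreviation cl where "cl \<sigma> \<equiv> eps_class X \<sigma>"

lemma cl_eqI: "eps_homotopic X \<sigma> \<alpha> \<beta> \<Longrightarrow> cl \<sigma> \<alpha> = cl \<sigma> \<beta>"
  using eps_class_eq_iff eps_homotopic_ends by blast

lemma cl_eqD: "joins X \<sigma> a b \<alpha> \<Longrightarrow> cl \<sigma> \<alpha> = cl \<sigma> \<beta> \<Longrightarrow> eps_homotopic X \<sigma> \<alpha> \<beta>"
  using eps_class_eq_iff joinsD(1) by blast

lemma carrier_pi: "carrier (\<pi> \<sigma>) = {cl \<sigma> \<alpha> |\<alpha>. joins X \<sigma> p p \<alpha>}"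
  by (simp add: pi_eps_def eps_loop_iff)

lemma cl_in_carrier: "joins X \<sigma> p p \<alpha> \<Longrightarrow> cl \<sigma> \<alpha> \<in> carrier (\<pi> \<sigma>)"
  by (auto simp: carrier_pi)

lemma cl_mult:
  "joins X \<sigma> p p \<alpha> \<Longrightarrow> joins X \<sigma> p p \<beta> \<Longrightarrow>
    cl \<sigma> \<alpha> \<otimes>\<^bsub>\<pi> \<sigma>\<^esub> cl \<sigma> \<beta> = cl \<sigma> (\<alpha> @@ \<beta>)"
  by (rule pi_eps_mult) (auto simp: joinsD)

lemma cl_one: "\<one>\<^bsub>\<pi> \<sigma>\<^esub> = cl \<sigma> [p]"
  by (simp add: pi_eps_def)

lemma group_pi: "0 < \<sigma> \<Longrightarrow> group (\<pi> \<sigma>)"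
  by (rule group_pi_eps[OF base_point])

lemma cl_inv:
  assumes "joins X \<sigma> p p \<alpha>" "0 < \<sigma>"
  shows "inv\<^bsub>\<pi> \<sigma>\<^esub> (cl \<sigma> \<alpha>) = cl \<sigma> (rev \<alpha>)"
proof -
  interpret group "\<pi> \<sigma>" by (rule group_pi[OF assms(2)])
  note r = joins_rev[OF assms(1)]
  have "cl \<sigma> (rev \<alpha>) \<otimes>\<^bsub>\<pi> \<sigma>\<^esub> cl \<sigma> \<alpha> = \<one>\<^bsub>\<pi> \<sigma>\<^esub>"
    using cl_mult[OF r assms(1)] cl_eqI[OF concat_rev_null(2)[OF assms]] cl_one by simp
  then show ?thesis
    using inv_equality cl_in_carrier[OF assms(1)] cl_in_carrier[OF r] by blast
qed

text \<open>Adding a point \<open>x\<close> between \<open>a\<close> and \<open>b\<close> multiplies the class of the filled chain by a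
  conjugate of the filled triangle \<open>a, x, b\<close>.\<close>

lemma fills_add_point:
  assumes \<sigma>: "0 < \<sigma>" "2 * \<delta> \<le> 3 * \<sigma>" and H: "subgroup H (\<pi> \<sigma>)"
    and tri: "\<And>k. joins X \<sigma> p a k \<Longrightarrow>
      cl \<sigma> (k @@ (fill \<sigma> a x @@ fill \<sigma> x b @@ fill \<sigma> b a) @@ rev k) \<in> H"
    and \<beta>: "joins X \<delta> p p (us @ a # x # b # vs)" and ab: "dist a b < \<delta>"
  shows "cl \<sigma> (fills \<sigma> (us @ a # b # vs)) \<in> H \<longleftrightarrow> cl \<sigma> (fills \<sigma> (us @ a # x # b # vs)) \<in> H"
proof -
  interpret group "\<pi> \<sigma>" by (rule group_pi[OF \<sigma>(1)])
  have X: "a \<in> X" "x \<in> X" "b \<in> X" "set us \<subseteq> X" "set vs \<subseteq> X"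
    using joinsD(5)[OF \<beta>] by auto
  define A B F1 F2 F3 F4 where "A = fills \<sigma> (us @ [a])" and "B = fills \<sigma> (b # vs)"
    and "F1 = fill \<sigma> a x" and "F2 = fill \<sigma> x b" and "F3 = fill \<sigma> b a" and "F4 = fill \<sigma> a b"
  have p: "hd (us @ [a]) = p" "last (b # vs) = p"
    using joinsD(3,4)[OF \<beta>] by (auto simp: hd_append split: if_splits)
  have A: "joins X \<sigma> p a A"
    using fills_between[of "us @ [a]" \<sigma>] X p \<sigma> by (simp add: A_def)
  have B: "joins X \<sigma> b p B"
    using fills_between[of "b # vs" \<sigma>] X p \<sigma> by (simp add: B_def)
  have F: "joins X \<sigma> a x F1" "joins X \<sigma> x b F2"
    "joins X \<sigma> b a F3" "joins X \<sigma> a b F4"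
    using fill(1) X \<sigma>(1) by (auto simp: F1_def F2_def F3_def F4_def)
  have ne: "A \<noteq> []" "B \<noteq> []" "F1 \<noteq> []" "F2 \<noteq> []" "F3 \<noteq> []" "F4 \<noteq> []" "rev A \<noteq> []"
    using A B F by (auto dest: joinsD(2))
  define T where "T = F1 @@ F2 @@ F3"
  have T: "joins X \<sigma> a a T"
    unfolding T_def using F by (blast intro: joins_concat)
  have f1: "fills \<sigma> (us @ a # b # vs) = A @@ F4 @@ B"
    using fills_append[of us a "b # vs" \<sigma>] X \<sigma> by (simp add: A_def B_def F4_def)
  have f2: "fills \<sigma> (us @ a # x # b # vs) = A @@ F1 @@ F2 @@ B"
    using fills_append[of us a "x # b # vs" \<sigma>] X \<sigma> by (simp add: A_def B_def F1_def F2_def)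
  have AFB: "joins X \<sigma> p p (A @@ F4 @@ B)"
    using A B F by (blast intro: joins_concat)
  have ATA: "joins X \<sigma> p p (A @@ T @@ rev A)"
    using A T by (blast intro: joins_rev joins_concat)
  \<comment> \<open>The same side filled in both directions is a loop of length at most
    \<open>2 * dist a b\<close>, which is less than \<open>2 * \<delta>\<close>: the place where
    \<open>2 * \<delta> \<le> 3 * \<sigma>\<close> is used.\<close>
  have f34: "eps_homotopic X \<sigma> (F3 @@ F4) [b]"
  proof (rule short_loop_null)
    show "joins X \<sigma> b b (F3 @@ F4)" using F by (blast intro: joins_concat)
    have "len (F3 @@ F4) = len F3 + len F4"
      using F by (intro len_concat) (auto simp: joinsD)
    also have "\<dots> \<le> 2 * dist a b"
      using fill(2)[of a b \<sigma>] fill(2)[of b a \<sigma>] X \<sigma> by (simp add: F3_def F4_def dist_commute)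
    finally show "len (F3 @@ F4) < 3 * \<sigma>" using ab \<sigma> by linarith
  qed (rule \<sigma>)
  \<comment> \<open>In groupoid notation, with a prime for the inverse: (A T A') (A F4 B) = A T F4 B
    = A F1 F2 (F3 F4) B = A F1 F2 B. Only the two cancellations are homotopies; the rest is
    associativity.\<close>
  have "eps_homotopic X \<sigma> ((rev A @@ A) @@ F4 @@ B) (F4 @@ B)"
    using concat_rev_null(2)[OF A \<sigma>(1)] joins_concat[OF F(4) B]
    by (rule homotopic_concat_null_left)
  moreover have "last (A @@ T) = hd ((rev A @@ A) @@ F4 @@ B)" "eps_chain X \<sigma> (A @@ T)"
    using joinsD(1,4)[OF joins_concat[OF A T]]
      joinsD(3)[OF joins_concat[OF joins_concat[OF joins_rev[OF A] A]
        joins_concat[OF F(4) B]]]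
    by simp_all
  ultimately have "eps_homotopic X \<sigma> ((A @@ T) @@ ((rev A @@ A) @@ F4 @@ B)) ((A @@ T) @@ (F4 @@ B))"
    by (intro eps_homotopic_concat_right)
  moreover have "(A @@ T) @@ ((rev A @@ A) @@ F4 @@ B) = (A @@ T @@ rev A) @@ (A @@ F4 @@ B)"
    using ne by (simp add: T_def chain_concat_assoc)
  moreover have "(A @@ T) @@ (F4 @@ B) = (A @@ F1 @@ F2) @@ ((F3 @@ F4) @@ B)"
    using ne by (simp add: T_def chain_concat_assoc)
  moreover have "eps_homotopic X \<sigma> ((A @@ F1 @@ F2) @@ ((F3 @@ F4) @@ B)) ((A @@ F1 @@ F2) @@ B)"
  proof (rule eps_homotopic_concat_right)
    show "eps_homotopic X \<sigma> ((F3 @@ F4) @@ B) B"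
      by (rule homotopic_concat_null_left[OF f34 B])
    have AF: "joins X \<sigma> p b (A @@ F1 @@ F2)" using A F by (blast intro: joins_concat)
    then show "eps_chain X \<sigma> (A @@ F1 @@ F2)" by (rule joinsD)
    have "joins X \<sigma> b p ((F3 @@ F4) @@ B)" using B F by (blast intro: joins_concat)
    then show "last (A @@ F1 @@ F2) = hd ((F3 @@ F4) @@ B)" using AF by (simp add: joinsD)
  qed
  moreover have "(A @@ F1 @@ F2) @@ B = A @@ F1 @@ F2 @@ B"
    using ne by (simp add: chain_concat_assoc)
  ultimately have hom: "eps_homotopic X \<sigma> ((A @@ T @@ rev A) @@ (A @@ F4 @@ B)) (A @@ F1 @@ F2 @@ B)"
    using eps_homotopic_trans by metis
  have "cl \<sigma> (A @@ F1 @@ F2 @@ B) = cl \<sigma> (A @@ T @@ rev A) \<otimes>\<^bsub>\<pi> \<sigma>\<^esub> cl \<sigma> (A @@ F4 @@ B)"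
    using cl_mult[OF ATA AFB] cl_eqI[OF hom] by simp
  moreover have "cl \<sigma> (A @@ T @@ rev A) \<in> H"
    using tri[OF A] by (simp add: T_def F1_def F2_def F3_def)
  moreover have "cl \<sigma> (A @@ F4 @@ B) \<in> carrier (\<pi> \<sigma>)" by (rule cl_in_carrier[OF AFB])
  moreover have "g \<in> H \<longleftrightarrow> t \<otimes>\<^bsub>\<pi> \<sigma>\<^esub> g \<in> H" if "t \<in> H" "g \<in> carrier (\<pi> \<sigma>)" for t g
  proof
    have t: "t \<in> carrier (\<pi> \<sigma>)" by (rule subgroup.mem_carrier[OF H that(1)])
    assume "t \<otimes>\<^bsub>\<pi> \<sigma>\<^esub> g \<in> H"
    then have "inv\<^bsub>\<pi> \<sigma>\<^esub> t \<otimes>\<^bsub>\<pi> \<sigma>\<^esub> (t \<otimes>\<^bsub>\<pi> \<sigma>\<^esub> g) \<in> H"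
      by (rule subgroup.m_closed[OF H subgroup.m_inv_closed[OF H that(1)]])
    moreover have "inv\<^bsub>\<pi> \<sigma>\<^esub> t \<otimes>\<^bsub>\<pi> \<sigma>\<^esub> (t \<otimes>\<^bsub>\<pi> \<sigma>\<^esub> g) = g"
      using m_assoc[of "inv\<^bsub>\<pi> \<sigma>\<^esub> t" t g] t that by simp
    ultimately show "g \<in> H" by simp
  qed (use H that in \<open>auto intro: subgroup.m_closed\<close>)
  ultimately show ?thesis
    unfolding f1 f2 by simp
qed

lemma fills_invariant_step:
  assumes \<sigma>: "0 < \<sigma>" "2 * \<delta> \<le> 3 * \<sigma>" and H: "subgroup H (\<pi> \<sigma>)"
    and tri: "\<And>a x b k. a \<in> X \<Longrightarrow> x \<in> X \<Longrightarrow> b \<in> X \<Longrightarrow> dist a x < \<delta> \<Longrightarrow> dist x b < \<delta> \<Longrightarrow>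
      dist a b < \<delta> \<Longrightarrow> joins X \<sigma> p a k \<Longrightarrow>
      cl \<sigma> (k @@ (fill \<sigma> a x @@ fill \<sigma> x b @@ fill \<sigma> b a) @@ rev k) \<in> H"
    and \<alpha>: "joins X \<delta> p p \<alpha>" and \<beta>: "joins X \<delta> p p \<beta>" and "adds_point \<alpha> \<beta>"
  shows "cl \<sigma> (fills \<sigma> \<alpha>) \<in> H \<longleftrightarrow> cl \<sigma> (fills \<sigma> \<beta>) \<in> H"
proof -
  obtain us x vs where uv: "\<alpha> = us @ vs" "\<beta> = us @ x # vs"
    using \<open>adds_point \<alpha> \<beta>\<close> by (auto simp: adds_point_def)
  have X: "set us \<subseteq> X" "x \<in> X" "set vs \<subseteq> X" "us @ vs \<noteq> []"
    using joinsD(2)[OF \<alpha>] joinsD(5)[OF \<beta>] uv by auto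
  have p0: "eps_homotopic X \<sigma> (fill \<sigma> p p) [p]"
    using fill_same_null base_point \<sigma> by blast
  \<comment> \<open>Homotopies fix the endpoints, so a point added at an end repeats
    \<open>p\<close> and contributes only the null loop \<open>fill \<sigma> p p\<close>. A triangle
    appears only in the interior.\<close>
  consider "us = []" | "us \<noteq> []" "vs = []" | a us' b vs' where "us = us' @ [a]" "vs = b # vs'"
    by (metis append_butlast_last_id list.exhaust)
  then show ?thesis
  proof cases
    case 1
    then have "x = p" "hd vs = p" "vs \<noteq> []" using joinsD(3)[OF \<alpha>] joinsD(3)[OF \<beta>] X uv by auto
    then obtain vs' where vs: "vs = p # vs'" by (cases vs) auto
    have "fills \<sigma> \<beta> = fill \<sigma> p p @@ fills \<sigma> \<alpha>" using 1 vs uv \<open>x = p\<close> by simp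
    moreover have "joins X \<sigma> p p (fills \<sigma> \<alpha>)"
      using fills_between[of \<alpha> \<sigma>] joinsD[OF \<alpha>] \<sigma> by auto
    ultimately show ?thesis using cl_eqI[OF homotopic_concat_null_left[OF p0]] by simp
  next
    case 2
    then have "x = p" "last us = p" using joinsD(4)[OF \<alpha>] joinsD(4)[OF \<beta>] uv by auto
    then obtain us' where us: "us = us' @ [p]" using 2 by (metis append_butlast_last_id)
    have "joins X \<sigma> p p (fill \<sigma> p p)" using fill(1) base_point \<sigma> by blast
    then have "fills \<sigma> \<beta> = fills \<sigma> \<alpha> @@ fill \<sigma> p p"
      using fills_append[of us' p "[p]" \<sigma>] uv 2 us X \<sigma> \<open>x = p\<close>
      by (simp add: joinsD)
    moreover have "joins X \<sigma> p p (fills \<sigma> \<alpha>)"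
      using fills_between[of \<alpha> \<sigma>] joinsD[OF \<alpha>] \<sigma> by auto
    ultimately show ?thesis using cl_eqI[OF homotopic_concat_null_right[OF p0]] by simp
  next
    case 3
    have "dist a b < \<delta>"
      using joinsD(1)[OF \<alpha>] 3 uv by (auto simp: eps_chain_def successively_append_iff)
    moreover have "dist a x < \<delta>" "dist x b < \<delta>"
      using joinsD(1)[OF \<beta>] 3 uv by (auto simp: eps_chain_def successively_append_iff)
    ultimately show ?thesis
      using fills_add_point[OF \<sigma> H tri, of a x b us' vs'] \<beta> 3 uv X by simp
  qed
qed

text \<open>\<open>H\<close> is not assumed normal; instead \<open>tri\<close> asks for the
  conjugates of each triangle along all chains \<open>k\<close> from \<open>p\<close>. The lemma is
  applied with \<open>H = lollipops \<sigma>\<close>.\<close>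

lemma fills_invariant:
  assumes \<sigma>: "0 < \<sigma>" "2 * \<delta> \<le> 3 * \<sigma>" and H: "subgroup H (\<pi> \<sigma>)"
    and tri: "\<And>a x b k. a \<in> X \<Longrightarrow> x \<in> X \<Longrightarrow> b \<in> X \<Longrightarrow> dist a x < \<delta> \<Longrightarrow> dist x b < \<delta> \<Longrightarrow>
      dist a b < \<delta> \<Longrightarrow> joins X \<sigma> p a k \<Longrightarrow>
      cl \<sigma> (k @@ (fill \<sigma> a x @@ fill \<sigma> x b @@ fill \<sigma> b a) @@ rev k) \<in> H"
    and \<alpha>: "joins X \<delta> p p \<alpha>" and hom: "eps_homotopic X \<delta> \<alpha> \<beta>"
  shows "cl \<sigma> (fills \<sigma> \<alpha>) \<in> H \<longleftrightarrow> cl \<sigma> (fills \<sigma> \<beta>) \<in> H"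
proof -
  have "(eps_step X \<delta>)\<^sup>*\<^sup>* \<alpha> \<beta>" using hom by (simp add: eps_homotopic_def)
  then have "joins X \<delta> p p \<beta> \<and> (cl \<sigma> (fills \<sigma> \<alpha>) \<in> H \<longleftrightarrow> cl \<sigma> (fills \<sigma> \<beta>) \<in> H)"
  proof (induction rule: rtranclp_induct)
    case (step \<beta> \<gamma>)
    have \<gamma>: "joins X \<delta> p p \<gamma>"
      using step by (auto simp: eps_step_def joins_def)
    have "cl \<sigma> (fills \<sigma> \<beta>) \<in> H \<longleftrightarrow> cl \<sigma> (fills \<sigma> \<gamma>) \<in> H"
    proof (cases "adds_point \<beta> \<gamma>")
      case True
      then show ?thesis using fills_invariant_step[OF \<sigma> H tri, of \<beta> \<gamma>] step.IH \<gamma> by blast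
    next
      case False
      then have "adds_point \<gamma> \<beta>" using step.hyps(2) by (auto simp: eps_step_def)
      then show ?thesis using fills_invariant_step[OF \<sigma> H tri, of \<gamma> \<beta>] step.IH \<gamma> by blast
    qed
    then show ?case using step.IH \<gamma> by blast
  qed (use \<alpha> in simp)
  then show ?thesis by blast
qed

section \<open>Essential curves and the generating loops\<close>

text \<open>Times of the corners and midpoints of a circle of length \<open>3 * \<delta>\<close>.
  The corners alone would not be a \<open>\<delta>\<close>-chain, as their distances equal
  \<open>\<delta>\<close>.\<close>

definition sixths :: "real \<Rightarrow> real list" where
  "sixths \<delta> = [0, \<delta> / 2, \<delta>, 3 * \<delta> / 2, 2 * \<delta>, 5 * \<delta> / 2, 3 * \<delta>]"

text \<open>Essentiality is tested on the single chain at \<open>sixths \<delta>\<close>, but the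
  whole curve is kept, so that it can be subdivided at smaller scales.\<close>

definition essential_curve :: "real \<Rightarrow> (real \<Rightarrow> 'a) \<Rightarrow> bool" where
  "essential_curve \<delta> c \<longleftrightarrow> 0 < \<delta> \<and> lip_curve X c 0 (3 * \<delta>) \<and> c (3 * \<delta>) = c 0 \<and>
     dist (c 0) (c \<delta>) = \<delta> \<and> dist (c \<delta>) (c (2 * \<delta>)) = \<delta> \<and> dist (c (2 * \<delta>)) (c 0) = \<delta> \<and>
     \<not> eps_null X \<delta> (map c (sixths \<delta>))"

text \<open>The same \<open>\<epsilon>\<close>-chain \<open>k\<close> is used on the way out and on the way back; a general
  \<open>\<epsilon>\<close>-refinement of a \<open>\<delta>\<close>-lollichain could use inequivalent ones.\<close>

definition generating_loop :: "real \<Rightarrow> 'a list \<Rightarrow> bool" where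
  "generating_loop \<epsilon> \<nu> \<longleftrightarrow> (\<exists>\<delta> c ts k. \<epsilon> \<le> \<delta> \<and> essential_curve \<delta> c \<and> subdivision \<epsilon> 0 (3 * \<delta>) ts \<and>
     sorted_wrt (<) ts \<and> set (sixths \<delta>) \<subseteq> set ts \<and> joins X \<epsilon> p (c 0) k \<and>
     \<nu> = k @@ map c ts @@ rev k)"

definition lollipops :: "real \<Rightarrow> 'a list set set" where
  "lollipops \<sigma> = generate (\<pi> \<sigma>) (cl \<sigma> ` {\<nu>. generating_loop \<sigma> \<nu>})"

lemma subdivision_sixths: "0 < \<delta> \<Longrightarrow> subdivision \<delta> 0 (3 * \<delta>) (sixths \<delta>)"
  by (simp add: subdivision_def sixths_def)

lemma generating_loop_between:
  assumes "generating_loop \<epsilon> \<nu>"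
  shows "joins X \<epsilon> p p \<nu>"
proof -
  obtain \<delta> c ts k where \<nu>: "essential_curve \<delta> c" "subdivision \<epsilon> 0 (3 * \<delta>) ts"
    "joins X \<epsilon> p (c 0) k" "\<nu> = k @@ map c ts @@ rev k"
    using assms by (auto simp: generating_loop_def)
  have "lip_curve X c 0 (3 * \<delta>)" "c (3 * \<delta>) = c 0" using \<nu>(1) by (auto simp: essential_curve_def)
  then have "joins X \<epsilon> (c 0) (c 0) (map c ts)"
    using joins_map[OF lip_curve_modulus \<nu>(2)] by fastforce
  then show ?thesis
    unfolding \<nu>(4) using \<nu>(3) by (blast intro: joins_concat joins_rev)
qed

lemma generating_loops_carrier: "cl \<sigma> ` {\<nu>. generating_loop \<sigma> \<nu>} \<subseteq> carrier (\<pi> \<sigma>)"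
  using generating_loop_between cl_in_carrier by blast

lemma lollipops_subgroup:
  assumes "0 < \<sigma>"
  shows "subgroup (lollipops \<sigma>) (\<pi> \<sigma>)"
  unfolding lollipops_def
  by (rule group.generate_is_subgroup[OF group_pi[OF assms] generating_loops_carrier])

text \<open>The circle and its size stay the same; only the subdivision and the stick are refined.
  So the sizes occurring at scale \<open>\<sigma>\<close> include all those from larger
  scales.\<close>

lemma generating_loop_lift:
  assumes "generating_loop \<delta> \<nu>" "0 < \<sigma>" "\<sigma> \<le> \<delta>"
  obtains \<nu>' where "generating_loop \<sigma> \<nu>'" "eps_homotopic X \<delta> \<nu> \<nu>'"
proof -
  obtain d c ts k where d: "\<delta> \<le> d" "essential_curve d c" "subdivision \<delta> 0 (3 * d) ts"
    "joins X \<delta> p (c 0) k" "\<nu> = k @@ map c ts @@ rev k"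
    using assms by (auto simp: generating_loop_def)
  have "0 < d" "0 < \<delta>" using assms d(1) by auto
  have c: "lip_curve X c 0 (3 * d)" "c (3 * d) = c 0" using d(2) by (auto simp: essential_curve_def)
  obtain k' where k': "joins X \<sigma> p (c 0) k'" "eps_homotopic X \<delta> k k'"
    using chain_refine[OF d(4) assms(2,3)] by blast
  have "set (sixths d) \<subseteq> {0..3 * d}" using \<open>0 < d\<close> by (simp add: sixths_def)
  then obtain us where us: "subdivision \<sigma> 0 (3 * d) us" "set (sixths d) \<subseteq> set us" "sorted_wrt (<) us"
    using subdivision_containing[OF assms(2), of 0 "3 * d" "sixths d"] \<open>0 < d\<close> by auto
  have "generating_loop \<sigma> (k' @@ map c us @@ rev k')"
    unfolding generating_loop_def
    by (intro exI[of _ d] exI[of _ c] exI[of _ us] exI[of _ k']) (use us k' d assms in simp)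
  moreover have "eps_homotopic X \<delta> \<nu> (k' @@ map c us @@ rev k')"
    unfolding d(5)
  proof (intro eps_homotopic_concat k'(2) eps_homotopic_rev_cong[OF k'(2) \<open>0 < \<delta>\<close>])
    show "eps_homotopic X \<delta> (map c ts) (map c us)"
      by (rule map_homotopic_subdivisions[OF lip_curve_modulus[OF c(1)] d(3) subdivision_mono[OF us(1) assms(3)]])
    have "joins X \<delta> (c 0) (c 0) (map c ts)"
      using joins_map[OF lip_curve_modulus[OF c(1)] d(3)] c(2) by simp
    note m = this joins_concat[OF this joins_rev[OF d(4)]]
    show "last (map c ts) = hd (rev k)"
      using joinsD(4)[OF m(1)] joinsD(3)[OF joins_rev[OF d(4)]] by simp
    show "last k = hd (map c ts @@ rev k)"
      using joinsD(4)[OF d(4)] joinsD(3)[OF m(2)] by simp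
  qed
  ultimately show thesis by (rule that)
qed

text \<open>Reading \<open>\<sigma>\<close>-loops as \<open>\<delta>\<close>-loops is a
  homomorphism, and the generators at \<open>\<delta>\<close> lift by
  \<open>generating_loop_lift\<close>. Their products and inverses lift to concatenations and
  reversals.\<close>

lemma lollipops_lift:
  assumes "A \<in> lollipops \<delta>" "0 < \<sigma>" "\<sigma> \<le> \<delta>"
  shows "\<exists>\<beta>. joins X \<sigma> p p \<beta> \<and> cl \<delta> \<beta> = A \<and> cl \<sigma> \<beta> \<in> lollipops \<sigma>"
proof -
  have \<delta>: "0 < \<delta>" using assms by simp
  note H = lollipops_subgroup[OF assms(2)]
  show ?thesis
    using assms(1) unfolding lollipops_def[of \<delta>]
  proof (induction rule: generate.induct)
    case one
    have "cl \<sigma> [p] \<in> lollipops \<sigma>"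
      using subgroup.one_closed[OF H] by (simp add: cl_one)
    then show ?case using joins_single[OF base_point] cl_one by metis
  next
    case (incl h)
    then obtain \<nu> where \<nu>: "generating_loop \<delta> \<nu>" "h = cl \<delta> \<nu>" by blast
    obtain \<nu>' where \<nu>': "generating_loop \<sigma> \<nu>'" "eps_homotopic X \<delta> \<nu> \<nu>'"
      using generating_loop_lift[OF \<nu>(1) assms(2,3)] by blast
    have "cl \<sigma> \<nu>' \<in> lollipops \<sigma>"
      using \<nu>'(1) unfolding lollipops_def by (intro generate.incl) auto
    then show ?case using generating_loop_between[OF \<nu>'(1)] cl_eqI[OF \<nu>'(2)] \<nu>(2) by metis
  next
    case (inv h)
    then obtain \<nu> where \<nu>: "generating_loop \<delta> \<nu>" "h = cl \<delta> \<nu>" by blast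
    obtain \<nu>' where \<nu>': "generating_loop \<sigma> \<nu>'" "eps_homotopic X \<delta> \<nu> \<nu>'"
      using generating_loop_lift[OF \<nu>(1) assms(2,3)] by blast
    note b = generating_loop_between[OF \<nu>'(1)]
    have "inv\<^bsub>\<pi> \<sigma>\<^esub> (cl \<sigma> \<nu>') \<in> lollipops \<sigma>"
      using \<nu>'(1) unfolding lollipops_def by (intro generate.inv) auto
    then have "cl \<sigma> (rev \<nu>') \<in> lollipops \<sigma>"
      using cl_inv[OF b assms(2)] by simp
    moreover have "cl \<delta> (rev \<nu>') = inv\<^bsub>\<pi> \<delta>\<^esub> h"
      using cl_inv[OF joins_mono[OF b assms(3)] \<delta>] cl_eqI[OF \<nu>'(2)] \<nu>(2) by simp
    ultimately show ?case using joins_rev[OF b] by blast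
  next
    case (eng h1 h2)
    then obtain \<beta>1 \<beta>2 where \<beta>: "joins X \<sigma> p p \<beta>1" "cl \<delta> \<beta>1 = h1" "cl \<sigma> \<beta>1 \<in> lollipops \<sigma>"
      "joins X \<sigma> p p \<beta>2" "cl \<delta> \<beta>2 = h2" "cl \<sigma> \<beta>2 \<in> lollipops \<sigma>"
      by blast
    have "cl \<delta> (\<beta>1 @@ \<beta>2) = h1 \<otimes>\<^bsub>\<pi> \<delta>\<^esub> h2"
      using cl_mult[of \<delta> \<beta>1 \<beta>2] joins_mono[OF \<beta>(1) assms(3)] joins_mono[OF \<beta>(4) assms(3)] \<beta>
      by simp
    moreover have "cl \<sigma> (\<beta>1 @@ \<beta>2) \<in> lollipops \<sigma>"
      using subgroup.m_closed[OF H \<beta>(3,6)] cl_mult[OF \<beta>(1,4)] by simp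
    ultimately show ?case using joins_concat[OF \<beta>(1,4)] by blast
  qed
qed

lemma lollipops_step:
  assumes \<sigma>: "0 < \<sigma>" "\<sigma> \<le> \<delta>" "2 * \<delta> \<le> 3 * \<sigma>"
    and tri: "\<And>a x b k. a \<in> X \<Longrightarrow> x \<in> X \<Longrightarrow> b \<in> X \<Longrightarrow> dist a x < \<delta> \<Longrightarrow> dist x b < \<delta> \<Longrightarrow>
      dist a b < \<delta> \<Longrightarrow> joins X \<sigma> p a k \<Longrightarrow>
      cl \<sigma> (k @@ (fill \<sigma> a x @@ fill \<sigma> x b @@ fill \<sigma> b a) @@ rev k) \<in> lollipops \<sigma>"
    and \<delta>: "carrier (\<pi> \<delta>) \<subseteq> lollipops \<delta>"
  shows "carrier (\<pi> \<sigma>) \<subseteq> lollipops \<sigma>"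
proof
  fix A assume "A \<in> carrier (\<pi> \<sigma>)"
  then obtain \<alpha> where \<alpha>: "joins X \<sigma> p p \<alpha>" "A = cl \<sigma> \<alpha>" by (auto simp: carrier_pi)
  note \<alpha>' = joins_mono[OF \<alpha>(1) \<sigma>(2)]
  have "cl \<delta> \<alpha> \<in> lollipops \<delta>" using \<delta> cl_in_carrier[OF \<alpha>'] by blast
  from lollipops_lift[OF this \<sigma>(1,2)] obtain \<beta> where \<beta>: "joins X \<sigma> p p \<beta>"
    "cl \<delta> \<beta> = cl \<delta> \<alpha>" "cl \<sigma> \<beta> \<in> lollipops \<sigma>" by blast
  \<comment> \<open>The \<open>\<sigma>\<close>-chains \<open>\<alpha>\<close> and
    \<open>\<beta>\<close> are known to agree only at scale \<open>\<delta>\<close>. Filling carries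
    the membership of \<open>\<beta>\<close> over to \<open>\<alpha>\<close>, since by
    \<open>fills_homotopic\<close> filling a \<open>\<sigma>\<close>-chain does not change its
    \<open>\<sigma>\<close>-class.\<close>
  have "eps_homotopic X \<delta> \<alpha> \<beta>" using cl_eqD[OF \<alpha>'] \<beta>(2) by simp
  from fills_invariant[OF \<sigma>(1,3) lollipops_subgroup[OF \<sigma>(1)] tri \<alpha>' this]
  show "A \<in> lollipops \<sigma>"
    using cl_eqI[OF fills_homotopic[OF joinsD(1)[OF \<alpha>(1)] \<sigma>(1)]]
      cl_eqI[OF fills_homotopic[OF joinsD(1)[OF \<beta>(1)] \<sigma>(1)]] \<alpha>(2) \<beta>(3) by simp
qed

end

section \<open>Triangles at nearby scales\<close>

lemma cancel_rev:
  assumes \<alpha>: "joins X \<sigma> a b \<alpha>" and k: "joins X \<sigma> c b k" and \<beta>: "joins X \<sigma> b d \<beta>"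
    and "0 < \<sigma>"
  shows "eps_homotopic X \<sigma> ((\<alpha> @@ rev k) @@ (k @@ \<beta>)) (\<alpha> @@ \<beta>)"
proof -
  have kk: "joins X \<sigma> b b (rev k @@ k)"
    using k by (blast intro: joins_concat joins_rev)
  have "eps_homotopic X \<sigma> (\<alpha> @@ ((rev k @@ k) @@ \<beta>)) (\<alpha> @@ \<beta>)"
  proof (rule eps_homotopic_concat_right)
    show "eps_homotopic X \<sigma> ((rev k @@ k) @@ \<beta>) \<beta>"
      by (rule homotopic_concat_null_left[OF concat_rev_null(2)[OF k \<open>0 < \<sigma>\<close>] \<beta>])
    show "last \<alpha> = hd ((rev k @@ k) @@ \<beta>)"
      using joinsD(4)[OF \<alpha>] joinsD(3)[OF joins_concat[OF kk \<beta>]] by simp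
  qed (rule joinsD(1)[OF \<alpha>])
  moreover have "(\<alpha> @@ rev k) @@ (k @@ \<beta>) = \<alpha> @@ ((rev k @@ k) @@ \<beta>)"
    using joinsD(2)[OF k] by (simp add: chain_concat_assoc)
  ultimately show ?thesis by simp
qed

lemma eps_homotopic_concat_between:
  assumes "eps_homotopic X \<sigma> \<alpha> \<alpha>'" "eps_homotopic X \<sigma> \<beta> \<beta>'"
    and "joins X \<sigma> a b \<alpha>" "joins X \<sigma> b c \<beta>"
  shows "eps_homotopic X \<sigma> (\<alpha> @@ \<beta>) (\<alpha>' @@ \<beta>')"
  using assms by (intro eps_homotopic_concat) (auto simp: joinsD)

text \<open>The centres have to lie in \<open>Q\<close> itself, which is not assumed closed: balls
  around points of \<open>Q\<close> already cover its closure, and the closure is compact.\<close>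

lemma compact_finite_net:
  fixes K :: "'a::metric_space set"
  assumes "compact K" "Q \<subseteq> K" "0 < e"
  obtains N where "finite N" "N \<subseteq> Q" "\<And>q. q \<in> Q \<Longrightarrow> \<exists>n\<in>N. dist n q < e"
proof -
  have "compact (closure Q)"
    using compact_Int_closed[OF assms(1) closed_closure[of Q]]
      closure_minimal[OF assms(2) compact_imp_closed[OF assms(1)]] by (simp add: inf.absorb2)
  moreover have "closure Q \<subseteq> (\<Union>q\<in>Q. ball q e)"
    using assms(3) by (auto simp: closure_approachable)
  ultimately obtain N where "N \<subseteq> Q" "finite N" "closure Q \<subseteq> (\<Union>q\<in>N. ball q e)"
    using compactE_image[of "closure Q" Q "\<lambda>q. ball q e"] by auto
  then show thesis using that[of N] closure_subset by fastforce
qed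

definition perimeter :: "'a::metric_space \<times> 'a \<times> 'a \<Rightarrow> real" where
  "perimeter T = (case T of (a, x, b) \<Rightarrow> dist a x + dist x b + dist b a)"

lemma dist_triple_less:
  assumes "dist (a, x, b) (a', x', b') < e"
  shows "dist a a' < e" "dist x x' < e" "dist b b' < e"
  using assms dist_fst_le[of "(a, x, b)" "(a', x', b')"] dist_snd_le[of "(a, x, b)" "(a', x', b')"]
    dist_fst_le[of "(x, b)" "(x', b')"] dist_snd_le[of "(x, b)" "(x', b')"] by auto

text \<open>Let \<open>K\<close> consist of the triples of perimeter at least
  \<open>3 * \<delta>\<close> that are at distance at least \<open>e\<close> from every triad. Sides
  of length at most \<open>\<delta>\<close> with sum at least \<open>3 * \<delta>\<close> would all
  equal \<open>\<delta>\<close>, so on the compact set \<open>K\<close> the longest side exceeds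
  \<open>\<delta>\<close>. Its minimum is the desired \<open>\<delta>'\<close>.\<close>

lemma triangles_near_triads:
  fixes X :: "'a::metric_space set"
  assumes "compact X" "0 < \<delta>" "0 < e"
  obtains \<delta>' where "\<delta> < \<delta>'" "\<And>a x b. a \<in> X \<Longrightarrow> x \<in> X \<Longrightarrow> b \<in> X \<Longrightarrow> dist a x < \<delta>' \<Longrightarrow> dist x b < \<delta>' \<Longrightarrow>
      dist b a < \<delta>' \<Longrightarrow> 3 * \<delta> \<le> perimeter (a, x, b) \<Longrightarrow>
      \<exists>a' x' b'. triad X \<delta> a' x' b' \<and> dist a a' < e \<and> dist x x' < e \<and> dist b b' < e"
proof -
  define U where "U = (\<Union>T\<in>{(a, x, b). triad X \<delta> a x b}. ball T e)"
  define f :: "'a \<times> 'a \<times> 'a \<Rightarrow> real" where "f = (\<lambda>T. max (dist (fst T) (fst (snd T)))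
    (max (dist (fst (snd T)) (snd (snd T))) (dist (snd (snd T)) (fst T))))"
  define K where "K = (X \<times> X \<times> X) \<inter> ({T. 3 * \<delta> \<le> perimeter T} \<inter> - U)"
  have "closed {T :: 'a \<times> 'a \<times> 'a. 3 * \<delta> \<le> perimeter T}"
    unfolding perimeter_def case_prod_beta
    by (intro closed_Collect_le continuous_intros)
  moreover have "open U" by (auto simp: U_def)
  ultimately have K: "compact K"
    unfolding K_def using assms(1)
    by (intro compact_Int_closed compact_Times closed_Int) (auto simp: closed_Compl)
  have f: "continuous_on K f" unfolding f_def by (intro continuous_intros)
  have gt: "\<delta> < f T" if "T \<in> K" for T
  proof (rule ccontr)
    obtain a x b where T: "T = (a, x, b)" by (cases T) auto
    assume "\<not> \<delta> < f T"
    then have "dist a x \<le> \<delta>" "dist x b \<le> \<delta>" "dist b a \<le> \<delta>" by (auto simp: f_def T)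
    moreover have "3 * \<delta> \<le> dist a x + dist x b + dist b a" "a \<in> X" "x \<in> X" "b \<in> X"
      using that by (auto simp: K_def T perimeter_def)
    ultimately have "triad X \<delta> a x b" by (auto simp: triad_def)
    then have "T \<in> U" using assms(3) unfolding U_def T by (intro UN_I[of "(a, x, b)"]) auto
    then show False using that by (auto simp: K_def)
  qed
  obtain \<delta>' where \<delta>': "\<delta> < \<delta>'" "\<And>T. T \<in> K \<Longrightarrow> \<delta>' \<le> f T"
  proof (cases "K = {}")
    case True
    then show thesis using that[of "\<delta> + 1"] by auto
  next
    case False
    then obtain T where "T \<in> K" "\<And>S. S \<in> K \<Longrightarrow> f T \<le> f S"
      using continuous_attains_inf[OF K False f] by blast
    then show thesis using that[of "f T"] gt by blast
  qed
  show thesis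
  proof (rule that[OF \<delta>'(1)])
    fix a x b assume T: "a \<in> X" "x \<in> X" "b \<in> X" "dist a x < \<delta>'" "dist x b < \<delta>'" "dist b a < \<delta>'"
      "3 * \<delta> \<le> perimeter (a, x, b)"
    then have "f (a, x, b) < \<delta>'" by (auto simp: f_def)
    then have "(a, x, b) \<in> U" using \<delta>'(2)[of "(a, x, b)"] T by (auto simp: K_def)
    then obtain a' x' b' where "triad X \<delta> a' x' b'" "dist (a', x', b') (a, x, b) < e"
      by (auto simp: U_def)
    with dist_triple_less[OF this(2)]
    show "\<exists>a' x' b'. triad X \<delta> a' x' b' \<and> dist a a' < e \<and> dist x x' < e \<and> dist b b' < e"
      by (auto simp: dist_commute)
  qed
qed

section \<open>Perturbing filled triangles\<close>

context geodesic_set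
begin

text \<open>A prism over two triangles: each lateral quadrilateral is a loop of length at most
  \<open>l + m + 2 * e\<close> and hence null. The connecting chains \<open>k2\<close> and
  \<open>k3\<close> cancel between neighbouring sides, and \<open>k1\<close> remains as conjugating
  chain.\<close>

lemma close_triangles_homotopic:
  assumes "0 < \<sigma>"
    and t: "joins X \<sigma> a x t1" "joins X \<sigma> x b t2" "joins X \<sigma> b a t3"
    and s: "joins X \<sigma> a' x' s1" "joins X \<sigma> x' b' s2" "joins X \<sigma> b' a' s3"
    and k: "joins X \<sigma> a a' k1" "joins X \<sigma> x x' k2" "joins X \<sigma> b b' k3"
    and len: "len t1 \<le> l" "len t2 \<le> l" "len t3 \<le> l"
      "len s1 \<le> m" "len s2 \<le> m" "len s3 \<le> m"
      "len k1 \<le> e" "len k2 \<le> e" "len k3 \<le> e" "l + m + 2 * e < 3 * \<sigma>"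
  shows "eps_homotopic X \<sigma> (t1 @@ t2 @@ t3) (k1 @@ (s1 @@ s2 @@ s3) @@ rev k1)"
proof -
  have side: "eps_homotopic X \<sigma> t (k @@ s @@ rev k')"
    if "joins X \<sigma> u v t" "joins X \<sigma> u' v' s" "joins X \<sigma> u u' k" "joins X \<sigma> v v' k'"
      "len t \<le> l" "len s \<le> m" "len k \<le> e" "len k' \<le> e"
    for u v u' v' t s k k'
  proof (rule homotopic_if_short[OF that(1)])
    note sk = joins_concat[OF that(2) joins_rev[OF that(4)]]
    show "joins X \<sigma> u v (k @@ s @@ rev k')" by (rule joins_concat[OF that(3) sk])
    have "len (k @@ s @@ rev k') = len k + (len s + len (rev k'))"
      using joinsD[OF that(2)] joinsD[OF that(3)] joinsD[OF sk]
        joinsD[OF joins_rev[OF that(4)]]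
      by (subst len_concat, simp_all) (subst len_concat, simp_all)
    then show "len t + len (k @@ s @@ rev k') < 3 * \<sigma>"
      using that len(10) by (simp add: len_rev)
  qed (rule assms)
  note cb = joins_concat joins_rev
  have ks: "joins X \<sigma> a x' (k1 @@ s1)" "joins X \<sigma> x b' (k2 @@ s2)" "joins X \<sigma> b a' (k3 @@ s3)"
    using s k by (blast intro: cb)+
  have ne: "k1 \<noteq> []" "k2 \<noteq> []" "k3 \<noteq> []" "s1 \<noteq> []" "s2 \<noteq> []" "s3 \<noteq> []"
    using s k by (auto dest: joinsD(2))
  have 1: "eps_homotopic X \<sigma> t1 ((k1 @@ s1) @@ rev k2)" "eps_homotopic X \<sigma> t2 ((k2 @@ s2) @@ rev k3)"
    "eps_homotopic X \<sigma> t3 ((k3 @@ s3) @@ rev k1)"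
    using side[OF t(1) s(1) k(1,2)] side[OF t(2) s(2) k(2,3)] side[OF t(3) s(3) k(3,1)] len ne
    by (auto simp: chain_concat_assoc)
  have "eps_homotopic X \<sigma> (t2 @@ t3) (((k2 @@ s2) @@ rev k3) @@ ((k3 @@ s3) @@ rev k1))"
    by (rule eps_homotopic_concat_between[OF 1(2,3) t(2,3)])
  moreover have "eps_homotopic X \<sigma> (((k2 @@ s2) @@ rev k3) @@ (k3 @@ (s3 @@ rev k1))) ((k2 @@ s2) @@ (s3 @@ rev k1))"
    by (rule cancel_rev[OF ks(2) k(3) _ assms(1)]) (use s k in \<open>blast intro: cb\<close>)
  ultimately have 2: "eps_homotopic X \<sigma> (t2 @@ t3) (k2 @@ (s2 @@ s3 @@ rev k1))"
    using ne by (simp add: chain_concat_assoc) (blast intro: eps_homotopic_trans)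
  have "eps_homotopic X \<sigma> (t1 @@ t2 @@ t3) (((k1 @@ s1) @@ rev k2) @@ (k2 @@ (s2 @@ s3 @@ rev k1)))"
    by (rule eps_homotopic_concat_between[OF 1(1) 2 t(1) joins_concat[OF t(2,3)]])
  moreover have "eps_homotopic X \<sigma> (((k1 @@ s1) @@ rev k2) @@ (k2 @@ (s2 @@ s3 @@ rev k1)))
      ((k1 @@ s1) @@ (s2 @@ s3 @@ rev k1))"
    by (rule cancel_rev[OF ks(1) k(2) _ assms(1)]) (use s k in \<open>blast intro: cb\<close>)
  ultimately have "eps_homotopic X \<sigma> (t1 @@ t2 @@ t3) ((k1 @@ s1) @@ (s2 @@ s3 @@ rev k1))"
    by (rule eps_homotopic_trans)
  then show ?thesis using ne by (simp add: chain_concat_assoc)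
qed

lemma conjugate_null:
  assumes "eps_homotopic X \<sigma> \<alpha> [b]" "joins X \<sigma> a b k" "0 < \<sigma>"
  shows "eps_homotopic X \<sigma> (k @@ \<alpha> @@ rev k) [a]"
proof -
  note r = joins_rev[OF assms(2)]
  have "joins X \<sigma> b b \<alpha>"
    using eps_homotopic_ends[OF assms(1)] by (auto simp: joins_def)
  then have "eps_homotopic X \<sigma> (k @@ \<alpha> @@ rev k) (k @@ rev k)"
    using eps_homotopic_concat_right[OF homotopic_concat_null_left[OF assms(1) r], of k]
      joinsD[OF assms(2)] joinsD(3)[OF joins_concat[OF _ r]] by simp
  then show ?thesis using concat_rev_null(1)[OF assms(2,3)] eps_homotopic_trans by blast
qed

lemma triangle_fill_null:
  assumes "a \<in> X" "x \<in> X" "b \<in> X" "0 < \<sigma>" "perimeter (a, x, b) < 3 * \<sigma>"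
  shows "eps_homotopic X \<sigma> (fill \<sigma> a x @@ fill \<sigma> x b @@ fill \<sigma> b a) [a]"
proof (rule short_loop_null)
  note F = fill[OF assms(1,2,4)] fill[OF assms(2,3,4)] fill[OF assms(3,1,4)]
  note F' = joins_concat[OF F(3,5)]
  show "joins X \<sigma> a a (fill \<sigma> a x @@ fill \<sigma> x b @@ fill \<sigma> b a)"
    by (rule joins_concat[OF F(1) F'])
  have "len (fill \<sigma> a x @@ fill \<sigma> x b @@ fill \<sigma> b a) =
      len (fill \<sigma> a x) + (len (fill \<sigma> x b) + len (fill \<sigma> b a))"
    using F F' by (simp add: len_concat joinsD)
  then show "len (fill \<sigma> a x @@ fill \<sigma> x b @@ fill \<sigma> b a) < 3 * \<sigma>"
    using F assms(5) by (simp add: perimeter_def)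
qed (rule assms)

text \<open>Perimeters in \<open>Q\<close> are below \<open>3 * \<delta>\<close> but may come
  arbitrarily close to it, so short loops alone do not suffice for any
  \<open>\<sigma> < \<delta>\<close>. Only the finitely many triangles of the net have to be short;
  every other one is \<open>\<sigma>\<close>-homotopic to a conjugate of a nearby triangle of the
  net.\<close>

lemma triangles_null_below:
  assumes "compact X" "0 < \<delta>"
  obtains \<delta>' where "2 / 3 * \<delta> \<le> \<delta>'" "\<delta>' < \<delta>" "\<And>\<sigma> a x b. \<delta>' < \<sigma> \<Longrightarrow> \<sigma> \<le> \<delta> \<Longrightarrow> a \<in> X \<Longrightarrow> x \<in> X \<Longrightarrow> b \<in> X \<Longrightarrow>
    dist a x < \<delta> \<Longrightarrow> dist x b < \<delta> \<Longrightarrow> dist b a < \<delta> \<Longrightarrow>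
    eps_homotopic X \<sigma> (fill \<sigma> a x @@ fill \<sigma> x b @@ fill \<sigma> b a) [a]"
proof -
  define e where "e = \<delta> / 40"
  have "0 < e" using assms by (simp add: e_def)
  define Q where "Q = {(a, x, b). a \<in> X \<and> x \<in> X \<and> b \<in> X \<and> dist a x < \<delta> \<and> dist x b < \<delta> \<and> dist b a < \<delta>}"
  have "Q \<subseteq> X \<times> X \<times> X" by (auto simp: Q_def)
  then obtain N where N: "finite N" "N \<subseteq> Q" "\<And>q. q \<in> Q \<Longrightarrow> \<exists>n\<in>N. dist n q < e"
    using compact_finite_net[OF compact_Times[OF assms(1) compact_Times[OF assms(1) assms(1)]] _ \<open>0 < e\<close>] by blast
  \<comment> \<open>\<open>N\<close> lies in \<open>Q\<close>, so the maximum is still below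
    \<open>\<delta>\<close>. The bound \<open>9 / 10 * \<delta>\<close> leaves room for the prism:
    \<open>\<delta> + \<delta> + 2 * e\<close> is \<open>2.05 * \<delta>\<close>, while
    \<open>3 * \<sigma>\<close> exceeds \<open>2.7 * \<delta>\<close>.\<close>
  define \<delta>' where "\<delta>' = Max (insert (9 / 10 * \<delta>) ((\<lambda>T. perimeter T / 3) ` N))"
  have "\<delta>' < \<delta>"
    unfolding \<delta>'_def using N(1,2) assms(2) by (auto simp: Q_def perimeter_def)
  have le: "9 / 10 * \<delta> \<le> \<delta>'" "\<And>T. T \<in> N \<Longrightarrow> perimeter T / 3 \<le> \<delta>'"
    unfolding \<delta>'_def using N(1) by (intro Max_ge; simp)+
  show thesis
  proof (rule that[OF _ \<open>\<delta>' < \<delta>\<close>])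
    show "2 / 3 * \<delta> \<le> \<delta>'" using le(1) assms(2) by linarith
    fix \<sigma> a x b assume \<sigma>: "\<delta>' < \<sigma>" "\<sigma> \<le> \<delta>" and X: "a \<in> X" "x \<in> X" "b \<in> X"
      and d: "dist a x < \<delta>" "dist x b < \<delta>" "dist b a < \<delta>"
    have "(a, x, b) \<in> Q" using X d by (auto simp: Q_def)
    then obtain a' x' b' where T': "(a', x', b') \<in> N" "dist (a', x', b') (a, x, b) < e"
      using N(3) by (metis prod_cases3)
    note near = dist_triple_less[OF T'(2)]
    have X': "a' \<in> X" "x' \<in> X" "b' \<in> X" "dist a' x' < \<delta>" "dist x' b' < \<delta>" "dist b' a' < \<delta>"
      using T' N(2) by (auto simp: Q_def)
    have "0 < \<sigma>" using \<sigma> le assms by linarith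
    have null: "eps_homotopic X \<sigma> (fill \<sigma> a' x' @@ fill \<sigma> x' b' @@ fill \<sigma> b' a') [a']"
      using le(2)[OF T'(1)] \<sigma> by (intro triangle_fill_null X' \<open>0 < \<sigma>\<close>) auto
    note F = fill[OF _ _ \<open>0 < \<sigma>\<close>]
    have "eps_homotopic X \<sigma> (fill \<sigma> a x @@ fill \<sigma> x b @@ fill \<sigma> b a)
       (fill \<sigma> a a' @@ (fill \<sigma> a' x' @@ fill \<sigma> x' b' @@ fill \<sigma> b' a') @@ rev (fill \<sigma> a a'))"
    proof (rule close_triangles_homotopic[OF \<open>0 < \<sigma>\<close> F(1)[OF X(1,2)] F(1)[OF X(2,3)] F(1)[OF X(3,1)]
          F(1)[OF X'(1,2)] F(1)[OF X'(2,3)] F(1)[OF X'(3,1)]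
          F(1)[OF X(1) X'(1)] F(1)[OF X(2) X'(2)] F(1)[OF X(3) X'(3)], of \<delta> \<delta> e])
      show "\<delta> + \<delta> + 2 * e < 3 * \<sigma>" using \<sigma> le(1) assms(2) by (simp add: e_def)
    qed (use X X' d near in \<open>auto intro!: order_trans[OF F(2)] simp: dist_commute\<close>)
    then show "eps_homotopic X \<sigma> (fill \<sigma> a x @@ fill \<sigma> x b @@ fill \<sigma> b a) [a]"
      using conjugate_null[OF null F(1)[OF X(1) X'(1)] \<open>0 < \<sigma>\<close>] eps_homotopic_trans by blast
  qed
qed

end

section \<open>Continuation in the scale\<close>

context pointed_geodesic_set
begin

lemma null_conjugate_in_lollipops:
  assumes "eps_homotopic X \<sigma> \<alpha> [b]" "joins X \<sigma> p b k" "0 < \<sigma>"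
  shows "cl \<sigma> (k @@ \<alpha> @@ rev k) \<in> lollipops \<sigma>"
  using cl_eqI[OF conjugate_null[OF assms]] subgroup.one_closed[OF lollipops_subgroup[OF assms(3)]]
  by (simp add: cl_one)

lemma triad_curve:
  assumes "triad X \<delta> a x b"
  obtains c where "lip_curve X c 0 (3 * \<delta>)" "c 0 = a" "c \<delta> = x" "c (2 * \<delta>) = b" "c (3 * \<delta>) = a"
proof -
  have t: "a \<in> X" "x \<in> X" "b \<in> X" "dist a x = \<delta>" "dist x b = \<delta>" "dist b a = \<delta>"
    using assms by (auto simp: triad_def)
  have l: "len [a, x, b, a] = 3 * \<delta>" using t by simp
  obtain c ts where "arc_parameter X [a, x, b, a] c ts"
    using arc_parameter_exists[OF geodesic_space, of "[a, x, b, a]"] t by auto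
  then have c: "lip_curve X c 0 (3 * \<delta>)" "hd ts = 0" "map c ts = [a, x, b, a]"
    "unit_speed c ts"
    unfolding arc_parameter_def l by auto
  have "length ts = Suc (Suc (Suc (Suc 0)))" using arg_cong[OF c(3), of length] by simp
  then obtain t0 t1 t2 t3 where ts: "ts = [t0, t1, t2, t3]"
    by (auto simp: length_Suc_conv)
  have "t0 = 0" "c t0 = a" "c t1 = x" "c t2 = b" "c t3 = a" using c(2,3) ts by auto
  moreover have "t1 - t0 = \<delta>" "t2 - t1 = \<delta>" "t3 - t2 = \<delta>"
    using c(3,4) ts t by auto
  then have "t1 = t0 + \<delta>" "t2 = t0 + 2 * \<delta>" "t3 = t0 + 3 * \<delta>" by auto
  ultimately show thesis using that[OF c(1)] by simp
qed

text \<open>The filled triangle is a conjugate of the chain of corners and midpoints of the nearby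
  triad, the prism estimate being \<open>\<delta> + \<sigma> + 2 * e \<le> 2.15 * \<sigma>\<close>.
  If that chain is null, the class is trivial. Otherwise the curve around the triad is essential and
  yields a generating loop of size exactly \<open>\<sigma>\<close>, with \<open>k\<close> prolonged
  to the triad as stick.\<close>

lemma near_triad_in_lollipops:
  assumes "0 < \<sigma>" "\<delta> \<le> 11 / 10 * \<sigma>"
    and X: "a \<in> X" "x \<in> X" "b \<in> X" and d: "dist a x < \<delta>" "dist x b < \<delta>" "dist b a < \<delta>"
    and T: "triad X \<sigma> a' x' b'" and near: "dist a a' < \<sigma> / 40" "dist x x' < \<sigma> / 40" "dist b b' < \<sigma> / 40"
    and k: "joins X \<sigma> p a k"
  shows "cl \<sigma> (k @@ (fill \<sigma> a x @@ fill \<sigma> x b @@ fill \<sigma> b a) @@ rev k) \<in> lollipops \<sigma>"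
proof -
  note F = fill[OF _ _ \<open>0 < \<sigma>\<close>]
  have X': "a' \<in> X" "x' \<in> X" "b' \<in> X" using T by (auto simp: triad_def)
  obtain c where c: "lip_curve X c 0 (3 * \<sigma>)" "c 0 = a'" "c \<sigma> = x'" "c (2 * \<sigma>) = b'" "c (3 * \<sigma>) = a'"
    using triad_curve[OF T] by blast
  have part: "joins X \<sigma> (c s) (c (s + \<sigma>)) (map c [s, s + \<sigma> / 2, s + \<sigma>])"
    "len (map c [s, s + \<sigma> / 2, s + \<sigma>]) \<le> \<sigma>" if "0 \<le> s" "s + \<sigma> \<le> 3 * \<sigma>" for s
  proof -
    have l: "lip_curve X c s (s + \<sigma>)" by (rule lip_curve_subset[OF c(1)]) (use that in auto)
    have "subdivision \<sigma> s (s + \<sigma>) [s, s + \<sigma> / 2, s + \<sigma>]" using assms(1) by (simp add: subdivision_def)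
    from joins_map[OF lip_curve_modulus[OF l] this]
    show "joins X \<sigma> (c s) (c (s + \<sigma>)) (map c [s, s + \<sigma> / 2, s + \<sigma>])" .
    show "len (map c [s, s + \<sigma> / 2, s + \<sigma>]) \<le> \<sigma>"
      using len_lipschitz_le[OF l, of "[s, s + \<sigma> / 2, s + \<sigma>]"] assms(1) by simp
  qed
  define s1 s2 s3 where "s1 = map c [0, 0 + \<sigma> / 2, 0 + \<sigma>]" and "s2 = map c [\<sigma>, \<sigma> + \<sigma> / 2, \<sigma> + \<sigma>]"
    and "s3 = map c [2 * \<sigma>, 2 * \<sigma> + \<sigma> / 2, 2 * \<sigma> + \<sigma>]"
  have s: "joins X \<sigma> a' x' s1" "joins X \<sigma> x' b' s2" "joins X \<sigma> b' a' s3"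
    "len s1 \<le> \<sigma>" "len s2 \<le> \<sigma>" "len s3 \<le> \<sigma>"
    using part[of 0] part[of \<sigma>] part[of "2 * \<sigma>"] c(2-5) assms(1)
    unfolding s1_def s2_def s3_def by simp_all
  have sx: "s1 @@ s2 @@ s3 = map c (sixths \<sigma>)"
    by (simp add: s1_def s2_def s3_def sixths_def chain_concat_def add_divide_distrib[symmetric] algebra_simps)
  let ?T = "fill \<sigma> a x @@ fill \<sigma> x b @@ fill \<sigma> b a" and ?k = "fill \<sigma> a a'"
  note FT = F(1)[OF X(1,2)] F(1)[OF X(2,3)] F(1)[OF X(3,1)]
  have k1: "joins X \<sigma> a a' ?k" by (rule F(1)[OF X(1) X'(1)])
  define e where "e = \<sigma> / 40"
  have hom: "eps_homotopic X \<sigma> ?T (?k @@ map c (sixths \<sigma>) @@ rev ?k)"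
    unfolding sx[symmetric]
  proof (rule close_triangles_homotopic[OF \<open>0 < \<sigma>\<close> FT s(1-3)
        k1 F(1)[OF X(2) X'(2)] F(1)[OF X(3) X'(3)], of \<delta> \<sigma> e])
    show "\<delta> + \<sigma> + 2 * e < 3 * \<sigma>" using assms by (simp add: e_def)
  qed (use X X' d near[folded e_def] s in \<open>auto intro!: order_trans[OF F(2)]\<close>)
  have T: "joins X \<sigma> a a ?T" by (rule joins_concat[OF FT(1) joins_concat[OF FT(2,3)]])
  have m: "joins X \<sigma> a' a' (map c (sixths \<sigma>))"
    using joins_map[OF lip_curve_modulus[OF c(1)] subdivision_sixths[OF \<open>0 < \<sigma>\<close>]] c by simp
  show ?thesis
  proof (cases "eps_null X \<sigma> (map c (sixths \<sigma>))")
    case True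
    then obtain y where "eps_homotopic X \<sigma> (map c (sixths \<sigma>)) [y]" by (auto simp: eps_null_def)
    moreover from this have "y = a'" using eps_homotopic_ends joinsD(3)[OF m] by fastforce
    ultimately have "eps_homotopic X \<sigma> ?T [a]"
      using conjugate_null[OF _ k1 \<open>0 < \<sigma>\<close>] hom eps_homotopic_trans by blast
    then show ?thesis by (rule null_conjugate_in_lollipops[OF _ k \<open>0 < \<sigma>\<close>])
  next
    case False
    note kk = joins_concat[OF k k1]
    have "essential_curve \<sigma> c" using False c T assms(1) \<open>triad X \<sigma> a' x' b'\<close>
      by (auto simp: essential_curve_def triad_def)
    moreover have "sorted_wrt (<) (sixths \<sigma>)" using assms(1) by (simp add: sixths_def)
    ultimately have "generating_loop \<sigma> ((k @@ ?k) @@ map c (sixths \<sigma>) @@ rev (k @@ ?k))"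
      unfolding generating_loop_def using subdivision_sixths[OF assms(1)] kk c(2)
      by (intro exI[of _ \<sigma>] exI[of _ c] exI[of _ "sixths \<sigma>"] exI[of _ "k @@ ?k"]) simp
    then have "cl \<sigma> ((k @@ ?k) @@ map c (sixths \<sigma>) @@ rev (k @@ ?k)) \<in> lollipops \<sigma>"
      unfolding lollipops_def by (intro generate.incl) auto
    moreover have "(k @@ ?k) @@ map c (sixths \<sigma>) @@ rev (k @@ ?k) = k @@ (?k @@ map c (sixths \<sigma>) @@ rev ?k) @@ rev k"
      using joinsD(2,4)[OF k] joinsD(2,3)[OF k1] joinsD(2)[OF m]
      by (simp add: rev_chain_concat chain_concat_assoc)
    moreover have "eps_homotopic X \<sigma> (k @@ ?T @@ rev k) (k @@ (?k @@ map c (sixths \<sigma>) @@ rev ?k) @@ rev k)"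
      using joins_rev[OF k] k T joinsD(1)
      by (intro eps_homotopic_concat_between[of _ _ _ _ _ _ p a p] eps_homotopic_concat_between[of _ _ _ _ _ _ a a p] hom
          joins_concat[of _ _ a a _ p] eps_homotopic_refl) blast+
    ultimately show ?thesis using cl_eqI by metis
  qed
qed

text \<open>Triangles of perimeter below \<open>3 * \<sigma>\<close> are null, and for
  \<open>\<delta>\<close> close to \<open>\<sigma>\<close> the others lie near a triad of side
  \<open>\<sigma>\<close>. One \<open>\<delta>'\<close> serves for all \<open>\<delta>\<close> below
  it, so it is enough that good scales exist arbitrarily close above \<open>\<sigma>\<close>. The
  factor \<open>11 / 10\<close> ensures \<open>2 * \<delta> \<le> 3 * \<sigma>\<close> as well as
  the hypothesis of \<open>near_triad_in_lollipops\<close>.\<close>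

lemma lollipops_above:
  assumes "compact X" "0 < \<sigma>"
  obtains \<delta>' where "\<sigma> < \<delta>'" "\<And>\<delta>. \<sigma> \<le> \<delta> \<Longrightarrow> \<delta> < \<delta>' \<Longrightarrow> carrier (\<pi> \<delta>) \<subseteq> lollipops \<delta> \<Longrightarrow>
    carrier (\<pi> \<sigma>) \<subseteq> lollipops \<sigma>"
proof -
  have "0 < \<sigma> / 40" using assms by simp
  obtain \<delta>1 where \<delta>1: "\<sigma> < \<delta>1" "\<And>a x b. a \<in> X \<Longrightarrow> x \<in> X \<Longrightarrow> b \<in> X \<Longrightarrow> dist a x < \<delta>1 \<Longrightarrow> dist x b < \<delta>1 \<Longrightarrow>
      dist b a < \<delta>1 \<Longrightarrow> 3 * \<sigma> \<le> perimeter (a, x, b) \<Longrightarrow>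
      \<exists>a' x' b'. triad X \<sigma> a' x' b' \<and> dist a a' < \<sigma> / 40 \<and> dist x x' < \<sigma> / 40 \<and> dist b b' < \<sigma> / 40"
    using triangles_near_triads[OF assms \<open>0 < \<sigma> / 40\<close>] by blast
  show thesis
  proof (rule that[of "min \<delta>1 (11 / 10 * \<sigma>)"])
    show "\<sigma> < min \<delta>1 (11 / 10 * \<sigma>)" using \<delta>1(1) assms by simp
    fix \<delta> assume \<delta>: "\<sigma> \<le> \<delta>" "\<delta> < min \<delta>1 (11 / 10 * \<sigma>)" "carrier (\<pi> \<delta>) \<subseteq> lollipops \<delta>"
    show "carrier (\<pi> \<sigma>) \<subseteq> lollipops \<sigma>"
    proof (rule lollipops_step[OF assms(2) \<delta>(1) _ _ \<delta>(3)])
      show "2 * \<delta> \<le> 3 * \<sigma>" using \<delta> assms by linarith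
      fix a x b k
      assume X: "a \<in> X" "x \<in> X" "b \<in> X" and d: "dist a x < \<delta>" "dist x b < \<delta>" "dist a b < \<delta>"
        and k: "joins X \<sigma> p a k"
      show "cl \<sigma> (k @@ (fill \<sigma> a x @@ fill \<sigma> x b @@ fill \<sigma> b a) @@ rev k) \<in> lollipops \<sigma>"
      proof (cases "perimeter (a, x, b) < 3 * \<sigma>")
        case True
        then show ?thesis
          by (rule null_conjugate_in_lollipops[OF triangle_fill_null[OF X assms(2)] k assms(2)])
      next
        case False
        then obtain a' x' b' where T: "triad X \<sigma> a' x' b'"
          "dist a a' < \<sigma> / 40" "dist x x' < \<sigma> / 40" "dist b b' < \<sigma> / 40"
          using \<delta>1(2)[OF X] d \<delta>(2) by (auto simp: dist_commute)
        show ?thesis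
          by (rule near_triad_in_lollipops[OF assms(2) _ X d(1,2) _ T k])
            (use \<delta>(2) d(3) in \<open>auto simp: dist_commute\<close>)
      qed
    qed
  qed
qed

text \<open>Just below \<open>\<delta>\<close> every triangle that occurs in a
  \<open>\<delta>\<close>-homotopy is null, so no circle of a new size has to enter.\<close>

lemma lollipops_below:
  assumes "compact X" "0 < \<delta>" "carrier (\<pi> \<delta>) \<subseteq> lollipops \<delta>"
  obtains \<delta>' where "\<delta>' < \<delta>" "\<And>\<sigma>. \<delta>' < \<sigma> \<Longrightarrow> \<sigma> \<le> \<delta> \<Longrightarrow> carrier (\<pi> \<sigma>) \<subseteq> lollipops \<sigma>"
proof -
  obtain \<delta>' where \<delta>': "2 / 3 * \<delta> \<le> \<delta>'" "\<delta>' < \<delta>" "\<And>\<sigma> a x b. \<delta>' < \<sigma> \<Longrightarrow> \<sigma> \<le> \<delta> \<Longrightarrow> a \<in> X \<Longrightarrow> x \<in> X \<Longrightarrow> b \<in> X \<Longrightarrow>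
    dist a x < \<delta> \<Longrightarrow> dist x b < \<delta> \<Longrightarrow> dist b a < \<delta> \<Longrightarrow>
    eps_homotopic X \<sigma> (fill \<sigma> a x @@ fill \<sigma> x b @@ fill \<sigma> b a) [a]"
    using triangles_null_below[OF assms(1,2)] by blast
  show thesis
  proof (rule that[OF \<delta>'(2)])
    fix \<sigma> assume \<sigma>: "\<delta>' < \<sigma>" "\<sigma> \<le> \<delta>"
    have "0 < \<sigma>" "2 * \<delta> \<le> 3 * \<sigma>" using \<sigma> \<delta>' assms by linarith+
    then show "carrier (\<pi> \<sigma>) \<subseteq> lollipops \<sigma>"
      using \<delta>'(3)[OF \<sigma>]
      by (intro lollipops_step[OF _ \<sigma>(2) _ _ assms(3)] null_conjugate_in_lollipops)
        (auto simp: dist_commute)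
  qed
qed

lemma carrier_large_scale:
  assumes "\<And>x y. x \<in> X \<Longrightarrow> y \<in> X \<Longrightarrow> dist x y < \<delta>"
  shows "carrier (\<pi> \<delta>) \<subseteq> {\<one>\<^bsub>\<pi> \<delta>\<^esub>}"
proof -
  have chain: "eps_chain X \<delta> \<alpha>" if "\<alpha> \<noteq> []" "set \<alpha> \<subseteq> X" for \<alpha>
  proof -
    have "successively (\<lambda>x y. dist x y < \<delta>) \<alpha>"
      unfolding successively_conv_nth using that assms by (meson Suc_lessD nth_mem subsetD)
    then show ?thesis using that by (simp add: eps_chain_def)
  qed
  have null: "eps_homotopic X \<delta> (x # \<alpha>) [x, last (x # \<alpha>)]" if "set (x # \<alpha>) \<subseteq> X" for x \<alpha>
    using that
  proof (induction \<alpha> arbitrary: x)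
    case Nil
    then show ?case
      using eps_homotopic_add_point[of X \<delta> "[]" "[x]" x] chain by simp
  next
    case (Cons y \<alpha>)
    let ?z = "last (y # \<alpha>)"
    have X: "x \<in> X" "y \<in> X" "?z \<in> X" using Cons.prems last_in_set[of "y # \<alpha>"] by auto
    have "eps_homotopic X \<delta> (y # \<alpha>) [y, ?z]" using Cons by simp
    then have "eps_homotopic X \<delta> ([x, y] @@ (y # \<alpha>)) ([x, y] @@ [y, ?z])"
      using X chain by (intro eps_homotopic_concat_right) auto
    then have "eps_homotopic X \<delta> (x # y # \<alpha>) [x, y, ?z]" by (simp add: chain_concat_def)
    moreover have "eps_homotopic X \<delta> [x, ?z] [x, y, ?z]"
      using eps_homotopic_add_point[of X \<delta> "[x]" "[?z]" y] chain X by simp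
    ultimately have "eps_homotopic X \<delta> (x # y # \<alpha>) [x, ?z]"
      using eps_homotopic_equiv by blast
    then show ?case by simp
  qed
  show ?thesis
  proof
    fix A assume "A \<in> carrier (\<pi> \<delta>)"
    then obtain \<alpha> where \<alpha>: "A = cl \<delta> \<alpha>" "joins X \<delta> p p \<alpha>" by (auto simp: carrier_pi)
    obtain \<alpha>' where \<alpha>': "\<alpha> = p # \<alpha>'" "last \<alpha> = p" using joinsD[OF \<alpha>(2)] by (cases \<alpha>) auto
    have "eps_homotopic X \<delta> \<alpha> [p, p]" using null[of p \<alpha>'] \<alpha>' joinsD(5)[OF \<alpha>(2)] by simp
    moreover have "eps_homotopic X \<delta> [p] [p, p]" using null[of p "[]"] base_point by simp
    ultimately have "eps_homotopic X \<delta> \<alpha> [p]" using eps_homotopic_equiv by blast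
    then show "A \<in> {\<one>\<^bsub>\<pi> \<delta>\<^esub>}" using \<alpha>(1) cl_eqI cl_one by simp
  qed
qed

lemma lollipops_eq_carrier:
  assumes "compact X" "0 < \<sigma>"
  shows "lollipops \<sigma> = carrier (\<pi> \<sigma>)"
proof
  show "lollipops \<sigma> \<subseteq> carrier (\<pi> \<sigma>)"
    by (rule subgroup.subset[OF lollipops_subgroup[OF assms(2)]])
  show "carrier (\<pi> \<sigma>) \<subseteq> lollipops \<sigma>"
  proof (rule ccontr)
    define bad where "bad = {\<delta>. \<sigma> \<le> \<delta> \<and> \<not> carrier (\<pi> \<delta>) \<subseteq> lollipops \<delta>}"
    assume "\<not> ?thesis"
    then have "\<sigma> \<in> bad" by (simp add: bad_def)
    obtain D where D: "\<And>x y. x \<in> X \<Longrightarrow> y \<in> X \<Longrightarrow> dist x y \<le> D"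
      using compact_imp_bounded[OF assms(1)] unfolding bounded_two_points by blast
    have "D \<ge> 0" using D[OF base_point base_point] by simp
    have bdd: "\<delta> \<le> D" if "\<delta> \<in> bad" for \<delta>
    proof (rule ccontr)
      assume "\<not> \<delta> \<le> D"
      then have "0 < \<delta>" "\<And>x y. x \<in> X \<Longrightarrow> y \<in> X \<Longrightarrow> dist x y < \<delta>" using D \<open>D \<ge> 0\<close> by force+
      then have "carrier (\<pi> \<delta>) \<subseteq> lollipops \<delta>"
        using carrier_large_scale subgroup.one_closed[OF lollipops_subgroup] by blast
      then show False using that by (simp add: bad_def)
    qed
    then have "bdd_above bad" by (auto simp: bdd_above_def)
    \<comment> \<open>All scales above \<open>s\<close> are good, so \<open>s\<close> is good by
      \<open>lollipops_above\<close>, and then so is an interval below \<open>s\<close> by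
      \<open>lollipops_below\<close>. But bad scales exist arbitrarily close to their
      supremum.\<close>
    define s where "s = Sup bad"
    have up: "\<delta> \<le> s" if "\<delta> \<in> bad" for \<delta> unfolding s_def using \<open>bdd_above bad\<close> that by (rule cSup_upper[rotated])
    have "0 < s" using up[OF \<open>\<sigma> \<in> bad\<close>] assms(2) by simp
    have "carrier (\<pi> s) \<subseteq> lollipops s"
    proof -
      obtain \<delta>' where \<delta>': "s < \<delta>'" "\<And>\<delta>. s \<le> \<delta> \<Longrightarrow> \<delta> < \<delta>' \<Longrightarrow> carrier (\<pi> \<delta>) \<subseteq> lollipops \<delta> \<Longrightarrow>
          carrier (\<pi> s) \<subseteq> lollipops s"
        using lollipops_above[OF assms(1) \<open>0 < s\<close>] by blast
      obtain \<delta> where "s < \<delta>" "\<delta> < \<delta>'" using dense[OF \<delta>'(1)] by blast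
      moreover from this have "\<delta> \<notin> bad" using up by fastforce
      ultimately show ?thesis
        using \<delta>'(2)[of \<delta>] up[OF \<open>\<sigma> \<in> bad\<close>] by (auto simp: bad_def)
    qed
    from lollipops_below[OF assms(1) \<open>0 < s\<close> this] obtain \<delta>' where
      \<delta>': "\<delta>' < s" "\<And>\<delta>. \<delta>' < \<delta> \<Longrightarrow> \<delta> \<le> s \<Longrightarrow> carrier (\<pi> \<delta>) \<subseteq> lollipops \<delta>" by blast
    obtain \<delta> where "\<delta> \<in> bad" "\<delta>' < \<delta>"
      using \<delta>'(1) \<open>\<sigma> \<in> bad\<close> unfolding s_def by (metis less_cSupD empty_iff)
    then show False using \<delta>'(2)[of \<delta>] up by (auto simp: bad_def)
  qed
qed

end

section \<open>Finite generation\<close>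

lemma (in group) generate_finite_support:
  assumes "x \<in> generate G A" "A \<subseteq> carrier G"
  shows "\<exists>F\<subseteq>A. finite F \<and> x \<in> generate G F"
  using assms(1)
proof (induction rule: generate.induct)
  case one
  then show ?case by (intro exI[of _ "{}"]) (auto intro: generate.one)
next
  case (incl h)
  then show ?case by (intro exI[of _ "{h}"]) (auto intro: generate.incl)
next
  case (inv h)
  then show ?case by (intro exI[of _ "{h}"]) (auto intro: generate.inv)
next
  case (eng h1 h2)
  then obtain F1 F2 where F: "F1 \<subseteq> A" "finite F1" "h1 \<in> generate G F1" "F2 \<subseteq> A" "finite F2" "h2 \<in> generate G F2"
    by blast
  then have "h1 \<in> generate G (F1 \<union> F2)" "h2 \<in> generate G (F1 \<union> F2)"
    using mono_generate[of F1 "F1 \<union> F2"] mono_generate[of F2 "F1 \<union> F2"] by auto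
  then show ?case using F by (intro exI[of _ "F1 \<union> F2"]) (auto intro: generate.eng)
qed

lemma (in group) generate_finite_subset:
  assumes "finite S" "S \<subseteq> generate G A" "A \<subseteq> carrier G"
  shows "\<exists>F\<subseteq>A. finite F \<and> generate G S \<subseteq> generate G F"
proof -
  have "\<forall>x\<in>S. \<exists>F. F \<subseteq> A \<and> finite F \<and> x \<in> generate G F"
    using generate_finite_support assms by blast
  then obtain F where F: "\<And>x. x \<in> S \<Longrightarrow> F x \<subseteq> A \<and> finite (F x) \<and> x \<in> generate G (F x)"
    by metis
  define U where "U = (\<Union>x\<in>S. F x)"
  have U: "U \<subseteq> A" "finite U" using F assms(1) by (auto simp: U_def)
  have "S \<subseteq> generate G U"
  proof
    fix x assume "x \<in> S"
    then have "F x \<subseteq> U" by (auto simp: U_def)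
    then show "x \<in> generate G U" using F[OF \<open>x \<in> S\<close>] mono_generate by blast
  qed
  moreover have "subgroup (generate G U) G" using generate_is_subgroup U assms(3) by blast
  ultimately show ?thesis using U generate_subgroup_incl by blast
qed

section \<open>Generators from a finite net\<close>

context geodesic_set
begin

text \<open>A ladder whose rungs join \<open>g i\<close> to \<open>f i\<close>: the first rung is
  pushed across one square after another to the last. Quarters suffice, since the steps of
  \<open>g\<close> are then below \<open>3 * \<epsilon> / 4\<close> and the boundary of a square is
  shorter than \<open>3 * \<epsilon> / 2\<close>.\<close>

lemma slide_chain:
  assumes "0 < \<epsilon>" "ns \<noteq> []" "\<And>i. i \<in> set ns \<Longrightarrow> f i \<in> X \<and> g i \<in> X \<and> dist (g i) (f i) < \<epsilon> / 4"
    and "successively (\<lambda>i j. dist (f i) (f j) < \<epsilon> / 4) ns"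
  shows "joins X \<epsilon> (g (hd ns)) (g (last ns)) (map g ns) \<and>
    joins X \<epsilon> (f (hd ns)) (f (last ns)) (map f ns) \<and>
    eps_homotopic X \<epsilon> ([g (hd ns), f (hd ns)] @@ map f ns) (map g ns @@ [g (last ns), f (last ns)])"
  using assms(2-)
proof (induction ns rule: induct_list012)
  case (2 i)
  then have i: "f i \<in> X" "g i \<in> X" "dist (g i) (f i) < \<epsilon>" using assms(1) by force+
  then have "joins X \<epsilon> (g i) (f i) [g i, f i]"
    by (simp add: joins_def eps_chain_def)
  with i show ?case
    by (simp add: eps_homotopic_refl joinsD(1) joins_single)
next
  case (3 i j ns)
  define k where "k = last (j # ns)"
  have IH: "joins X \<epsilon> (g j) (g k) (map g (j # ns))"
    "joins X \<epsilon> (f j) (f k) (map f (j # ns))"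
    "eps_homotopic X \<epsilon> ([g j, f j] @@ map f (j # ns)) (map g (j # ns) @@ [g k, f k])"
    using "3.IH"(2) "3.prems" by (auto simp: k_def)
  have X: "f i \<in> X" "f j \<in> X" "g i \<in> X" "g j \<in> X" "dist (g i) (f i) < \<epsilon> / 4"
    "dist (g j) (f j) < \<epsilon> / 4" "dist (f i) (f j) < \<epsilon> / 4"
    using "3.prems" by auto
  have gg: "dist (g i) (g j) < 3 * \<epsilon> / 4"
    using X dist_triangle[of "g i" "g j" "f i"] dist_triangle[of "f i" "g j" "f j"] dist_commute[of "f j" "g j"]
    by linarith
  have c: "joins X \<epsilon> (g i) (f j) [g i, f i, f j]" "joins X \<epsilon> (g i) (f j) [g i, g j, f j]"
    "joins X \<epsilon> (g i) (g j) [g i, g j]" "joins X \<epsilon> (g j) (f j) [g j, f j]"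
    "joins X \<epsilon> (f i) (f j) [f i, f j]"
    using X gg assms(1) by (auto simp: joins_def eps_chain_def)
  have b: "joins X \<epsilon> (g i) (g k) (map g (i # j # ns))" "joins X \<epsilon> (f i) (f k) (map f (i # j # ns))"
    using joins_concat[OF c(3) IH(1)] joins_concat[OF c(5) IH(2)] by (simp_all add: chain_concat_def)
  have "eps_homotopic X \<epsilon> [g i, f i, f j] [g i, g j, f j]"
    by (rule homotopic_if_short[OF c(1,2)]) (use X gg assms(1) in auto)
  from eps_homotopic_concat_between[OF this eps_homotopic_refl c(1) IH(2)]
  have "eps_homotopic X \<epsilon> ([g i, f i, f j] @@ map f (j # ns)) ([g i, g j, f j] @@ map f (j # ns))"
    using joinsD(1)[OF IH(2)] by blast
  then have 1: "eps_homotopic X \<epsilon> ([g i, f i] @@ map f (i # j # ns)) ([g i, g j, f j] @@ map f (j # ns))"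
    by (simp add: chain_concat_def)
  have "eps_homotopic X \<epsilon> ([g i, g j] @@ ([g j, f j] @@ map f (j # ns))) ([g i, g j] @@ (map g (j # ns) @@ [g k, f k]))"
    by (rule eps_homotopic_concat_between[OF eps_homotopic_refl IH(3) c(3) joins_concat[OF c(4) IH(2)]])
      (rule joinsD(1)[OF c(3)])
  then have 2: "eps_homotopic X \<epsilon> ([g i, g j, f j] @@ map f (j # ns)) (map g (i # j # ns) @@ [g k, f k])"
    by (simp add: chain_concat_def)
  have "eps_homotopic X \<epsilon> ([g i, f i] @@ map f (i # j # ns)) (map g (i # j # ns) @@ [g k, f k])"
    by (rule eps_homotopic_trans[OF 1 2])
  with b show ?case by (simp add: k_def)
qed simp

lemma repeated_point_null: "a \<in> X \<Longrightarrow> 0 < \<epsilon> \<Longrightarrow> eps_homotopic X \<epsilon> [a, a] [a]"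
  using eps_homotopic_add_point[of X \<epsilon> "[]" "[a]" a] eps_homotopic_sym by (simp add: eps_chain_def)

lemma close_chains_homotopic:
  assumes "0 < \<epsilon>" "ns \<noteq> []" "\<And>i. i \<in> set ns \<Longrightarrow> f i \<in> X \<and> g i \<in> X \<and> dist (g i) (f i) < \<epsilon> / 4"
    and "successively (\<lambda>i j. dist (f i) (f j) < \<epsilon> / 4) ns" "g (hd ns) = f (hd ns)" "g (last ns) = f (last ns)"
  shows "eps_homotopic X \<epsilon> (map f ns) (map g ns)"
proof -
  note S = slide_chain[OF assms(1-4)]
  have X: "f (hd ns) \<in> X" "f (last ns) \<in> X" using assms(2,3) by auto
  have "eps_homotopic X \<epsilon> ([f (hd ns), f (hd ns)] @@ map f ns) (map f ns)"
    using homotopic_concat_null_left[OF repeated_point_null[OF X(1) assms(1)]] S by blast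
  moreover have "eps_homotopic X \<epsilon> (map g ns @@ [f (last ns), f (last ns)]) (map g ns)"
    using homotopic_concat_null_right[OF repeated_point_null[OF X(2) assms(1)]] S assms(6) by auto
  ultimately show ?thesis
    using S assms(5,6) eps_homotopic_equiv by metis
qed

end

context pointed_geodesic_set
begin

definition edge_loop :: "real \<Rightarrow> 'a \<Rightarrow> 'a \<Rightarrow> 'a list" where
  "edge_loop \<epsilon> y z = fill \<epsilon> p y @@ [y, z] @@ rev (fill \<epsilon> p z)"

lemma edge_loop_between:
  assumes "0 < \<epsilon>" "y \<in> X" "z \<in> X" "dist y z < \<epsilon>"
  shows "joins X \<epsilon> p p (edge_loop \<epsilon> y z)"
proof -
  have "joins X \<epsilon> y z [y, z]" using assms by (simp add: joins_def eps_chain_def)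
  then show ?thesis
    unfolding edge_loop_def using fill(1)[OF base_point _ assms(1)] assms
    by (blast intro: joins_concat joins_rev)
qed

text \<open>Telescoping: the way back to \<open>p\<close> that closes one edge loop cancels against
  the way out that opens the next. What is left is the chain itself, preceded by the way from
  \<open>p\<close> to its first point.\<close>

lemma cl_in_generate_edge_loops:
  assumes "0 < \<epsilon>" "Y \<subseteq> X" "set \<beta> \<subseteq> Y" "joins X \<epsilon> y p \<beta>"
  shows "cl \<epsilon> (fill \<epsilon> p y @@ \<beta>) \<in> generate (\<pi> \<epsilon>) {cl \<epsilon> (edge_loop \<epsilon> y z) |y z. y \<in> Y \<and> z \<in> Y \<and> dist y z < \<epsilon>}"
    (is "_ \<in> generate _ ?S")
  using assms(3,4)
proof (induction \<beta> arbitrary: y rule: induct_list012)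
  case 1
  then show ?case by (auto dest: joinsD(2))
next
  case (2 x)
  then have "x = p" "y = p" by (auto simp: joins_def)
  then have "cl \<epsilon> (fill \<epsilon> p y @@ [x]) = \<one>\<^bsub>\<pi> \<epsilon>\<^esub>"
    using cl_eqI[OF fill_same_null[OF base_point assms(1)]] by (simp add: cl_one)
  then show ?case by (simp add: generate.one)
next
  case (3 x z \<beta>)
  then have x: "x = y" by (simp add: joins_def)
  have X: "y \<in> Y" "z \<in> Y" "dist y z < \<epsilon>" and \<beta>: "joins X \<epsilon> z p (z # \<beta>)"
    using "3.prems" by (auto simp: joins_def eps_chain_def)
  have XX: "y \<in> X" "z \<in> X" using X assms(2) by auto
  let ?F = "fill \<epsilon> p"
  note F = fill(1)[OF base_point XX(1) assms(1)] fill(1)[OF base_point XX(2) assms(1)]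
  have yz: "joins X \<epsilon> y z [y, z]" using X XX by (simp add: joins_def eps_chain_def)
  note e = edge_loop_between[OF assms(1) XX X(3)] and f = joins_concat[OF F(2) \<beta>]
  have "eps_homotopic X \<epsilon> (((?F y @@ [y, z]) @@ rev (?F z)) @@ (?F z @@ (z # \<beta>))) ((?F y @@ [y, z]) @@ (z # \<beta>))"
    by (rule cancel_rev[OF joins_concat[OF F(1) yz] F(2) \<beta> assms(1)])
  moreover have "(?F y @@ [y, z]) @@ (z # \<beta>) = ?F y @@ (x # z # \<beta>)"
    by (simp add: chain_concat_def x)
  moreover have "(?F y @@ [y, z]) @@ rev (?F z) = edge_loop \<epsilon> y z"
    by (simp add: edge_loop_def chain_concat_assoc)
  ultimately have "cl \<epsilon> (?F y @@ (x # z # \<beta>)) = cl \<epsilon> (edge_loop \<epsilon> y z) \<otimes>\<^bsub>\<pi> \<epsilon>\<^esub> cl \<epsilon> (?F z @@ (z # \<beta>))"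
    using cl_mult[OF e f] cl_eqI by metis
  moreover have "cl \<epsilon> (edge_loop \<epsilon> y z) \<in> generate (\<pi> \<epsilon>) ?S"
    using X by (intro generate.incl) auto
  moreover have "cl \<epsilon> (?F z @@ (z # \<beta>)) \<in> generate (\<pi> \<epsilon>) ?S"
    using "3.IH"(2)[OF _ \<beta>] "3.prems" by simp
  ultimately show ?case by (simp add: generate.eng)
qed

lemma finitely_generated:
  assumes "compact X" "0 < \<epsilon>"
  shows "\<exists>S. finite S \<and> S \<subseteq> carrier (\<pi> \<epsilon>) \<and> carrier (\<pi> \<epsilon>) \<subseteq> generate (\<pi> \<epsilon>) S"
proof -
  have "0 < \<epsilon> / 4" using assms by simp
  then obtain N where N: "finite N" "N \<subseteq> X" "\<And>x. x \<in> X \<Longrightarrow> \<exists>n\<in>N. dist n x < \<epsilon> / 4"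
    using compact_finite_net[OF assms(1) order_refl] by blast
  define Y where "Y = insert p N"
  \<comment> \<open>The base point is sent to itself, so that loops based at \<open>p\<close> are
    moved to loops based at \<open>p\<close>.\<close>
  define r where "r x = (if x = p then p else SOME n. n \<in> N \<and> dist n x < \<epsilon> / 4)" for x
  have "\<forall>x\<in>X. r x \<in> Y \<and> dist (r x) x < \<epsilon> / 4"
  proof
    fix x assume "x \<in> X"
    then have "\<exists>n. n \<in> N \<and> dist n x < \<epsilon> / 4" using N(3) by blast
    from someI_ex[OF this] show "r x \<in> Y \<and> dist (r x) x < \<epsilon> / 4"
      using \<open>0 < \<epsilon> / 4\<close> by (simp add: r_def Y_def)
  qed
  then have r: "\<And>x. x \<in> X \<Longrightarrow> r x \<in> Y" "\<And>x. x \<in> X \<Longrightarrow> dist (r x) x < \<epsilon> / 4" by auto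
  have Y: "finite Y" "Y \<subseteq> X" "r p = p" using N base_point by (auto simp: Y_def r_def)
  define S where "S = {cl \<epsilon> (edge_loop \<epsilon> y z) |y z. y \<in> Y \<and> z \<in> Y \<and> dist y z < \<epsilon>}"
  have "S \<subseteq> (\<lambda>(y, z). cl \<epsilon> (edge_loop \<epsilon> y z)) ` (Y \<times> Y)" by (auto simp: S_def)
  then have "finite S" using Y(1) by (meson finite_SigmaI finite_imageI finite_subset)
  moreover have "S \<subseteq> carrier (\<pi> \<epsilon>)"
    using edge_loop_between[OF assms(2)] cl_in_carrier Y(2) unfolding S_def by blast
  moreover have "carrier (\<pi> \<epsilon>) \<subseteq> generate (\<pi> \<epsilon>) S"
  proof
    fix A assume "A \<in> carrier (\<pi> \<epsilon>)"
    then obtain \<alpha>0 where \<alpha>0: "joins X \<epsilon> p p \<alpha>0" "A = cl \<epsilon> \<alpha>0" by (auto simp: carrier_pi)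
    \<comment> \<open>Moving a chain pointwise by less than \<open>\<epsilon> / 4\<close> keeps its
      class if its steps are below \<open>\<epsilon> / 4\<close> as well, hence the refinement
      before passing to the net.\<close>
    obtain \<alpha> where \<alpha>: "joins X (\<epsilon> / 4) p p \<alpha>" "eps_homotopic X \<epsilon> \<alpha>0 \<alpha>"
      using chain_refine[OF \<alpha>0(1) \<open>0 < \<epsilon> / 4\<close>] assms(2) by auto
    have pts: "x \<in> X \<and> r x \<in> X \<and> dist (r x) x < \<epsilon> / 4" if "x \<in> set \<alpha>" for x
      using joinsD(5)[OF \<alpha>(1)] that r Y(2) by blast
    have st: "successively (\<lambda>x y. dist x y < \<epsilon> / 4) \<alpha>"
      using joinsD(1)[OF \<alpha>(1)] by (simp add: eps_chain_def)
    have ends: "r (hd \<alpha>) = hd \<alpha>" "r (last \<alpha>) = last \<alpha>" using joinsD(3,4)[OF \<alpha>(1)] Y(3) by auto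
    have slide: "eps_homotopic X \<epsilon> \<alpha> (map r \<alpha>)"
      using close_chains_homotopic[OF assms(2) joinsD(2)[OF \<alpha>(1)] pts st ends] by simp
    have sl: "joins X \<epsilon> p p (map r \<alpha>)"
      using joins_homotopic[OF joins_mono[OF \<alpha>(1), of \<epsilon>] slide] assms(2) by simp
    note slide
    moreover have "eps_homotopic X \<epsilon> (fill \<epsilon> p p @@ map r \<alpha>) (map r \<alpha>)"
      by (rule homotopic_concat_null_left[OF fill_same_null[OF base_point assms(2)] sl])
    ultimately have "A = cl \<epsilon> (fill \<epsilon> p p @@ map r \<alpha>)"
      using cl_eqI \<alpha>0(2) \<alpha>(2) by metis
    moreover have "set (map r \<alpha>) \<subseteq> Y" using r(1) joinsD(5)[OF \<alpha>(1)] by auto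
    ultimately show "A \<in> generate (\<pi> \<epsilon>) S"
      using cl_in_generate_edge_loops[OF assms(2) Y(2) _ sl] by (simp add: S_def)
  qed
  ultimately show ?thesis by blast
qed

text \<open>Each of the finitely many edge loops is a word in finitely many generating loops, so
  those occurring in the words already generate.\<close>

proposition finite_generating_loops:
  assumes "compact X" "0 < \<epsilon>"
  obtains \<Lambda> where "finite \<Lambda>" "\<And>\<nu>. \<nu> \<in> \<Lambda> \<Longrightarrow> generating_loop \<epsilon> \<nu>"
    "generate (\<pi> \<epsilon>) (cl \<epsilon> ` \<Lambda>) = carrier (\<pi> \<epsilon>)"
proof -
  interpret group "\<pi> \<epsilon>" by (rule group_pi[OF assms(2)])
  obtain S where S: "finite S" "S \<subseteq> carrier (\<pi> \<epsilon>)" "carrier (\<pi> \<epsilon>) \<subseteq> generate (\<pi> \<epsilon>) S"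
    using finitely_generated[OF assms] by blast
  have "S \<subseteq> generate (\<pi> \<epsilon>) (cl \<epsilon> ` {\<nu>. generating_loop \<epsilon> \<nu>})"
    using S(2) lollipops_eq_carrier[OF assms] by (simp add: lollipops_def)
  then obtain F where F: "F \<subseteq> cl \<epsilon> ` {\<nu>. generating_loop \<epsilon> \<nu>}" "finite F"
    "generate (\<pi> \<epsilon>) S \<subseteq> generate (\<pi> \<epsilon>) F"
    using generate_finite_subset[OF S(1) _ generating_loops_carrier] by blast
  obtain \<Lambda> where \<Lambda>: "\<Lambda> \<subseteq> {\<nu>. generating_loop \<epsilon> \<nu>}" "finite \<Lambda>" "F = cl \<epsilon> ` \<Lambda>"
    using finite_subset_image[OF F(2,1)] by blast
  have "generate (\<pi> \<epsilon>) F = carrier (\<pi> \<epsilon>)"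
    using F S generate_incl[of F] generating_loops_carrier by blast
  then show thesis using that[of \<Lambda>] \<Lambda> by blast
qed

end

section \<open>Refinements of lollichains\<close>

lemma lip_curve_isometric:
  assumes "lip_curve X c a b" "dist (c a) (c b) = b - a" "a \<le> s" "s \<le> t" "t \<le> b"
  shows "dist (c s) (c t) = t - s"
proof -
  have "dist (c a) (c b) \<le> dist (c a) (c s) + dist (c s) (c t) + dist (c t) (c b)"
    using dist_triangle[of "c a" "c b" "c s"] dist_triangle[of "c s" "c b" "c t"] by linarith
  then show ?thesis
    using lip_curveD(2)[OF assms(1), of a s] lip_curveD(2)[OF assms(1), of s t]
      lip_curveD(2)[OF assms(1), of t b] assms by linarith
qed

lemma lip_curve_geodesic:
  assumes "lip_curve X c a b" "dist (c a) (c b) = b - a" "a \<le> b"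
  shows "geodesic X (\<lambda>t. c (a + t)) (c a) (c b)"
proof -
  have "geodesic X (\<lambda>t. c (a + t)) (c (a + 0)) (c (a + (b - a)))"
  proof (rule isometric_geodesic)
    show "(\<lambda>t. c (a + t)) ` {0..b - a} \<subseteq> X"
      using lip_curveD(1)[OF assms(1)] by auto
    show "dist (c (a + s)) (c (a + t)) = t - s" if "0 \<le> s" "s \<le> t" "t \<le> b - a" for s t
      using lip_curve_isometric[OF assms(1,2), of "a + s" "a + t"] that by simp
  qed (use assms in simp)
  then show ?thesis by simp
qed

lemma refinement_hd: "refinement X \<alpha> \<beta> \<Longrightarrow> \<alpha> \<noteq> [] \<and> \<beta> \<noteq> [] \<and> hd \<beta> = hd \<alpha>"
  by (cases rule: refinement.cases) auto

lemma refinement_refl: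
  assumes "geodesic_space X" "\<alpha> \<noteq> []" "set \<alpha> \<subseteq> X"
  shows "refinement X \<alpha> \<alpha>"
  using assms(2,3)
proof (induction \<alpha> rule: induct_list012)
  case (3 x y \<alpha>)
  have "x \<in> X" "y \<in> X" using "3.prems" by auto
  then obtain g where "geodesic X g x y" using assms(1) unfolding geodesic_space_def by blast
  moreover have "refinement X (y # \<alpha>) (y # \<alpha>)" using 3 by simp
  ultimately show ?case using refinement.step[of X g x y "[]"] by simp
qed (auto intro: refinement.single)

lemma refinement_concat:
  assumes "refinement X \<alpha> \<alpha>'" "refinement X \<beta> \<beta>'" "last \<alpha> = hd \<beta>"
  shows "refinement X (\<alpha> @@ \<beta>) (\<alpha>' @@ \<beta>')"
  using assms(1,3)
proof (induction rule: refinement.induct)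
  case (single x)
  then show ?case using assms(2) refinement_hd[OF assms(2)] by simp
next
  case (step g x y ts \<alpha> \<alpha>')
  then have "refinement X (y # \<alpha> @ tl \<beta>) (\<alpha>' @ tl \<beta>')" by (simp add: chain_concat_def)
  from refinement.step[OF step(1-3) this] show ?case by (simp add: chain_concat_def)
qed

text \<open>\<open>ts\<close> is cut at the second corner \<open>v\<close>. Strict sorting puts the
  times before the cut, apart from \<open>u\<close>, strictly between the corners, and on that
  interval the curve is a geodesic because its speed bound is attained at the ends.\<close>

lemma refinement_map:
  assumes "sorted_wrt (<) (u # us)" "sorted_wrt (<) ts" "ts \<noteq> []" "hd ts = u" "last ts = last (u # us)"
    "set (u # us) \<subseteq> set ts" "unit_speed c (u # us)"
    "lip_curve X c u (last (u # us))"
  shows "refinement X (map c (u # us)) (map c ts)"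
  using assms
proof (induction us arbitrary: u ts)
  case Nil
  have "ts = [u]"
  proof (cases ts)
    case (Cons t ts')
    then show ?thesis using Nil last_in_set[of ts'] by (cases "ts' = []") fastforce+
  qed (use Nil in simp)
  then show ?case by (simp add: refinement.single)
next
  case (Cons v us)
  have uv: "u < v" "\<forall>w\<in>set us. v < w" using Cons.prems(1) by auto
  have vl: "v \<le> last (v # us)" using uv(2) by (metis last_ConsL last_ConsR last_in_set less_imp_le order_refl)
  obtain A B where AB: "ts = A @ v # B" using Cons.prems(6) by (meson list.set_intros split_list subsetD)
  have sA: "\<forall>a\<in>set A. a < v" "sorted_wrt (<) A" "sorted_wrt (<) (v # B)"
    using Cons.prems(2) unfolding AB by (auto simp: sorted_wrt_append)
  obtain ms where A: "A = u # ms" using Cons.prems(4) uv AB by (cases A) auto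
  have lip: "lip_curve X c u v" "lip_curve X c v (last (v # us))"
    using lip_curve_subset[OF Cons.prems(8)] uv vl by auto
  have "refinement X (map c (v # us)) (map c (v # B))"
  proof (rule Cons.IH)
    show "set (v # us) \<subseteq> set (v # B)"
      using Cons.prems(6) sA(1) uv unfolding AB by fastforce
  qed (use Cons.prems sA lip AB in auto)
  moreover have d: "dist (c u) (c v) = v - u" using Cons.prems(7) by simp
  moreover have "geodesic X (\<lambda>t. c (u + t)) (c u) (c v)"
    using lip_curve_geodesic[OF lip(1) d] uv by simp
  moreover have "sorted_wrt (<) (map (\<lambda>m. m - u) ms)" "set (map (\<lambda>m. m - u) ms) \<subseteq> {0<..<dist (c u) (c v)}"
    using sA unfolding A d by (auto simp: sorted_wrt_map)
  ultimately have "refinement X (c u # c v # map c us)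
      (c u # map (\<lambda>t. c (u + t)) (map (\<lambda>m. m - u) ms) @ map c (v # B))"
    by (intro refinement.step) auto
  then show ?case by (simp add: AB A comp_def)
qed

section \<open>Essential curves as refined triads\<close>

context pointed_geodesic_set
begin

lemma essential_curve_sides:
  assumes "essential_curve \<delta> c" "i \<in> {0, \<delta>, 2 * \<delta>}"
  shows "lip_curve X c i (i + \<delta>)" "dist (c i) (c (i + \<delta>)) = \<delta>"
proof -
  have c: "0 < \<delta>" "lip_curve X c 0 (3 * \<delta>)" "c (3 * \<delta>) = c 0" "dist (c 0) (c \<delta>) = \<delta>"
    "dist (c \<delta>) (c (2 * \<delta>)) = \<delta>" "dist (c (2 * \<delta>)) (c 0) = \<delta>"
    using assms(1) by (auto simp: essential_curve_def)
  show "lip_curve X c i (i + \<delta>)"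
    by (rule lip_curve_subset[OF c(2)]) (use assms(2) c(1) in auto)
  have "2 * \<delta> + \<delta> = 3 * \<delta>" "\<delta> + \<delta> = 2 * \<delta>" by simp_all
  then show "dist (c i) (c (i + \<delta>)) = \<delta>" using assms(2) c by auto
qed

text \<open>A 1-Lipschitz curve covering distance \<open>\<delta>\<close> in time
  \<open>\<delta>\<close> is a geodesic, so the three sides are geodesics and the half-times give
  midpoints. The midpoint chain is itself the \<open>\<delta>\<close>-refinement that witnesses
  essentiality.\<close>

lemma essential_curve_triad:
  assumes "essential_curve \<delta> c"
  shows "essential_triad X \<delta> (c 0) (c \<delta>) (c (2 * \<delta>))"
    "midpoint_refinement X (triad_loop (c 0) (c \<delta>) (c (2 * \<delta>))) (map c (sixths \<delta>))"
    "joins X \<delta> (c 0) (c 0) (map c (sixths \<delta>))"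
    "unit_speed c (sixths \<delta>)"
proof -
  have c: "0 < \<delta>" "lip_curve X c 0 (3 * \<delta>)" "c (3 * \<delta>) = c 0" "dist (c 0) (c \<delta>) = \<delta>"
    "dist (c \<delta>) (c (2 * \<delta>)) = \<delta>" "dist (c (2 * \<delta>)) (c 0) = \<delta>" "\<not> eps_null X \<delta> (map c (sixths \<delta>))"
    using assms by (auto simp: essential_curve_def)
  have X: "c 0 \<in> X" "c \<delta> \<in> X" "c (2 * \<delta>) \<in> X"
    using lip_curveD(1)[OF c(2)] c(1) by auto
  have sides: "lip_curve X c i (i + \<delta>)" "dist (c i) (c (i + \<delta>)) = (i + \<delta>) - i"
    if "i \<in> {0, \<delta>, 2 * \<delta>}" for i
    using essential_curve_sides[OF assms that] by auto
  have iso: "dist (c s) (c t) = t - s" if "i \<in> {0, \<delta>, 2 * \<delta>}" "i \<le> s" "s \<le> t" "t \<le> i + \<delta>" for i s t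
    by (rule lip_curve_isometric[OF sides[OF that(1)] that(2-)])
  show s6: "unit_speed c (sixths \<delta>)"
    using iso[of 0 0 "\<delta> / 2"] iso[of 0 "\<delta> / 2" \<delta>] iso[of \<delta> \<delta> "3 * \<delta> / 2"] iso[of \<delta> "3 * \<delta> / 2" "2 * \<delta>"]
      iso[of "2 * \<delta>" "2 * \<delta>" "5 * \<delta> / 2"] iso[of "2 * \<delta>" "5 * \<delta> / 2" "3 * \<delta>"] c(1)
    by (simp add: sixths_def)
  have geo: "geodesic X (\<lambda>t. c (i + t)) (c i) (c (i + \<delta>))" if "i \<in> {0, \<delta>, 2 * \<delta>}" for i
    using lip_curve_geodesic[OF sides[OF that]] c(1) by simp
  have e: "2 * \<delta> + \<delta> = 3 * \<delta>" "\<delta> + \<delta> = 2 * \<delta>" "\<delta> + \<delta> / 2 = 3 * \<delta> / 2" "2 * \<delta> + \<delta> / 2 = 5 * \<delta> / 2"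
    by simp_all
  have g: "geodesic X (\<lambda>t. c (0 + t)) (c 0) (c \<delta>)" "geodesic X (\<lambda>t. c (\<delta> + t)) (c \<delta>) (c (2 * \<delta>))"
    "geodesic X (\<lambda>t. c (2 * \<delta> + t)) (c (2 * \<delta>)) (c 0)"
    using geo[of 0] geo[of \<delta>] geo[of "2 * \<delta>"] by (simp_all add: e c(3))
  show "midpoint_refinement X (triad_loop (c 0) (c \<delta>) (c (2 * \<delta>))) (map c (sixths \<delta>))"
    using midpoint_refinement.step[OF g(1) midpoint_refinement.step[OF g(2)
          midpoint_refinement.step[OF g(3) midpoint_refinement.single]]]
    by (simp add: triad_loop_def sixths_def c e)
  show b: "joins X \<delta> (c 0) (c 0) (map c (sixths \<delta>))"
    using joins_map[OF lip_curve_modulus[OF c(2)] subdivision_sixths[OF c(1)]] c(3) by simp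
  have t: "unit_speed c (0 # [\<delta>, 2 * \<delta>, 3 * \<delta>])"
    using c by simp
  have "refinement X (map c (0 # [\<delta>, 2 * \<delta>, 3 * \<delta>])) (map c (sixths \<delta>))"
    by (rule refinement_map[OF _ _ _ _ _ _ t]) (use c in \<open>auto simp: sixths_def\<close>)
  then have "eps_refinement X \<delta> (triad_loop (c 0) (c \<delta>) (c (2 * \<delta>))) (map c (sixths \<delta>))"
    using joinsD(1)[OF b] by (simp add: eps_refinement_def triad_loop_def c(3))
  then show "essential_triad X \<delta> (c 0) (c \<delta>) (c (2 * \<delta>))"
    using c X by (auto simp: essential_triad_def triad_def)
qed

text \<open>The stick needs no new points: an \<open>\<epsilon>\<close>-chain is also a
  \<open>\<delta>\<close>-chain, and it refines itself. Only the circle is refined, from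
  \<open>sixths \<delta>\<close> to the finer times \<open>ts\<close>.\<close>

lemma generating_loop_refines_lollichain:
  assumes "generating_loop \<epsilon> \<nu>"
  shows "\<exists>\<delta>\<ge>\<epsilon>. \<exists>\<mu>. lollichain X p \<delta> \<mu> \<and> eps_refinement X \<epsilon> \<mu> \<nu>"
proof -
  obtain \<delta> c ts k where \<nu>: "\<epsilon> \<le> \<delta>" "essential_curve \<delta> c" "subdivision \<epsilon> 0 (3 * \<delta>) ts" "sorted_wrt (<) ts"
    "set (sixths \<delta>) \<subseteq> set ts" "joins X \<epsilon> p (c 0) k" "\<nu> = k @@ map c ts @@ rev k"
    using assms by (auto simp: generating_loop_def)
  have c: "0 < \<delta>" "lip_curve X c 0 (3 * \<delta>)" using \<nu>(2) by (auto simp: essential_curve_def)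
  note E = essential_curve_triad[OF \<nu>(2)] and k = joins_mono[OF \<nu>(6,1)]
  let ?\<mu> = "k @@ map c (sixths \<delta>) @@ rev k"
  have "eps_loop X \<delta> p ?\<mu>"
    unfolding eps_loop_iff using k E(3) by (blast intro: joins_concat joins_rev)
  then have "lollichain X p \<delta> ?\<mu>"
    unfolding lollichain_def using E(1,2) joinsD[OF k] by blast
  moreover have "refinement X ?\<mu> \<nu>"
  proof -
    have "sixths \<delta> = 0 # tl (sixths \<delta>)" by (simp add: sixths_def)
    have "refinement X (map c (0 # tl (sixths \<delta>))) (map c ts)"
      using \<nu>(3-5) E(4) c by (intro refinement_map) (simp_all add: sixths_def subdivision_def)
    then have "refinement X (map c (sixths \<delta>)) (map c ts)" by (simp add: sixths_def)
    moreover have "refinement X (rev k) (rev k)" "refinement X k k"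
      using refinement_refl[OF geodesic_space] joinsD(2,5)[OF k] by auto
    ultimately show ?thesis
      unfolding \<nu>(7) using joinsD(4)[OF k] joinsD(3)[OF joins_rev[OF k]]
        joinsD(4)[OF E(3)] joinsD(3)[OF joins_concat[OF E(3) joins_rev[OF k]]]
      by (intro refinement_concat) auto
  qed
  ultimately show ?thesis
    using \<nu>(1) joinsD(1)[OF generating_loop_between[OF assms]] by (auto simp: eps_refinement_def)
qed

end

section \<open>The groupoid of paths\<close>

definition path_between :: "'a::topological_space set \<Rightarrow> 'a \<Rightarrow> 'a \<Rightarrow> (real \<Rightarrow> 'a) \<Rightarrow> bool" where
  "path_between X a b f \<longleftrightarrow> path f \<and> path_image f \<subseteq> X \<and> pathstart f = a \<and> pathfinish f = b"

lemma path_between_join: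
  "path_between X a b f \<Longrightarrow> path_between X b c g \<Longrightarrow> path_between X a c (f +++ g)"
  by (auto simp: path_between_def path_image_join)

lemma path_between_reverse: "path_between X a b f \<Longrightarrow> path_between X b a (reversepath f)"
  by (auto simp: path_between_def)

lemma path_between_const: "a \<in> X \<Longrightarrow> path_between X a a (\<lambda>_. a)"
  by (auto simp: path_between_def path_def path_image_def pathstart_def pathfinish_def)

lemma path_between_mem: "path_between X a b f \<Longrightarrow> a \<in> X \<and> b \<in> X"
  by (metis path_between_def pathfinish_in_path_image pathstart_in_path_image subsetD)

lemma path_between_mono: "path_between Y a b f \<Longrightarrow> Y \<subseteq> X \<Longrightarrow> path_between X a b f"
  by (auto simp: path_between_def)

lemma path_between_homotopic:
  "path_between X a b f \<Longrightarrow> homotopic_paths X f g \<Longrightarrow> path_between X a b g"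
  using homotopic_paths_imp_path homotopic_paths_imp_subset homotopic_paths_imp_pathstart
    homotopic_paths_imp_pathfinish unfolding path_between_def by metis

lemmas path_homotopic_equiv = homotopic_paths_sym homotopic_paths_trans

lemma path_homotopic_refl: "path_between X a b f \<Longrightarrow> homotopic_paths X f f"
  by (simp add: path_between_def)

lemma path_homotopic_join:
  assumes "homotopic_paths X f f'" "homotopic_paths X g g'" "path_between X a b f" "path_between X b c g"
  shows "homotopic_paths X (f +++ g) (f' +++ g')"
  using assms by (intro homotopic_paths_join) (auto simp: path_between_def)

lemma path_homotopic_assoc:
  assumes "path_between X a b f" "path_between X b c g" "path_between X c d h"
  shows "homotopic_paths X ((f +++ g) +++ h) (f +++ (g +++ h))"
  by (rule homotopic_paths_sym, rule homotopic_paths_assoc) (use assms in \<open>auto simp: path_between_def\<close>)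

lemma path_homotopic_const_left: "path_between X a b f \<Longrightarrow> homotopic_paths X ((\<lambda>_. a) +++ f) f"
  by (rule homotopic_paths_const_left) (auto simp: path_between_def)

lemma reversepath_const: "reversepath (\<lambda>_. a) = (\<lambda>_. a)"
  by (simp add: reversepath_def fun_eq_iff)

lemma path_homotopic_const_right:
  assumes "path_between X a b f"
  shows "homotopic_paths X (f +++ (\<lambda>_. b)) f"
proof -
  have "homotopic_paths X ((\<lambda>_. b) +++ reversepath f) (reversepath f)"
    by (rule path_homotopic_const_left[OF path_between_reverse[OF assms]])
  then have "homotopic_paths X (reversepath (reversepath ((\<lambda>_. b) +++ reversepath f))) (reversepath (reversepath (reversepath f)))"
    by (simp only: homotopic_paths_reversepath)
  moreover have "reversepath ((\<lambda>_. b) +++ reversepath f) = f +++ (\<lambda>_. b)"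
    using assms by (subst reversepath_joinpaths)
      (auto simp: path_between_def reversepath_const pathfinish_def pathstart_def reversepath_def)
  ultimately show ?thesis
    by (metis homotopic_paths_reversepath reversepath_reversepath)
qed

lemma path_homotopic_inverse_left:
  "path_between X a b f \<Longrightarrow> homotopic_paths X (reversepath f +++ f) (\<lambda>_. b)"
  using homotopic_paths_reverse_left[of f X] by (auto simp: path_between_def)

lemma path_homotopic_inverse_right:
  "path_between X a b f \<Longrightarrow> homotopic_paths X (f +++ reversepath f) (\<lambda>_. a)"
  using path_homotopic_inverse_left[OF path_between_reverse, of X a b f] by simp

lemma path_homotopic_cancel_left:
  assumes h: "path_between X a b h" and f: "path_between X b c f" and g: "path_between X b c g"
    and "homotopic_paths X (h +++ f) (h +++ g)"
  shows "homotopic_paths X f g"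
proof -
  note r = path_between_reverse[OF h]
  have *: "homotopic_paths X (reversepath h +++ (h +++ u)) u" if u: "path_between X b c u" for u
  proof -
    have "homotopic_paths X (reversepath h +++ (h +++ u)) ((reversepath h +++ h) +++ u)"
      by (rule homotopic_paths_sym[OF path_homotopic_assoc[OF r h u]])
    moreover have "homotopic_paths X ((reversepath h +++ h) +++ u) ((\<lambda>_. b) +++ u)"
      by (rule path_homotopic_join[OF path_homotopic_inverse_left[OF h] path_homotopic_refl[OF u]
            path_between_join[OF r h] u])
    ultimately show ?thesis
      using path_homotopic_const_left[OF u] homotopic_paths_trans by blast
  qed
  have "homotopic_paths X (reversepath h +++ (h +++ f)) (reversepath h +++ (h +++ g))"
    by (rule path_homotopic_join[OF path_homotopic_refl[OF r] assms(4) r path_between_join[OF h f]])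
  then show ?thesis
    using *[OF f] *[OF g] path_homotopic_equiv by blast
qed

lemma path_homotopic_cancel_right:
  assumes f: "path_between X a b f" and g: "path_between X a b g" and h: "path_between X b c h"
    and "homotopic_paths X (f +++ h) (g +++ h)"
  shows "homotopic_paths X f g"
proof -
  have "homotopic_paths X (reversepath (f +++ h)) (reversepath (g +++ h))"
    using assms(4) by (simp only: homotopic_paths_reversepath)
  moreover have "reversepath (f +++ h) = reversepath h +++ reversepath f"
    "reversepath (g +++ h) = reversepath h +++ reversepath g"
    using f g h by (auto simp: path_between_def intro!: reversepath_joinpaths)
  ultimately have "homotopic_paths X (reversepath f) (reversepath g)"
    using path_homotopic_cancel_left[OF path_between_reverse[OF h] path_between_reverse[OF f] path_between_reverse[OF g]]
    by simp
  then show ?thesis by (simp only: homotopic_paths_reversepath)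
qed

lemma homotopic_paths_convex_image:
  fixes p q :: "real \<Rightarrow> real"
  assumes "path p" "path q" "path_image p \<subseteq> S" "path_image q \<subseteq> S" "convex S"
    "pathstart p = pathstart q" "pathfinish p = pathfinish q" "continuous_on S c" "c ` S \<subseteq> X"
  shows "homotopic_paths X (c \<circ> p) (c \<circ> q)"
proof (rule homotopic_paths_continuous_image)
  have "closed_segment (p t) (q t) \<subseteq> S" if "t \<in> {0..1}" for t
  proof (rule closed_segment_subset[OF _ _ assms(5)])
    show "p t \<in> S" "q t \<in> S" using assms(3,4) that by (auto simp: path_image_def)
  qed
  then show "homotopic_paths S p q"
    using assms by (intro homotopic_paths_linear) auto
qed (use assms in auto)

section \<open>Paths along chains\<close>

context geodesic_set
begin

definition geodesic_path :: "'a \<Rightarrow> 'a \<Rightarrow> real \<Rightarrow> 'a" where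
  "geodesic_path x y = (\<lambda>t. (SOME g. geodesic X g x y) (dist x y * t))"

lemma geodesic_path:
  assumes "x \<in> X" "y \<in> X"
  shows "path_between X x y (geodesic_path x y)"
    "path_image (geodesic_path x y) \<subseteq> {z. dist x z \<le> dist x y}"
proof -
  define g where "g = (SOME g. geodesic X g x y)"
  have "\<exists>g. geodesic X g x y" using geodesic_space assms unfolding geodesic_space_def by blast
  then have g: "geodesic X g x y" unfolding g_def by (rule someI_ex)
  have gp: "geodesic_path x y = (\<lambda>t. g (dist x y * t))" by (simp add: geodesic_path_def g_def)
  have sc: "(\<lambda>t. dist x y * t) ` {0..1} \<subseteq> {0..dist x y}" by (auto intro!: mult_left_le)
  have ends: "g 0 = x" "g (dist x y) = y" "g ` {0..dist x y} \<subseteq> X" using g by (auto simp: geodesic_def)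
  have "continuous_on {0..1} (geodesic_path x y)"
    unfolding gp by (rule continuous_on_compose2[OF lip_curve_continuous[OF geodesic_lipschitz[OF g]] _ sc])
      (intro continuous_intros)
  then have path: "path (geodesic_path x y)" by (simp add: path_def)
  have "path_image (geodesic_path x y) = g ` (\<lambda>t. dist x y * t) ` {0..1}"
    by (simp add: path_image_def gp image_image)
  then have img: "path_image (geodesic_path x y) \<subseteq> g ` {0..dist x y}"
    using image_mono[OF sc] by simp
  then have "path_image (geodesic_path x y) \<subseteq> X" using ends(3) by (rule order_trans)
  moreover have "pathstart (geodesic_path x y) = x" "pathfinish (geodesic_path x y) = y"
    using ends by (simp_all add: gp pathstart_def pathfinish_def)
  ultimately show "path_between X x y (geodesic_path x y)"
    using path by (simp add: path_between_def)
  show "path_image (geodesic_path x y) \<subseteq> {z. dist x z \<le> dist x y}"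
  proof
    fix z assume "z \<in> path_image (geodesic_path x y)"
    then have "z \<in> g ` {0..dist x y}" using img by blast
    then obtain s where "0 \<le> s" "s \<le> dist x y" "z = g s" by auto
    then show "z \<in> {z. dist x z \<le> dist x y}"
      using geodesic_isometric[OF g, of 0 s] ends(1) by simp
  qed
qed

fun chain_path :: "'a list \<Rightarrow> real \<Rightarrow> 'a" where
  "chain_path (x # y # xs) = geodesic_path x y +++ chain_path (y # xs)"
| "chain_path xs = (\<lambda>_. hd xs)"

lemma chain_path_between:
  "\<alpha> \<noteq> [] \<Longrightarrow> set \<alpha> \<subseteq> X \<Longrightarrow> path_between X (hd \<alpha>) (last \<alpha>) (chain_path \<alpha>)"
proof (induction \<alpha> rule: chain_path.induct)
  case (1 x y xs)
  then have "path_between X y (last (y # xs)) (chain_path (y # xs))" by simp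
  moreover have "path_between X x y (geodesic_path x y)" using "1.prems" by (intro geodesic_path) auto
  ultimately show ?case using path_between_join by fastforce
qed (auto intro: path_between_const)

lemma chain_path_append:
  "set (us @ a # vs) \<subseteq> X \<Longrightarrow>
    homotopic_paths X (chain_path (us @ a # vs)) (chain_path (us @ [a]) +++ chain_path (a # vs))"
proof (induction us)
  case Nil
  have "path_between X a (last (a # vs)) (chain_path (a # vs))"
    using chain_path_between[of "a # vs"] Nil by simp
  then show ?case using homotopic_paths_sym[OF path_homotopic_const_left] by simp
next
  case (Cons u us)
  obtain w ws where w: "us @ [a] = w # ws" by (cases us) auto
  then have w': "us @ a # vs = w # ws @ vs" by (metis append_Cons append_assoc append_self_conv2)
  have last: "last (w # ws) = a" using w by (metis last_snoc)
  have "set (us @ [a]) \<subseteq> X" and X: "u \<in> X" "set (a # vs) \<subseteq> X" using Cons.prems by auto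
  then have X: "set (w # ws) \<subseteq> X" "u \<in> X" "w \<in> X" "set (a # vs) \<subseteq> X" using w by auto
  have g: "path_between X u w (geodesic_path u w)" by (rule geodesic_path(1)[OF X(2,3)])
  have W: "path_between X w a (chain_path (w # ws))" using chain_path_between[OF _ X(1)] last by simp
  have A: "path_between X a (last (a # vs)) (chain_path (a # vs))" using chain_path_between[OF _ X(4)] by simp
  have IH: "homotopic_paths X (chain_path (w # ws @ vs)) (chain_path (w # ws) +++ chain_path (a # vs))"
    using Cons w w' by simp
  have WA: "path_between X w (last (a # vs)) (chain_path (w # ws @ vs))"
    by (rule path_between_homotopic[OF path_between_join[OF W A] homotopic_paths_sym[OF IH]])
  have "homotopic_paths X (geodesic_path u w +++ chain_path (w # ws @ vs))
      (geodesic_path u w +++ (chain_path (w # ws) +++ chain_path (a # vs)))"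
    by (rule path_homotopic_join[OF path_homotopic_refl[OF g] IH g WA])
  also have "homotopic_paths X \<dots> ((geodesic_path u w +++ chain_path (w # ws)) +++ chain_path (a # vs))"
    by (rule homotopic_paths_sym[OF path_homotopic_assoc[OF g W A]])
  finally show ?case by (simp add: w w')
qed

lemma chain_path_concat:
  assumes "\<alpha> \<noteq> []" "\<beta> \<noteq> []" "last \<alpha> = hd \<beta>" "set \<alpha> \<subseteq> X" "set \<beta> \<subseteq> X"
  shows "homotopic_paths X (chain_path (\<alpha> @@ \<beta>)) (chain_path \<alpha> +++ chain_path \<beta>)"
proof -
  obtain us z where "\<alpha> = us @ [z]" using assms(1) by (metis append_butlast_last_id)
  moreover obtain w vs where "\<beta> = w # vs" using assms(2) by (cases \<beta>) auto
  ultimately show ?thesis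
    using assms(3-) chain_path_append[of us w vs] by (simp add: chain_concat_def)
qed

end

section \<open>Small balls\<close>

text \<open>The radius is twice the scale because a geodesic of length below
  \<open>\<epsilon>\<close> that starts within \<open>\<epsilon>\<close> of \<open>y\<close> stays
  in \<open>ball y (2 * \<epsilon>)\<close>. The loops may have any base point in the ball and
  contract in \<open>X\<close>, not necessarily in the ball.\<close>

locale locally_null_set = geodesic_set +
  fixes \<epsilon> :: real
  assumes eps_pos: "0 < \<epsilon>"
    and null: "\<And>y f. y \<in> X \<Longrightarrow> path f \<Longrightarrow> path_image f \<subseteq> X \<inter> ball y (2 * \<epsilon>) \<Longrightarrow> pathfinish f = pathstart f \<Longrightarrow>
      homotopic_paths X f (\<lambda>_. pathstart f)"
begin

lemma homotopic_in_ball: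
  assumes "y \<in> X" and f: "path_between (X \<inter> ball y (2 * \<epsilon>)) a b f" and g: "path_between (X \<inter> ball y (2 * \<epsilon>)) a b g"
  shows "homotopic_paths X f g"
proof -
  note f' = path_between_mono[OF f, of X] and g' = path_between_mono[OF g, of X]
  have "path_between (X \<inter> ball y (2 * \<epsilon>)) a a (f +++ reversepath g)"
    by (rule path_between_join[OF f path_between_reverse[OF g]])
  then have "homotopic_paths X (f +++ reversepath g) (\<lambda>_. a)"
    using null[OF assms(1), of "f +++ reversepath g"] unfolding path_between_def by metis
  moreover have "homotopic_paths X (g +++ reversepath g) (\<lambda>_. a)"
    using g' by (intro path_homotopic_inverse_right) auto
  ultimately have "homotopic_paths X (f +++ reversepath g) (g +++ reversepath g)"
    using path_homotopic_equiv by blast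
  with f' g' show ?thesis
    using path_homotopic_cancel_right[of X a b f g a "reversepath g"] path_between_reverse by auto
qed

lemma geodesic_path_in_ball:
  assumes "x \<in> X" "y \<in> X" "dist x y < \<epsilon>" "dist z x < \<epsilon>"
  shows "path_between (X \<inter> ball z (2 * \<epsilon>)) x y (geodesic_path x y)"
proof -
  note g = geodesic_path[OF assms(1,2)]
  have "dist z w < 2 * \<epsilon>" if "dist x w \<le> dist x y" for w
    using dist_triangle[of z w x] that assms by linarith
  with g show ?thesis by (auto simp: path_between_def)
qed

lemma geodesic_path_same: "x \<in> X \<Longrightarrow> homotopic_paths X (geodesic_path x x) (\<lambda>_. x)"
  using eps_pos by (intro homotopic_in_ball[of x x x] geodesic_path_in_ball path_between_const) auto

text \<open>As for filled chains, a point added at an end only contributes a null path from that end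
  to itself. In the interior the geodesic triangle with corners \<open>y\<close>, \<open>x\<close>,
  \<open>z\<close> lies in the ball of radius \<open>2 * \<epsilon>\<close> about
  \<open>y\<close>.\<close>

lemma chain_path_step:
  assumes \<alpha>: "joins X \<epsilon> a b \<alpha>" and \<beta>: "joins X \<epsilon> a b \<beta>" and "adds_point \<alpha> \<beta>"
  shows "homotopic_paths X (chain_path \<alpha>) (chain_path \<beta>)"
proof -
  obtain us x vs where uv: "\<alpha> = us @ vs" "\<beta> = us @ x # vs"
    using \<open>adds_point \<alpha> \<beta>\<close> by (auto simp: adds_point_def)
  have X: "set us \<subseteq> X" "x \<in> X" "set vs \<subseteq> X" "us @ vs \<noteq> []" "set \<beta> \<subseteq> X"
    using joinsD(2)[OF \<alpha>] joinsD(5)[OF \<beta>] uv by auto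
  have P\<alpha>: "path_between X a b (chain_path \<alpha>)"
    using chain_path_between[OF joinsD(2,5)[OF \<alpha>]] joinsD(3,4)[OF \<alpha>] by simp
  consider "us = []" | "us \<noteq> []" "vs = []" | y us' z vs' where "us = us' @ [y]" "vs = z # vs'"
    by (metis append_butlast_last_id list.exhaust)
  then show ?thesis
  proof cases
    case 1
    then have "x = a" "hd vs = a" "vs \<noteq> []" using joinsD(3)[OF \<alpha>] joinsD(3)[OF \<beta>] X uv by auto
    then obtain vs' where vs: "vs = a # vs'" by (cases vs) auto
    have "homotopic_paths X (geodesic_path a a +++ chain_path \<alpha>) ((\<lambda>_. a) +++ chain_path \<alpha>)"
      using X \<open>x = a\<close> by (intro path_homotopic_join[OF geodesic_path_same path_homotopic_refl[OF P\<alpha>] geodesic_path(1) P\<alpha>]) auto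
    then have "homotopic_paths X (geodesic_path a a +++ chain_path \<alpha>) (chain_path \<alpha>)"
      using path_homotopic_const_left[OF P\<alpha>] homotopic_paths_trans by blast
    then show ?thesis using 1 vs uv \<open>x = a\<close> homotopic_paths_sym by simp
  next
    case 2
    then have b: "x = b" "last us = b" using joinsD(4)[OF \<alpha>] joinsD(4)[OF \<beta>] uv by auto
    then obtain us' where us: "us = us' @ [b]" using 2 by (metis append_butlast_last_id)
    have bX: "b \<in> X" using X b by simp
    note c = path_between_const[OF bX] and g = geodesic_path(1)[OF bX bX]
    have "homotopic_paths X (geodesic_path b b +++ (\<lambda>_. b)) (\<lambda>_. b)"
      using path_homotopic_const_right[OF g] geodesic_path_same[OF bX] homotopic_paths_trans by blast
    then have "homotopic_paths X (chain_path \<alpha> +++ (geodesic_path b b +++ (\<lambda>_. b))) (chain_path \<alpha> +++ (\<lambda>_. b))"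
      by (rule path_homotopic_join[OF path_homotopic_refl[OF P\<alpha>] _ P\<alpha> path_between_join[OF g c]])
    then have "homotopic_paths X (chain_path \<alpha> +++ chain_path [b, b]) (chain_path \<alpha>)"
      using path_homotopic_const_right[OF P\<alpha>] homotopic_paths_trans by fastforce
    moreover have "homotopic_paths X (chain_path \<beta>) (chain_path \<alpha> +++ chain_path [b, b])"
      using chain_path_append[of us' b "[b]"] uv us 2 X b by simp
    ultimately show ?thesis using path_homotopic_equiv by blast
  next
    case 3
    have d: "dist y z < \<epsilon>" "dist y x < \<epsilon>" "dist x z < \<epsilon>"
      using joinsD(1)[OF \<alpha>] joinsD(1)[OF \<beta>] 3 uv
      by (auto simp: eps_chain_def successively_append_iff)
    have X': "y \<in> X" "x \<in> X" "z \<in> X" "set (z # vs') \<subseteq> X" "set (us' @ [y]) \<subseteq> X" using 3 X by auto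
    let ?A = "chain_path (us' @ [y])" and ?B = "chain_path (z # vs')"
    have A: "path_between X (hd (us' @ [y])) y ?A" using chain_path_between[OF _ X'(5)] by simp
    have B: "path_between X z (last (z # vs')) ?B" using chain_path_between[OF _ X'(4)] by simp
    note g = geodesic_path(1)[OF X'(1,3)] geodesic_path(1)[OF X'(1,2)] geodesic_path(1)[OF X'(2,3)]
    have "homotopic_paths X (geodesic_path y x +++ geodesic_path x z) (geodesic_path y z)"
    proof (rule homotopic_in_ball[OF X'(1)])
      show "path_between (X \<inter> ball y (2 * \<epsilon>)) y z (geodesic_path y x +++ geodesic_path x z)"
        using d X' eps_pos by (intro path_between_join[of _ _ x] geodesic_path_in_ball) auto
      show "path_between (X \<inter> ball y (2 * \<epsilon>)) y z (geodesic_path y z)"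
        using d X' eps_pos by (intro geodesic_path_in_ball) auto
    qed
    then have "homotopic_paths X ((geodesic_path y x +++ geodesic_path x z) +++ ?B) (geodesic_path y z +++ ?B)"
      by (rule path_homotopic_join[OF _ path_homotopic_refl[OF B] path_between_join[OF g(2,3)] B])
    then have "homotopic_paths X (geodesic_path y x +++ (geodesic_path x z +++ ?B)) (geodesic_path y z +++ ?B)"
      using path_homotopic_assoc[OF g(2,3) B] path_homotopic_equiv by blast
    then have "homotopic_paths X (?A +++ (geodesic_path y x +++ (geodesic_path x z +++ ?B))) (?A +++ (geodesic_path y z +++ ?B))"
      by (rule path_homotopic_join[OF path_homotopic_refl[OF A] _ A path_between_join[OF g(2) path_between_join[OF g(3) B]]])
    moreover have "homotopic_paths X (chain_path \<beta>) (?A +++ (geodesic_path y x +++ (geodesic_path x z +++ ?B)))"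
      using chain_path_append[of us' y "x # z # vs'"] 3 uv X by simp
    moreover have "homotopic_paths X (chain_path \<alpha>) (?A +++ (geodesic_path y z +++ ?B))"
      using chain_path_append[of us' y "z # vs'"] 3 uv X by simp
    ultimately show ?thesis using path_homotopic_equiv by blast
  qed
qed

lemma chain_path_homotopic:
  assumes "eps_homotopic X \<epsilon> \<alpha> \<beta>"
  shows "homotopic_paths X (chain_path \<alpha>) (chain_path \<beta>)"
proof -
  have \<alpha>: "joins X \<epsilon> (hd \<alpha>) (last \<alpha>) \<alpha>"
    using eps_homotopic_ends[OF assms] by (simp add: joins_def)
  have "(eps_step X \<epsilon>)\<^sup>*\<^sup>* \<alpha> \<beta>" using assms by (simp add: eps_homotopic_def)
  then have "joins X \<epsilon> (hd \<alpha>) (last \<alpha>) \<beta> \<and> homotopic_paths X (chain_path \<alpha>) (chain_path \<beta>)"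
  proof (induction rule: rtranclp_induct)
    case base
    then show ?case
      using \<alpha> path_homotopic_refl[OF chain_path_between[OF joinsD(2,5)[OF \<alpha>]]] by simp
  next
    case (step \<beta> \<gamma>)
    have \<gamma>: "joins X \<epsilon> (hd \<alpha>) (last \<alpha>) \<gamma>"
      using step by (auto simp: eps_step_def joins_def)
    have "adds_point \<beta> \<gamma> \<or> adds_point \<gamma> \<beta>" using step.hyps(2) by (auto simp: eps_step_def)
    then have "homotopic_paths X (chain_path \<beta>) (chain_path \<gamma>)"
      using chain_path_step[of _ _ \<beta> \<gamma>] chain_path_step[of _ _ \<gamma> \<beta>] step.IH \<gamma> homotopic_paths_sym by blast
    then show ?case using step.IH \<gamma> homotopic_paths_trans by blast
  qed
  then show ?thesis by blast
qed

text \<open>Over one interval of the subdivision the arc and the geodesic with the same ends both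
  stay in a small ball about their starting point, so they can be exchanged by
  \<open>homotopic_in_ball\<close>.\<close>

lemma curve_homotopic_chain_path:
  assumes "continuous_on {a..b} c" "modulus X \<eta> \<epsilon> c a b" "subdivision \<eta> a b ts"
  shows "homotopic_paths X (c \<circ> linepath a b) (chain_path (map c ts))"
  using assms
proof (induction ts arbitrary: a rule: induct_list012)
  case 1
  then show ?case by (simp add: subdivision_def)
next
  case (2 t)
  then have "a = t" "b = t" "c t \<in> X" by (auto simp: subdivision_def modulus_def)
  then show ?case
    using path_homotopic_refl[OF path_between_const[of "c t" X]] by (simp add: linepath_refl comp_def)
next
  case (3 s t ts)
  have s: "s = a" "a \<le> t" "t - a < \<eta>" and sub: "subdivision \<eta> t b (t # ts)"
    using "3.prems"(3) by (auto simp: subdivision_def)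
  have tb: "t \<le> b" using subdivision_ends[OF sub] by simp
  have cont: "continuous_on {a..t} c" "continuous_on {t..b} c"
    using "3.prems"(1) s tb by (auto elim: continuous_on_subset)
  have m: "modulus X \<eta> \<epsilon> c t b" using "3.prems"(2) s by (auto simp: modulus_def)
  have cX: "c ` {a..b} \<subseteq> X" using "3.prems"(2) by (simp add: modulus_def)
  have X: "c a \<in> X" "c t \<in> X" using cX s tb by auto
  have IH: "homotopic_paths X (c \<circ> linepath t b) (chain_path (map c (t # ts)))"
    by (rule "3.IH"(2)[OF cont(2) m sub])
  have near: "dist (c a) (c u) < \<epsilon>" if "u \<in> {a..t}" for u
    using "3.prems"(2) that s tb unfolding modulus_def by auto
  have lp: "path_between X (c u) (c v) (c \<circ> linepath u v)" if "a \<le> u" "u \<le> v" "v \<le> b" for u v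
  proof -
    have "continuous_on (closed_segment u v) c"
      using "3.prems"(1) that by (auto simp: closed_segment_eq_real_ivl elim: continuous_on_subset)
    then have "path (c \<circ> linepath u v)" by (intro path_continuous_image) auto
    moreover have "path_image (c \<circ> linepath u v) \<subseteq> X"
      using cX that by (auto simp: path_image_compose closed_segment_eq_real_ivl)
    ultimately show ?thesis by (simp add: path_between_def pathstart_compose pathfinish_compose)
  qed
  have "homotopic_paths X (c \<circ> linepath a b) (c \<circ> (linepath a t +++ linepath t b))"
    using "3.prems"(1) cX s tb
    by (intro homotopic_paths_convex_image[of _ _ "{a..b}"])
      (auto simp: path_image_join closed_segment_eq_real_ivl)
  then have 1: "homotopic_paths X (c \<circ> linepath a b) ((c \<circ> linepath a t) +++ (c \<circ> linepath t b))"
    by (simp add: path_compose_join)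
  have "path_between (X \<inter> ball (c a) (2 * \<epsilon>)) (c a) (c t) (c \<circ> linepath a t)"
    using lp[of a t] s tb near eps_pos
    by (force simp: path_between_def path_image_compose closed_segment_eq_real_ivl)
  moreover have "path_between (X \<inter> ball (c a) (2 * \<epsilon>)) (c a) (c t) (geodesic_path (c a) (c t))"
    using near[of t] s eps_pos by (intro geodesic_path_in_ball X) auto
  ultimately have "homotopic_paths X (c \<circ> linepath a t) (geodesic_path (c a) (c t))"
    by (rule homotopic_in_ball[OF X(1)])
  then have "homotopic_paths X ((c \<circ> linepath a t) +++ (c \<circ> linepath t b))
      (geodesic_path (c a) (c t) +++ chain_path (map c (t # ts)))"
    by (rule path_homotopic_join[OF _ IH]) (use lp s tb in auto)
  from homotopic_paths_trans[OF 1 this] show ?case unfolding list.map chain_path.simps s(1) .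
qed

text \<open>The geodesics from \<open>x\<close> to \<open>y\<close> and from \<open>y\<close> to
  \<open>x\<close> are chosen independently, so the two paths may differ. Both are inverse to
  \<open>chain_path k\<close> up to homotopy, and inverses agree.\<close>

lemma chain_path_rev:
  assumes k: "joins X \<epsilon> a b k"
  shows "homotopic_paths X (chain_path (rev k)) (reversepath (chain_path k))"
proof -
  note r = joins_rev[OF k]
  have P: "path_between X u v (chain_path \<kappa>)" if "joins X \<epsilon> u v \<kappa>" for u v \<kappa>
    using chain_path_between[OF joinsD(2,5)[OF that]] joinsD(3,4)[OF that] by simp
  have "homotopic_paths X (chain_path k +++ chain_path (rev k)) (chain_path (k @@ rev k))"
    using joinsD[OF k] by (intro homotopic_paths_sym[OF chain_path_concat]) (auto simp: hd_rev)
  also have "homotopic_paths X \<dots> (chain_path [a])"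
    by (rule chain_path_homotopic[OF concat_rev_null(1)[OF k eps_pos]])
  also have "homotopic_paths X (chain_path [a]) (chain_path k +++ reversepath (chain_path k))"
    using homotopic_paths_sym[OF path_homotopic_inverse_right[OF P[OF k]]] by simp
  finally show ?thesis
    by (rule path_homotopic_cancel_left[OF P[OF k] P[OF r] path_between_reverse[OF P[OF k]]])
qed

end

text \<open>The hypothesis concerns only loops based at the chosen point, in a neighbourhood that
  depends on it. A Lebesgue number \<open>e\<close> makes the size uniform, and \<open>e / 2\<close>
  fits the balls of radius \<open>2 * \<epsilon>\<close> of the locale. A loop based at another
  point \<open>z\<close> of \<open>ball x \<rho>\<close> is conjugated to \<open>x\<close> along a
  geodesic, which stays in that ball as its distance from \<open>x\<close> never exceeds
  \<open>dist x z\<close>.\<close>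

lemma locally_null_exists:
  assumes "compact X" "geodesic_space X" "semilocally_simply_connected X"
  obtains \<epsilon> where "locally_null_set X \<epsilon>"
proof -
  interpret geodesic_set X by unfold_locales (rule assms(2))
  define good where "good x \<rho> \<longleftrightarrow> 0 < \<rho> \<and> (\<forall>f. path f \<and> path_image f \<subseteq> X \<inter> ball x \<rho> \<and> pathstart f = x \<and> pathfinish f = x \<longrightarrow>
    homotopic_paths X f (\<lambda>_. x))" for x \<rho>
  have ex: "\<exists>\<rho>. good x \<rho>" if "x \<in> X" for x
  proof -
    obtain U where U: "openin (top_of_set X) U" "x \<in> U" "\<And>f. path f \<and> path_image f \<subseteq> U \<and> pathstart f = x \<and> pathfinish f = x \<Longrightarrow>
        homotopic_paths X f (\<lambda>_. x)"
      using assms(3) \<open>x \<in> X\<close> unfolding semilocally_simply_connected_def by meson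
    obtain \<rho> where "0 < \<rho>" "ball x \<rho> \<inter> X \<subseteq> U" using U(1,2) openin_contains_ball by metis
    then have "good x \<rho>" unfolding good_def using U(3) by (metis inf_commute order_trans)
    then show ?thesis by blast
  qed
  define \<G> where "\<G> = {ball x \<rho> |x \<rho>. x \<in> X \<and> good x \<rho>}"
  have "X \<subseteq> \<Union>\<G>"
  proof
    fix x assume x: "x \<in> X"
    then obtain \<rho> where \<rho>: "good x \<rho>" using ex by blast
    then have "x \<in> ball x \<rho>" by (simp add: good_def)
    with x \<rho> show "x \<in> \<Union>\<G>" unfolding \<G>_def by blast
  qed
  moreover have "\<And>G. G \<in> \<G> \<Longrightarrow> open G" by (auto simp: \<G>_def)
  ultimately obtain e where e: "0 < e" "\<And>x. x \<in> X \<Longrightarrow> \<exists>G\<in>\<G>. ball x e \<subseteq> G"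
    using Heine_Borel_lemma[OF assms(1), of \<G>] by blast
  have "locally_null_set X (e / 2)"
  proof unfold_locales
    show "0 < e / 2" using e by simp
    fix y f assume y: "y \<in> X" and f: "path f" "path_image f \<subseteq> X \<inter> ball y (2 * (e / 2))" "pathfinish f = pathstart f"
    define z where "z = pathstart f"
    obtain x \<rho> where x: "x \<in> X" "good x \<rho>" "ball y e \<subseteq> ball x \<rho>" using e(2)[OF y] by (auto simp: \<G>_def)
    have f': "path_between (X \<inter> ball x \<rho>) z z f" using f x by (auto simp: path_between_def z_def)
    have zX: "z \<in> X" "dist x z < \<rho>" using path_between_mem[OF f'] by auto
    let ?g = "geodesic_path x z"
    have g: "path_between (X \<inter> ball x \<rho>) x z ?g"
      using geodesic_path[OF x(1) zX(1)] zX(2) by (force simp: path_between_def)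
    have "path_between (X \<inter> ball x \<rho>) x x (?g +++ (f +++ reversepath ?g))"
      by (intro path_between_join[OF g] path_between_join[OF f'] path_between_reverse[OF g])
    then have 1: "homotopic_paths X (?g +++ (f +++ reversepath ?g)) (\<lambda>_. x)"
      using x(2) unfolding good_def path_between_def by blast
    note fX = path_between_mono[OF f' Int_lower1] and gX = path_between_mono[OF g Int_lower1]
    note r = path_between_reverse[OF gX]
    have "homotopic_paths X (?g +++ (f +++ reversepath ?g)) (?g +++ reversepath ?g)"
      using 1 path_homotopic_inverse_right[OF gX] path_homotopic_equiv by blast
    then have "homotopic_paths X (f +++ reversepath ?g) (reversepath ?g)"
      by (rule path_homotopic_cancel_left[OF gX path_between_join[OF fX r] r])
    then have "homotopic_paths X (f +++ reversepath ?g) ((\<lambda>_. z) +++ reversepath ?g)"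
      using path_homotopic_const_left[OF r] path_homotopic_equiv by blast
    then show "homotopic_paths X f (\<lambda>_. pathstart f)"
      using path_homotopic_cancel_right[OF fX path_between_const[OF zX(1)] r] by (simp add: z_def)
  qed
  then show thesis by (rule that)
qed

section \<open>Shortest curves in a class of chains\<close>

lemma compact_finite_subsequence:
  fixes y :: "nat \<Rightarrow> nat \<Rightarrow> 'a::metric_space"
  assumes "compact X" "\<And>j i. i < n \<Longrightarrow> y j i \<in> X"
  shows "\<exists>r l. strict_mono (r :: nat \<Rightarrow> nat) \<and> (\<forall>i<n. l i \<in> X \<and> (\<lambda>j. y (r j) i) \<longlonglongrightarrow> l i)"
  using assms(2)
proof (induction n)
  case 0
  then show ?case using strict_mono_id by auto
next
  case (Suc n)
  then obtain r l where r: "strict_mono (r :: nat \<Rightarrow> nat)" "\<And>i. i < n \<Longrightarrow> l i \<in> X \<and> (\<lambda>j. y (r j) i) \<longlonglongrightarrow> l i"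
    by (meson less_SucI)
  have "\<forall>j. y (r j) n \<in> X" using Suc.prems by simp
  then obtain z s where s: "z \<in> X" "strict_mono (s :: nat \<Rightarrow> nat)" "((\<lambda>j. y (r j) n) \<circ> s) \<longlonglongrightarrow> z"
    using assms(1) unfolding compact_def by meson
  have "(l(n := z)) i \<in> X \<and> (\<lambda>j. y ((r \<circ> s) j) i) \<longlonglongrightarrow> (l(n := z)) i" if "i < Suc n" for i
  proof (cases "i = n")
    case False
    then have i: "l i \<in> X" "(\<lambda>j. y (r j) i) \<longlonglongrightarrow> l i" using r(2) that by auto
    then show ?thesis using LIMSEQ_subseq_LIMSEQ[OF i(2) s(2)] False by (simp add: comp_def)
  qed (use s in \<open>simp add: comp_def\<close>)
  then show ?case using strict_mono_o[OF r(1) s(2)] by blast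
qed

lemma len_map_upt:
  "len (map y [0..<Suc n]) = (\<Sum>i<n. dist (y i) (y (Suc i)))"
proof -
  have "dist (map y [0..<Suc n] ! i) (map y [0..<Suc n] ! Suc i) = dist (y i) (y (Suc i))" if "i < n" for i
  proof -
    have "map y [0..<Suc n] ! i = y i" "map y [0..<Suc n] ! Suc i = y (Suc i)"
      using that by (simp_all del: upt_Suc)
    then show ?thesis by simp
  qed
  then show ?thesis
    unfolding len_eq_sum by (intro sum.cong) (simp_all del: upt_Suc)
qed

context geodesic_set
begin

text \<open>Resampling at equal times fixes the number of points, so that a sequence of chains can
  converge pointwise.\<close>

lemma even_subdivision:
  assumes "joins X \<epsilon> a b \<kappa>" "0 < \<epsilon>" "0 < n" "len \<kappa> < real n * \<eta>" "\<eta> \<le> \<epsilon>"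
  obtains y :: "nat \<Rightarrow> 'a" where "\<And>i. i \<le> n \<Longrightarrow> y i \<in> X" "y 0 = a" "y n = b"
    "successively (\<lambda>i j. dist (y i) (y j) < \<eta>) [0..<Suc n]"
    "eps_homotopic X \<epsilon> \<kappa> (map y [0..<Suc n])" "len (map y [0..<Suc n]) \<le> len \<kappa>"
proof -
  define l where "l = len \<kappa>"
  have l: "0 \<le> l" "l / real n < \<eta>" using assms len_nonneg[of \<kappa>] by (auto simp: l_def field_simps)
  obtain c ts where c: "lip_curve X c 0 l" "subdivision \<epsilon> 0 l ts" "map c ts = \<kappa>"
    using chain_curve_subdivision[OF geodesic_space joinsD(1)[OF assms(1)] assms(2)] unfolding l_def by blast
  define t where "t i = l * real i / real n" for i :: nat
  have mono: "t i \<le> t j" if "i \<le> j" for i j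
    unfolding t_def using that l assms(3) by (intro divide_right_mono mult_left_mono) auto
  have gap: "t (Suc i) - t i < \<eta>" for i
    using l assms(3) by (simp add: t_def field_simps)
  define us where "us = map t [0..<Suc n]"
  have us: "us \<noteq> []" "sorted us" "hd us = 0" "last us = l"
    using assms(3) mono by (auto simp: us_def t_def sorted_map sorted_wrt_iff_nth_less hd_map simp del: upt_Suc)
      (simp_all add: t_def)
  have "0 < \<eta>" using l assms(3) by (meson divide_nonneg_nonneg le_less_trans of_nat_0_le_iff)
  have "successively (\<lambda>s t. t - s < \<eta>) us"
    unfolding us_def successively_map using gap by (simp add: successively_conv_nth del: upt_Suc)
  then have sub: "subdivision \<eta> 0 l us" using us \<open>0 < \<eta>\<close> by (simp add: subdivision_def)
  have "ts \<noteq> []" "hd ts = 0" "last ts = l"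
    using c(2) by (auto simp: subdivision_def)
  then have ends: "c 0 = a" "c l = b"
    using c(3) joinsD(3,4)[OF assms(1)] by (auto simp: hd_map last_map)
  note cu = joins_map[OF lip_curve_modulus[OF c(1)] sub]
  have map: "map (\<lambda>i. c (t i)) [0..<Suc n] = map c us" by (simp add: us_def comp_def)
  show thesis
  proof (rule that[of "\<lambda>i. c (t i)"])
    show "c (t i) \<in> X" if "i \<le> n" for i
    proof -
      have "c (t i) \<in> set (map c us)" using that by (simp add: us_def less_Suc_eq_le del: upt_Suc)
      then show ?thesis using joinsD(5)[OF cu] by blast
    qed
    show "c (t 0) = a" "c (t n) = b" using ends assms(3) by (simp_all add: t_def)
    show "successively (\<lambda>i j. dist (c (t i)) (c (t j)) < \<eta>) [0..<Suc n]"
      using joinsD(1)[OF cu] by (simp add: eps_chain_def us_def successively_map del: upt_Suc)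
    show "eps_homotopic X \<epsilon> \<kappa> (map (\<lambda>i. c (t i)) [0..<Suc n])"
      unfolding map c(3)[symmetric]
      by (rule map_homotopic_subdivisions[OF lip_curve_modulus[OF c(1)] c(2) subdivision_mono[OF sub assms(5)]])
    show "len (map (\<lambda>i. c (t i)) [0..<Suc n]) \<le> len \<kappa>"
      unfolding map using len_lipschitz_le[OF c(1) us(1,2) subdivision_bounds[OF sub]] us
      by (simp add: l_def)
  qed
qed

text \<open>A minimizing sequence, resampled with a common number of points, has a pointwise
  convergent subsequence. The limit is within \<open>\<epsilon> / 4\<close> of some member and has
  the same ends, so it is in the same class, and \<open>len\<close> passes to the limit.\<close>

lemma shortest_chain:
  assumes "compact X" "0 < \<epsilon>" "joins X \<epsilon> a b k"
  obtains \<kappa> where "eps_homotopic X \<epsilon> k \<kappa>" "\<And>\<kappa>'. eps_homotopic X \<epsilon> k \<kappa>' \<Longrightarrow> len \<kappa> \<le> len \<kappa>'"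
proof -
  define S where "S = len ` {\<kappa>. eps_homotopic X \<epsilon> k \<kappa>}"
  define L where "L = Inf S"
  have kk: "eps_homotopic X \<epsilon> k k" by (rule eps_homotopic_refl[OF joinsD(1)[OF assms(3)]])
  have ne: "S \<noteq> {}" using kk by (auto simp: S_def)
  have bdd: "bdd_below S" by (auto simp: S_def bdd_below_def intro: len_nonneg)
  have low: "L \<le> len \<kappa>" if "eps_homotopic X \<epsilon> k \<kappa>" for \<kappa>
    unfolding L_def using that bdd by (intro cInf_lower) (auto simp: S_def)
  obtain n where n: "(L + 1) / (\<epsilon> / 4) < real n" using reals_Archimedean2 by blast
  have "0 \<le> L" unfolding L_def by (rule cInf_greatest[OF ne]) (auto simp: S_def len_nonneg)
  \<comment> \<open>All chains of the minimizing sequence are shorter than \<open>L + 1\<close>,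
    since \<open>inverse (real (Suc j)) \<le> 1\<close>. So one \<open>n\<close> gives steps below
    \<open>\<epsilon> / 4\<close> for all of them.\<close>
  have n': "L + 1 < real n * (\<epsilon> / 4)" using n assms(2) by (simp add: field_simps)
  have "0 < n" using n' \<open>0 \<le> L\<close> by (cases n) auto
  have "\<exists>y. (\<forall>i\<le>n. y i \<in> X) \<and> y 0 = a \<and> y n = b \<and> successively (\<lambda>i j. dist (y i) (y j) < \<epsilon> / 4) [0..<Suc n] \<and>
    eps_homotopic X \<epsilon> k (map y [0..<Suc n]) \<and> len (map y [0..<Suc n]) \<le> L + inverse (real (Suc j))" for j
  proof -
    have inv: "inverse (real (Suc j)) > 0" "inverse (real (Suc j)) \<le> 1" by (simp_all add: field_simps)
    then have "Inf S < L + inverse (real (Suc j))" by (simp add: L_def)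
    then obtain \<kappa> where \<kappa>: "eps_homotopic X \<epsilon> k \<kappa>" "len \<kappa> < L + inverse (real (Suc j))"
      using cInf_lessD[OF ne] by (auto simp: S_def)
    have "len \<kappa> < real n * (\<epsilon> / 4)" using \<kappa>(2) inv n' by linarith
    from even_subdivision[OF joins_homotopic[OF assms(3) \<kappa>(1)] assms(2) \<open>0 < n\<close> this]
    obtain y where "\<And>i. i \<le> n \<Longrightarrow> y i \<in> X" "y 0 = a" "y n = b"
      "successively (\<lambda>i j. dist (y i) (y j) < \<epsilon> / 4) [0..<Suc n]"
      "eps_homotopic X \<epsilon> \<kappa> (map y [0..<Suc n])" "len (map y [0..<Suc n]) \<le> len \<kappa>"
      using assms(2) by auto
    then show ?thesis using \<kappa> eps_homotopic_trans by (intro exI[of _ y]) (auto simp del: upt_Suc)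
  qed
  then obtain Y where Y: "\<And>j i. i \<le> n \<Longrightarrow> Y j i \<in> X" "\<And>j. Y j 0 = a" "\<And>j. Y j n = b"
    "\<And>j. successively (\<lambda>i i'. dist (Y j i) (Y j i') < \<epsilon> / 4) [0..<Suc n]"
    "\<And>j. eps_homotopic X \<epsilon> k (map (Y j) [0..<Suc n])"
    "\<And>j. len (map (Y j) [0..<Suc n]) \<le> L + inverse (real (Suc j))"
    by metis
  obtain r l where r: "strict_mono (r :: nat \<Rightarrow> nat)" "\<And>i. i \<le> n \<Longrightarrow> l i \<in> X \<and> (\<lambda>j. Y (r j) i) \<longlonglongrightarrow> l i"
    using compact_finite_subsequence[OF assms(1), of "Suc n" Y] Y(1) by (auto simp: less_Suc_eq_le)
  have "(\<lambda>j. a) \<longlonglongrightarrow> l 0" "(\<lambda>j. b) \<longlonglongrightarrow> l n" using r(2)[of 0] r(2)[of n] Y(2,3) by auto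
  then have l: "l 0 = a" "l n = b" by (simp_all add: LIMSEQ_const_iff)
  have "\<forall>\<^sub>F j in sequentially. dist (Y (r j) i) (l i) < \<epsilon> / 4" if "i \<in> {..n}" for i
    using r(2)[of i] that assms(2) tendstoD[of "\<lambda>j. Y (r j) i" "l i" sequentially "\<epsilon> / 4"] by simp
  then have "\<forall>\<^sub>F j in sequentially. \<forall>i\<in>{..n}. dist (Y (r j) i) (l i) < \<epsilon> / 4"
    by (intro eventually_ball_finite) auto
  then obtain j where j: "\<And>i. i \<le> n \<Longrightarrow> dist (Y (r j) i) (l i) < \<epsilon> / 4"
    by (auto simp: eventually_sequentially)
  have upt: "[0..<Suc n] \<noteq> []" "hd [0..<Suc n] = 0" "last [0..<Suc n] = n"
    by (simp_all add: hd_upt last_upt del: upt_Suc)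
  have "eps_homotopic X \<epsilon> (map (Y (r j)) [0..<Suc n]) (map l [0..<Suc n])"
  proof (rule close_chains_homotopic[OF assms(2) upt(1) _ Y(4)])
    show "Y (r j) i \<in> X \<and> l i \<in> X \<and> dist (l i) (Y (r j) i) < \<epsilon> / 4" if "i \<in> set [0..<Suc n]" for i
      using that Y(1) r(2) j by (auto simp: dist_commute)
  qed (use l Y(2,3) in \<open>simp_all only: upt\<close>)
  then have kl: "eps_homotopic X \<epsilon> k (map l [0..<Suc n])" using Y(5) eps_homotopic_trans by blast
  have "(\<lambda>j. len (map (Y (r j)) [0..<Suc n])) \<longlonglongrightarrow> len (map l [0..<Suc n])"
    unfolding len_map_upt using r(2) by (intro tendsto_sum tendsto_dist) auto
  moreover have "(\<lambda>j. L + inverse (real (Suc j))) \<longlonglongrightarrow> L" by (rule LIMSEQ_inverse_real_of_nat_add)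
  moreover have "len (map (Y (r j)) [0..<Suc n]) \<le> L + inverse (real (Suc j))" for j
  proof -
    have "inverse (real (Suc (r j))) \<le> inverse (real (Suc j))"
      using seq_suble[OF r(1), of j] by (intro le_imp_inverse_le) auto
    then show ?thesis using Y(6)[of "r j"] by linarith
  qed
  ultimately have "len (map l [0..<Suc n]) \<le> L"
    by (intro LIMSEQ_le) (auto simp del: upt_Suc)
  then show thesis using that[OF kl] low order_trans by blast
qed

lemma shortest_curve:
  assumes "compact X" "0 < \<epsilon>" "joins X \<epsilon> a b k"
  obtains L q us where "0 \<le> L" "lip_curve X q 0 L" "q 0 = a" "q L = b" "subdivision \<epsilon> 0 L us"
    "eps_homotopic X \<epsilon> k (map q us)"
    "\<And>s t. 0 \<le> s \<Longrightarrow> s \<le> t \<Longrightarrow> t \<le> L \<Longrightarrow> t - s < \<epsilon> \<Longrightarrow> dist (q s) (q t) = t - s"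
proof -
  obtain \<kappa> where \<kappa>: "eps_homotopic X \<epsilon> k \<kappa>" "\<And>\<kappa>'. eps_homotopic X \<epsilon> k \<kappa>' \<Longrightarrow> len \<kappa> \<le> len \<kappa>'"
    using shortest_chain[OF assms] by blast
  note \<kappa>b = joins_homotopic[OF assms(3) \<kappa>(1)]
  define L where "L = len \<kappa>"
  obtain q us where q: "lip_curve X q 0 L" "subdivision \<epsilon> 0 L us" "map q us = \<kappa>"
    using chain_curve_subdivision[OF geodesic_space joinsD(1)[OF \<kappa>b] assms(2)] unfolding L_def by blast
  have "us \<noteq> []" "hd us = 0" "last us = L"
    using q(2) by (auto simp: subdivision_def)
  then have ends: "q 0 = a" "q L = b"
    using q(3) joinsD(3,4)[OF \<kappa>b] by (auto simp: hd_map last_map)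
  show thesis
  proof (rule that[OF _ q(1) ends q(2)])
    show "0 \<le> L" by (simp add: L_def len_nonneg)
    show "eps_homotopic X \<epsilon> k (map q us)" using \<kappa>(1) q(3) by simp
    fix s t assume st: "0 \<le> s" "s \<le> t" "t \<le> L" "t - s < \<epsilon>"
    obtain A B where A: "subdivision \<epsilon> 0 s A" and B: "subdivision \<epsilon> t L B"
      using subdivision_exists[OF assms(2)] st by meson
    \<comment> \<open>Going from \<open>s\<close> to \<open>t\<close> in a single step is a
      legitimate subdivision of mesh \<open>\<epsilon>\<close>. The resulting chain stays in the
      class and cannot be shorter than \<open>L\<close>, which forces
      \<open>dist (q s) (q t)\<close> to be the full \<open>t - s\<close>.\<close>
    have M: "subdivision \<epsilon> s t [s, t]" using st assms(2) by (simp add: subdivision_def)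
    note MB = subdivision_concat[OF M B] and AMB = subdivision_concat[OF A subdivision_concat(1)[OF M B]]
    have "eps_homotopic X \<epsilon> (map q us) (map q (A @@ [s, t] @@ B))"
      by (rule map_homotopic_subdivisions[OF lip_curve_modulus[OF q(1)] q(2) AMB(1)])
    then have "L \<le> len (map q (A @@ [s, t] @@ B))"
      using \<kappa> q(3) eps_homotopic_trans unfolding L_def by blast
    also have "\<dots> = len (map q A) + (dist (q s) (q t) + len (map q B))"
    proof -
      have ne: "A \<noteq> []" "B \<noteq> []" "last A = s" "hd B = t" "[s, t] @@ B \<noteq> []" "hd ([s, t] @@ B) = s"
        using A B by (auto simp: subdivision_def chain_concat_def)
      have "len (map q [s, t] @@ map q B) = len (map q [s, t]) + len (map q B)"
        using ne by (intro len_concat) (auto simp: hd_map)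
      moreover have "len (map q A @@ map q ([s, t] @@ B)) = len (map q A) + len (map q ([s, t] @@ B))"
        using ne by (intro len_concat) (auto simp: hd_map last_map)
      ultimately show ?thesis by (simp add: AMB(2) MB(2))
    qed
    also have "len (map q A) \<le> s - 0"
      using len_lipschitz_le[OF lip_curve_subset[OF q(1)], of 0 s A] A subdivision_bounds[OF A] st
      by (auto simp: subdivision_def)
    also have "len (map q B) \<le> L - t"
      using len_lipschitz_le[OF lip_curve_subset[OF q(1)], of t L B] B subdivision_bounds[OF B] st
      by (auto simp: subdivision_def)
    finally have "t - s \<le> dist (q s) (q t)" by simp
    then show "dist (q s) (q t) = t - s" using lip_curveD(2)[OF q(1) st(1-3)] by linarith
  qed
qed

end

lemma locally_length_minimizing_scaled:
  assumes q: "lip_curve X q 0 L" and "0 \<le> L" "0 < \<epsilon>"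
    and iso: "\<And>s t. 0 \<le> s \<Longrightarrow> s \<le> t \<Longrightarrow> t \<le> L \<Longrightarrow> t - s < \<epsilon> \<Longrightarrow> dist (q s) (q t) = t - s"
  shows "locally_length_minimizing X (\<lambda>t. q (L * t))"
  unfolding locally_length_minimizing_def
proof
  fix u :: real assume "u \<in> {0..1}"
  \<comment> \<open>An interval inside \<open>ball u e\<close> is shorter than \<open>2 * e\<close>,
    and its image under scaling by \<open>L\<close> is shorter than \<open>\<epsilon>\<close>, where
    \<open>q\<close> is isometric. Taking \<open>L + 1\<close> in the denominator covers the case
    \<open>L = 0\<close>.\<close>
  define e where "e = \<epsilon> / (2 * (L + 1))"
  have e: "0 < e" "2 * e * L < \<epsilon>" using assms(2,3) by (auto simp: e_def field_simps)
  show "\<exists>e>0. \<forall>a b. a \<le> b \<and> {a..b} \<subseteq> {0..1} \<inter> ball u e \<longrightarrow> length_minimizing X (\<lambda>t. q (L * t)) a b"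
  proof (intro exI[of _ e] conjI allI impI)
    fix a b assume ab: "a \<le> b \<and> {a..b} \<subseteq> {0..1} \<inter> ball u e"
    have "a \<in> {a..b}" "b \<in> {a..b}" using ab by auto
    then have ab': "0 \<le> a" "b \<le> 1" "a \<in> ball u e" "b \<in> ball u e" "a \<le> b" using ab by auto
    have "b - a < 2 * e" using ab'(3,4) by (auto simp: dist_real_def)
    then have "L * (b - a) \<le> L * (2 * e)" using assms(2) by (intro mult_left_mono) auto
    then have small: "L * b - L * a < \<epsilon>" using e(2) by (simp add: algebra_simps)
    have La: "0 \<le> L * a" "L * a \<le> L * b" "L * b \<le> L" using ab' assms(2)
      by (auto intro: mult_left_mono simp: mult_left_le)
    have d: "dist (q (L * a)) (q (L * b)) = L * b - L * a" by (rule iso[OF La small])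
    show "length_minimizing X (\<lambda>t. q (L * t)) a b"
      unfolding length_minimizing_def
    proof (intro allI impI)
      fix h assume h: "path h \<and> path_image h \<subseteq> X \<and> pathstart h = q (L * a) \<and> pathfinish h = q (L * b)"
      have "path_length (\<lambda>t. q (L * t)) a b \<le> ennreal (L * b - L * a)"
        unfolding path_length_eq
      proof (rule SUP_least)
        fix ts assume "ts \<in> {ts. sorted ts \<and> set ts \<subseteq> {a..b}}"
        then have ts: "sorted ts" "set ts \<subseteq> {a..b}" by auto
        have "sorted (map (\<lambda>t. L * t) ts)" "set (map (\<lambda>t. L * t) ts) \<subseteq> {L * a..L * b}"
          using ts assms(2) by (auto simp: sorted_map intro!: mult_left_mono elim!: sorted_wrt_mono_rel[rotated])
        then have "ennreal (len (map q (map (\<lambda>t. L * t) ts))) \<le> path_length q (L * a) (L * b)"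
          by (rule len_le_path_length)
        also have "\<dots> \<le> ennreal (L * b - L * a)"
          using path_length_lipschitz_le[OF lip_curve_subset[OF q La(1,3)] La(2)] .
        finally show "ennreal (len (map (\<lambda>t. q (L * t)) ts)) \<le> ennreal (L * b - L * a)"
          by (simp add: comp_def)
      qed
      also have "\<dots> = ennreal (len (map h [0, 1]))"
        using h d by (simp add: pathstart_def pathfinish_def)
      also have "\<dots> \<le> path_length h 0 1" by (rule len_le_path_length) auto
      finally show "path_length (\<lambda>t. q (L * t)) a b \<le> path_length h 0 1" .
    qed
  qed (rule e)
qed

section \<open>Essential circles\<close>

context pointed_geodesic_set
begin

text \<open>A self-intersection would cut an essential curve into two loops shorter than \<open>3\<delta>\<close>.\<close>

lemma essential_curve_inj:
  assumes "essential_curve \<delta> c"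
  shows "inj_on c {0..<3 * \<delta>}"
proof -
  have c: "0 < \<delta>" "lip_curve X c 0 (3 * \<delta>)" "c (3 * \<delta>) = c 0" "\<not> eps_null X \<delta> (map c (sixths \<delta>))"
    using assms by (auto simp: essential_curve_def)
  have "c s \<noteq> c t" if st: "0 \<le> s" "s < t" "t < 3 * \<delta>" for s t
  proof
    assume eq: "c s = c t"
    obtain A B D where sub: "subdivision \<delta> 0 s A" "subdivision \<delta> s t B" "subdivision \<delta> t (3 * \<delta>) D"
      using subdivision_exists[OF c(1)] st by (meson less_imp_le)
    have lip: "lip_curve X c 0 s" "lip_curve X c s t" "lip_curve X c t (3 * \<delta>)"
      using lip_curve_subset[OF c(2)] st by auto
    note ch = joins_map[OF lip_curve_modulus[OF lip(1)] sub(1)]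
      joins_map[OF lip_curve_modulus[OF lip(2)] sub(2)]
      joins_map[OF lip_curve_modulus[OF lip(3)] sub(3)]
    have chD: "joins X \<delta> (c s) (c 0) (map c D)" using ch(3) eq c(3) by simp
    have "eps_homotopic X \<delta> (map c (sixths \<delta>)) (map c (A @@ B @@ D))"
      by (rule map_homotopic_subdivisions[OF lip_curve_modulus[OF c(2)] subdivision_sixths[OF c(1)]
            subdivision_concat(1)[OF sub(1) subdivision_concat(1)[OF sub(2,3)]]])
    moreover have "map c (A @@ B @@ D) = map c A @@ (map c B @@ map c D)"
      by (simp add: subdivision_concat(2)[OF sub(1) subdivision_concat(1)[OF sub(2,3)]] subdivision_concat(2)[OF sub(2,3)])
    moreover have "eps_homotopic X \<delta> (map c B) [c s]"
      by (rule closed_curve_null[OF lip(2) _ _ eq c(1) sub(2)]) (use st in auto)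
    then have "eps_homotopic X \<delta> (map c B @@ map c D) (map c D)"
      by (rule homotopic_concat_null_left[OF _ chD])
    then have "eps_homotopic X \<delta> (map c A @@ (map c B @@ map c D)) (map c A @@ map c D)"
      using ch(2) eq chD
      by (intro eps_homotopic_concat_between[OF eps_homotopic_refl _ ch(1) joins_concat[of _ _ _ "c s"]])
        (auto intro: joinsD(1)[OF ch(1)])
    moreover have "eps_homotopic X \<delta> (map c A @@ map c D) [c 0]"
    proof (rule short_loop_null[OF joins_concat[OF ch(1) chD] _ c(1)])
      have "len (map c A @@ map c D) = len (map c A) + len (map c D)"
        using joinsD[OF ch(1)] joinsD[OF chD] by (intro len_concat) auto
      moreover have "len (map c A) \<le> s - 0" "len (map c D) \<le> 3 * \<delta> - t"
        using len_lipschitz_le[OF lip(1), of A] len_lipschitz_le[OF lip(3), of D] sub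
          subdivision_bounds[OF sub(1)] subdivision_bounds[OF sub(3)]
        by (auto simp: subdivision_def)
      ultimately show "len (map c A @@ map c D) < 3 * \<delta>" using st by linarith
    qed
    ultimately show False using c(4) eps_homotopic_trans unfolding eps_null_def by metis
  qed
  then show ?thesis by (intro inj_onI) (metis atLeastLessThan_iff linorder_neqE)
qed

lemma essential_curve_arclength:
  assumes "essential_curve \<delta> c"
  shows "arclength_parameterized c 0 (3 * \<delta>)"
proof (rule isometric_arclength_parameterized)
  have \<delta>: "0 < \<delta>" using assms by (simp add: essential_curve_def)
  show "lip_curve X c 0 (3 * \<delta>)" using assms by (simp add: essential_curve_def)
  fix s t assume st: "0 \<le> s" "s \<le> t" "t \<le> 3 * \<delta>"
  \<comment> \<open>The corner times \<open>\<delta>\<close> and \<open>2 * \<delta>\<close> are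
    clamped to the interval from \<open>s\<close> to \<open>t\<close>. Corners outside it give
    pieces of length zero, and each piece lies on one side of the triad.\<close>
  define m1 m2 where "m1 = min t (max s \<delta>)" and "m2 = min t (max s (2 * \<delta>))"
  have iso: "dist (c u) (c v) = v - u"
    if "i \<in> {0, \<delta>, 2 * \<delta>}" "i \<le> u" "u \<le> v" "v \<le> i + \<delta>" for i u v
    using lip_curve_isometric[OF essential_curve_sides(1)[OF assms that(1)]]
      essential_curve_sides(2)[OF assms that(1)] that by simp
  have "dist (c s) (c m1) = m1 - s"
    using iso[of 0 s m1] st \<delta> by (cases "s \<le> \<delta>") (auto simp: m1_def)
  moreover have "dist (c m1) (c m2) = m2 - m1"
    using iso[of \<delta> m1 m2] st \<delta> unfolding m1_def m2_def by (auto simp: min_def max_def)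
  moreover have "dist (c m2) (c t) = t - m2"
    using iso[of "2 * \<delta>" m2 t] st \<delta> unfolding m2_def by (auto simp: min_def max_def)
  ultimately have "t - s \<le> len (map c [s, m1, m2, t])" by simp
  moreover have "sorted [s, m1, m2, t]" "set [s, m1, m2, t] \<subseteq> {s..t}"
    using st \<delta> by (auto simp: m1_def m2_def)
  ultimately show "\<exists>ts. sorted ts \<and> set ts \<subseteq> {s..t} \<and> t - s \<le> len (map c ts)" by blast
qed

lemma essential_curve_circle:
  assumes "essential_curve \<delta> c"
  shows "essential_circle X \<delta> (c ` {0..3 * \<delta>})" "circle_parameterization c \<delta> (c ` {0..3 * \<delta>})"
proof -
  have c: "0 < \<delta>" "c (3 * \<delta>) = c 0" using assms by (auto simp: essential_curve_def)
  have geo: "geodesic X (\<lambda>t. c (i + t)) (c i) (c (i + \<delta>))" if "i \<in> {0, \<delta>, 2 * \<delta>}" for i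
    using lip_curve_geodesic[OF essential_curve_sides(1)[OF assms that]]
      essential_curve_sides(2)[OF assms that] c(1) by simp
  have e: "2 * \<delta> + \<delta> = 3 * \<delta>" "\<delta> + \<delta> = 2 * \<delta>" by simp_all
  have img: "(\<lambda>t. c (i + t)) ` {0..\<delta>} = c ` {i..i + \<delta>}" for i
  proof -
    have "(\<lambda>t. c (i + t)) ` {0..\<delta>} = c ` (+) i ` {0..\<delta>}" unfolding image_image ..
    then show ?thesis by (simp add: add.commute)
  qed
  have "{0..3 * \<delta>} = {0..0 + \<delta>} \<union> {\<delta>..\<delta> + \<delta>} \<union> {2 * \<delta>..2 * \<delta> + \<delta>}" using c(1) by auto
  then have "c ` {0..3 * \<delta>} = (\<lambda>t. c (0 + t)) ` {0..\<delta>} \<union> (\<lambda>t. c (\<delta> + t)) ` {0..\<delta>} \<union> (\<lambda>t. c (2 * \<delta> + t)) ` {0..\<delta>}"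
    unfolding img by (simp add: image_Un)
  moreover have "geodesic X (\<lambda>t. c (0 + t)) (c 0) (c \<delta>)" "geodesic X (\<lambda>t. c (\<delta> + t)) (c \<delta>) (c (2 * \<delta>))"
    "geodesic X (\<lambda>t. c (2 * \<delta> + t)) (c (2 * \<delta>)) (c 0)"
    using geo[of 0] geo[of \<delta>] geo[of "2 * \<delta>"] by (simp_all add: e c(2))
  ultimately show "essential_circle X \<delta> (c ` {0..3 * \<delta>})"
    unfolding essential_circle_def using essential_curve_triad(1)[OF assms] by blast
  show "circle_parameterization c \<delta> (c ` {0..3 * \<delta>})"
    using essential_curve_arclength[OF assms] essential_curve_inj[OF assms] c
    by (simp add: circle_parameterization_def)
qed

end

section \<open>From chains to the fundamental group\<close>

locale pointed_locally_null_set = pointed_geodesic_set + locally_null_set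
begin

lemma chain_path_loop:
  "joins X \<epsilon> a b \<alpha> \<Longrightarrow> path_between X a b (chain_path \<alpha>)"
  using chain_path_between[of \<alpha>] joinsD[of X \<epsilon> a b \<alpha>] by simp

lemma path_class_eqI: "homotopic_paths X f g \<Longrightarrow> path_class X f = path_class X g"
  using path_class_eq_iff[of f X g] homotopic_paths_imp_path[of X f g] homotopic_paths_imp_subset[of X f g] by simp

lemma carrier_pi_1: "carrier (pi_1 X p) = {path_class X f |f. path_between X p p f}"
  by (simp add: pi_1_def path_between_def)

definition to_pi_1 :: "'a list set \<Rightarrow> (real \<Rightarrow> 'a) set" where
  "to_pi_1 A = path_class X (chain_path (SOME \<alpha>. \<alpha> \<in> A))"

lemma to_pi_1_cl:
  assumes "joins X \<epsilon> p p \<alpha>"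
  shows "to_pi_1 (cl \<epsilon> \<alpha>) = path_class X (chain_path \<alpha>)"
proof -
  have "\<alpha> \<in> cl \<epsilon> \<alpha>"
    using joinsD(1)[OF assms] by (simp add: eps_class_def eps_homotopic_refl)
  then have "(SOME \<beta>. \<beta> \<in> cl \<epsilon> \<alpha>) \<in> cl \<epsilon> \<alpha>" by (rule someI)
  then have "eps_homotopic X \<epsilon> \<alpha> (SOME \<beta>. \<beta> \<in> cl \<epsilon> \<alpha>)" by (simp add: eps_class_def)
  from path_class_eqI[OF chain_path_homotopic[OF this]] show ?thesis
    by (simp add: to_pi_1_def)
qed

lemma to_pi_1_hom: "group_hom (\<pi> \<epsilon>) (pi_1 X p) to_pi_1"
proof -
  have "to_pi_1 \<in> hom (\<pi> \<epsilon>) (pi_1 X p)"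
  proof (rule homI)
    fix A assume "A \<in> carrier (\<pi> \<epsilon>)"
    then obtain \<alpha> where \<alpha>: "A = cl \<epsilon> \<alpha>" "joins X \<epsilon> p p \<alpha>" by (auto simp: carrier_pi)
    then show "to_pi_1 A \<in> carrier (pi_1 X p)"
      using to_pi_1_cl chain_path_loop unfolding carrier_pi_1 by blast
    fix B assume "B \<in> carrier (\<pi> \<epsilon>)"
    then obtain \<beta> where \<beta>: "B = cl \<epsilon> \<beta>" "joins X \<epsilon> p p \<beta>" by (auto simp: carrier_pi)
    note ab = joins_concat[OF \<alpha>(2) \<beta>(2)]
    have "homotopic_paths X (chain_path (\<alpha> @@ \<beta>)) (chain_path \<alpha> +++ chain_path \<beta>)"
      using joinsD[OF \<alpha>(2)] joinsD[OF \<beta>(2)] by (intro chain_path_concat) auto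
    moreover have "path_class X (chain_path \<alpha>) \<otimes>\<^bsub>pi_1 X p\<^esub> path_class X (chain_path \<beta>) =
        path_class X (chain_path \<alpha> +++ chain_path \<beta>)"
      using chain_path_loop[OF \<alpha>(2)] chain_path_loop[OF \<beta>(2)]
      by (intro pi_1_mult) (auto simp: path_between_def)
    ultimately show "to_pi_1 (A \<otimes>\<^bsub>\<pi> \<epsilon>\<^esub> B) = to_pi_1 A \<otimes>\<^bsub>pi_1 X p\<^esub> to_pi_1 B"
      using cl_mult[OF \<alpha>(2) \<beta>(2)] to_pi_1_cl[OF ab] to_pi_1_cl[OF \<alpha>(2)] to_pi_1_cl[OF \<beta>(2)] path_class_eqI \<alpha>(1) \<beta>(1)
      by simp
  qed
  then show ?thesis
    using group_pi[OF eps_pos] group_pi_1[OF base_point] by (simp add: group_hom_def group_hom_axioms_def)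
qed

lemma to_pi_1_surj: "to_pi_1 ` carrier (\<pi> \<epsilon>) = carrier (pi_1 X p)"
proof
  interpret group_hom "\<pi> \<epsilon>" "pi_1 X p" to_pi_1 by (rule to_pi_1_hom)
  show "to_pi_1 ` carrier (\<pi> \<epsilon>) \<subseteq> carrier (pi_1 X p)" by auto
  show "carrier (pi_1 X p) \<subseteq> to_pi_1 ` carrier (\<pi> \<epsilon>)"
  proof
    fix F assume "F \<in> carrier (pi_1 X p)"
    then obtain f where f: "F = path_class X f" "path_between X p p f" by (auto simp: carrier_pi_1)
    have cont: "continuous_on {0..1} f" and fX: "f ` {0..1} \<subseteq> X" and ends: "f 0 = p" "f 1 = p"
      using f(2) by (auto simp: path_between_def path_def path_image_def pathstart_def pathfinish_def)
    have "uniformly_continuous_on {0..1} f" using cont by (intro compact_uniformly_continuous) auto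
    then obtain \<eta> where \<eta>: "0 < \<eta>" "\<And>s t. s \<in> {0..1} \<Longrightarrow> t \<in> {0..1} \<Longrightarrow> dist t s < \<eta> \<Longrightarrow> dist (f t) (f s) < \<epsilon>"
      using eps_pos unfolding uniformly_continuous_on_def by meson
    have m: "modulus X \<eta> \<epsilon> f 0 1"
      unfolding modulus_def using fX \<eta>(2) by (auto simp: dist_real_def dist_commute)
    obtain ts where ts: "subdivision \<eta> 0 1 ts" using subdivision_exists[OF \<eta>(1), of 0 1] by auto
    have "f \<circ> linepath 0 1 = f" by (simp add: linepath_def comp_def)
    then have "homotopic_paths X f (chain_path (map f ts))"
      using curve_homotopic_chain_path[OF cont m ts] by simp
    moreover have l: "joins X \<epsilon> p p (map f ts)" using joins_map[OF m ts] ends by simp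
    ultimately have "F = to_pi_1 (cl \<epsilon> (map f ts))"
      using to_pi_1_cl[OF l] path_class_eqI f(1) by simp
    then show "F \<in> to_pi_1 ` carrier (\<pi> \<epsilon>)" using cl_in_carrier[OF l] by blast
  qed
qed

lemma lip_curve_homotopic_chain_path:
  assumes "lip_curve X c 0 l" "subdivision \<epsilon> 0 l ts"
  shows "homotopic_paths X (\<lambda>t. c (l * t)) (chain_path (map c ts))"
proof -
  have "c \<circ> linepath 0 l = (\<lambda>t. c (l * t))" by (simp add: linepath_def comp_def mult.commute)
  then show ?thesis
    using curve_homotopic_chain_path[OF lip_curve_continuous[OF assms(1)] lip_curve_modulus[OF assms(1)] assms(2)]
    by simp
qed

text \<open>Replacing the stick \<open>k\<close> by a shortest curve in its class does not change
  the class of the loop. A single curve \<open>K\<close> serves for both directions because a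
  generating loop returns along the chain on which it came.\<close>

lemma generating_loop_lollipop:
  assumes "compact X" "generating_loop \<epsilon> \<nu>"
  shows "\<exists>\<gamma>. geodesic_lollipop X p \<gamma> \<and> path_class X \<gamma> = to_pi_1 (cl \<epsilon> \<nu>)"
proof -
  obtain \<delta> c ts k where \<nu>: "\<epsilon> \<le> \<delta>" "essential_curve \<delta> c" "subdivision \<epsilon> 0 (3 * \<delta>) ts"
    "joins X \<epsilon> p (c 0) k" "\<nu> = k @@ map c ts @@ rev k"
    using assms(2) by (auto simp: generating_loop_def)
  have \<delta>: "0 < \<delta>" and lip: "lip_curve X c 0 (3 * \<delta>)" and c3: "c (3 * \<delta>) = c 0"
    using \<nu>(2) by (auto simp: essential_curve_def)
  obtain L q us where q: "0 \<le> L" "lip_curve X q 0 L" "q 0 = p" "q L = c 0" "subdivision \<epsilon> 0 L us"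
    "eps_homotopic X \<epsilon> k (map q us)"
    "\<And>s t. 0 \<le> s \<Longrightarrow> s \<le> t \<Longrightarrow> t \<le> L \<Longrightarrow> t - s < \<epsilon> \<Longrightarrow> dist (q s) (q t) = t - s"
    using shortest_curve[OF assms(1) eps_pos \<nu>(4)] by blast
  define K C where "K = (\<lambda>t. q (L * t))" and "C = (\<lambda>t. c (3 * \<delta> * t))"
  define \<gamma> where "\<gamma> = K +++ C +++ reversepath K"
  have Kk: "homotopic_paths X K (chain_path k)"
    using lip_curve_homotopic_chain_path[OF q(2,5)] chain_path_homotopic[OF q(6)]
      homotopic_paths_sym homotopic_paths_trans unfolding K_def by blast
  have Cc: "homotopic_paths X C (chain_path (map c ts))"
    using lip_curve_homotopic_chain_path[OF lip \<nu>(3)] unfolding C_def .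
  have m: "joins X \<epsilon> (c 0) (c 0) (map c ts)"
    using joins_map[OF lip_curve_modulus[OF lip] \<nu>(3)] c3 by simp
  note r = joins_rev[OF \<nu>(4)]
  have Rk: "homotopic_paths X (reversepath K) (chain_path (rev k))"
    using chain_path_rev[OF \<nu>(4)] Kk homotopic_paths_reversepath path_homotopic_equiv by blast
  have bet: "path_between X p (c 0) K" "path_between X (c 0) (c 0) C" "path_between X (c 0) p (reversepath K)"
    using path_between_homotopic[OF chain_path_loop[OF \<nu>(4)] homotopic_paths_sym[OF Kk]]
      path_between_homotopic[OF chain_path_loop[OF m] homotopic_paths_sym[OF Cc]]
    by (auto intro: path_between_reverse)
  have "homotopic_paths X (C +++ reversepath K) (chain_path (map c ts) +++ chain_path (rev k))"
    by (rule path_homotopic_join[OF Cc Rk bet(2,3)])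
  moreover have "homotopic_paths X (chain_path (map c ts @@ rev k)) (chain_path (map c ts) +++ chain_path (rev k))"
    using joinsD[OF m] joinsD[OF r] by (intro chain_path_concat) auto
  ultimately have "homotopic_paths X (C +++ reversepath K) (chain_path (map c ts @@ rev k))"
    using path_homotopic_equiv by blast
  then have "homotopic_paths X \<gamma> (chain_path k +++ chain_path (map c ts @@ rev k))"
    unfolding \<gamma>_def by (rule path_homotopic_join[OF Kk _ bet(1) path_between_join[OF bet(2,3)]])
  moreover have "homotopic_paths X (chain_path \<nu>) (chain_path k +++ chain_path (map c ts @@ rev k))"
    unfolding \<nu>(5) using joinsD[OF \<nu>(4)] joinsD[OF joins_concat[OF m r]]
    by (intro chain_path_concat) auto
  ultimately have "homotopic_paths X \<gamma> (chain_path \<nu>)"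
    using path_homotopic_equiv by blast
  then have "path_class X \<gamma> = to_pi_1 (cl \<epsilon> \<nu>)"
    using path_class_eqI to_pi_1_cl[OF generating_loop_between[OF assms(2)]] by simp
  moreover have "lollipop X p K \<gamma>"
    unfolding lollipop_def
  proof (intro conjI exI[of _ \<delta>] exI[of _ "c ` {0..3 * \<delta>}"] exI[of _ c])
    show "\<gamma> = K +++ (\<lambda>t. c (3 * \<delta> * t)) +++ reversepath K" by (simp add: \<gamma>_def C_def)
  qed (use bet(1) \<delta> essential_curve_circle[OF \<nu>(2)] in \<open>auto simp: path_between_def\<close>)
  moreover have "locally_length_minimizing X K"
    unfolding K_def by (rule locally_length_minimizing_scaled[OF q(2,1) eps_pos q(7)])
  ultimately show ?thesis unfolding geodesic_lollipop_def by blast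
qed

proposition finite_lollipops:
  assumes "compact X"
  shows "\<exists>\<Gamma>. finite \<Gamma> \<and> (\<forall>\<gamma>\<in>\<Gamma>. geodesic_lollipop X p \<gamma>) \<and>
    generate (pi_1 X p) (path_class X ` \<Gamma>) = carrier (pi_1 X p)"
proof -
  interpret group_hom "\<pi> \<epsilon>" "pi_1 X p" to_pi_1 by (rule to_pi_1_hom)
  obtain \<Lambda> where \<Lambda>: "finite \<Lambda>" "\<And>\<nu>. \<nu> \<in> \<Lambda> \<Longrightarrow> generating_loop \<epsilon> \<nu>"
    "generate (\<pi> \<epsilon>) (cl \<epsilon> ` \<Lambda>) = carrier (\<pi> \<epsilon>)"
    using finite_generating_loops[OF assms eps_pos] by blast
  have "\<forall>\<nu>\<in>\<Lambda>. \<exists>\<gamma>. geodesic_lollipop X p \<gamma> \<and> path_class X \<gamma> = to_pi_1 (cl \<epsilon> \<nu>)"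
    using \<Lambda>(2) generating_loop_lollipop[OF assms] by blast
  then obtain \<gamma> where \<gamma>: "\<And>\<nu>. \<nu> \<in> \<Lambda> \<Longrightarrow> geodesic_lollipop X p (\<gamma> \<nu>) \<and> path_class X (\<gamma> \<nu>) = to_pi_1 (cl \<epsilon> \<nu>)"
    by metis
  have "path_class X ` \<gamma> ` \<Lambda> = to_pi_1 ` cl \<epsilon> ` \<Lambda>"
    unfolding image_image using \<gamma> by (intro image_cong) auto
  moreover have "cl \<epsilon> ` \<Lambda> \<subseteq> carrier (\<pi> \<epsilon>)"
    using \<Lambda>(2) generating_loop_between cl_in_carrier by blast
  ultimately have "generate (pi_1 X p) (path_class X ` \<gamma> ` \<Lambda>) = carrier (pi_1 X p)"
    using generate_img[of "cl \<epsilon> ` \<Lambda>"] \<Lambda>(3) to_pi_1_surj by simp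
  then show ?thesis using \<Lambda>(1) \<gamma> by (intro exI[of _ "\<gamma> ` \<Lambda>"]) auto
qed

end

theorem theorem25:
  fixes X :: "'a::metric_space set" and p :: 'a and \<epsilon> :: real
  assumes "compact X" and "geodesic_space X" and "p \<in> X" and "\<epsilon> > 0"
  shows "(trivial_group (pi_eps X \<epsilon> p) \<or>
           (\<exists>\<Lambda>. finite \<Lambda> \<and>
              (\<forall>\<nu>\<in>\<Lambda>. \<exists>\<delta>\<ge>\<epsilon>. \<exists>\<mu>. lollichain X p \<delta> \<mu> \<and> eps_refinement X \<epsilon> \<mu> \<nu>) \<and>
              generate (pi_eps X \<epsilon> p) (eps_class X \<epsilon> ` \<Lambda>) = carrier (pi_eps X \<epsilon> p))) \<and>
         (semilocally_simply_connected X \<and> \<not> simply_connected X \<longrightarrow>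
           (\<exists>\<Lambda>. finite \<Lambda> \<and> (\<forall>\<gamma>\<in>\<Lambda>. geodesic_lollipop X p \<gamma>) \<and>
              generate (pi_1 X p) (path_class X ` \<Lambda>) = carrier (pi_1 X p)))"
proof (intro conjI impI disjI2)
  interpret pointed_geodesic_set X p
    by unfold_locales (use assms in auto)
  obtain \<Lambda> where \<Lambda>: "finite \<Lambda>" "\<And>\<nu>. \<nu> \<in> \<Lambda> \<Longrightarrow> generating_loop \<epsilon> \<nu>"
    "generate (\<pi> \<epsilon>) (cl \<epsilon> ` \<Lambda>) = carrier (\<pi> \<epsilon>)"
    using finite_generating_loops[OF assms(1,4)] by blast
  then show "\<exists>\<Lambda>. finite \<Lambda> \<and> (\<forall>\<nu>\<in>\<Lambda>. \<exists>\<delta>\<ge>\<epsilon>. \<exists>\<mu>. lollichain X p \<delta> \<mu> \<and> eps_refinement X \<epsilon> \<mu> \<nu>) \<and>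
      generate (pi_eps X \<epsilon> p) (eps_class X \<epsilon> ` \<Lambda>) = carrier (pi_eps X \<epsilon> p)"
    using generating_loop_refines_lollichain by (intro exI[of _ \<Lambda>]) auto
  assume "semilocally_simply_connected X \<and> \<not> simply_connected X"
  \<comment> \<open>The scale \<open>\<eta>\<close> is dictated by \<open>X\<close> alone and is
    unrelated to the given \<open>\<epsilon>\<close>.\<close>
  then obtain \<eta> where "locally_null_set X \<eta>"
    using locally_null_exists[OF assms(1,2)] by blast
  then interpret null: locally_null_set X \<eta> .
  interpret null: pointed_locally_null_set X p \<eta> by unfold_locales
  show "\<exists>\<Lambda>. finite \<Lambda> \<and> (\<forall>\<gamma>\<in>\<Lambda>. geodesic_lollipop X p \<gamma>) \<and>
      generate (pi_1 X p) (path_class X ` \<Lambda>) = carrier (pi_1 X p)"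
    by (rule null.finite_lollipops[OF assms(1)])
qed

end
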